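(* Let $\Omega\subset\mathbb{R}^3$ be a bounded smooth domain, $a\in W^{1,\infty}(\Omega)$ with $a\ge 0$, $T>0$, and $(u_0,u_1)\in H_0^1(\Omega)\times L^2(\Omega)$. Suppose $u$ and $v$ are two solutions of $$u_{tt}-\Delta u-\operatorname{div}(a(x)\nabla u_t)+u^5=0 \text{ in } \Omega\times(0,T),\quad u=0 \text{ on } \partial\Omega\times(0,T),\quad u(0)=u_0,\ u_t(0)=u_1,$$ in the energy space $C([0,T];H_0^1(\Omega))\cap C^1([0,T];L^2(\Omega))$ with the same initial data. If in addition $u,v\in L^4(0,T;L^{12}(\Omega))$, then $u\equiv v$ on $[0,T]$.
   Context: Solutions are understood in the weak (distributional) sense. *)

theory Defs
  imports "HOL-Analysis.Analysis"
begin

fun dderiv :: "'a::euclidean_space list \<Rightarrow> ('a \<Rightarrow> real) \<Rightarrow> 'a \<Rightarrow> real" where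
  "dderiv [] f = f"
| "dderiv (v # vs) f = (\<lambda>x. deriv (\<lambda>t. dderiv vs f (x + t *\<^sub>R v)) 0)"

definition smooth :: "('a::euclidean_space \<Rightarrow> real) \<Rightarrow> bool" where
  "smooth f \<longleftrightarrow>
     (\<forall>vs. set vs \<subseteq> Basis \<longrightarrow>
        continuous_on UNIV (dderiv vs f) \<and>
        (\<forall>v\<in>Basis. \<forall>x. (\<lambda>t. dderiv vs f (x + t *\<^sub>R v)) differentiable (at 0)))"

definition test_fun :: "'a::euclidean_space set \<Rightarrow> ('a \<Rightarrow> real) \<Rightarrow> bool" where
  "test_fun U \<phi> \<longleftrightarrow> smooth \<phi> \<and> (\<exists>K. compact K \<and> K \<subseteq> U \<and> (\<forall>x. x \<notin> K \<longrightarrow> \<phi> x = 0))"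

definition partial :: "'n::finite \<Rightarrow> (real^'n \<Rightarrow> real) \<Rightarrow> real^'n \<Rightarrow> real" where
  "partial i f = dderiv [axis i 1] f"

definition cgrad :: "(real^'n::finite \<Rightarrow> real) \<Rightarrow> real^'n \<Rightarrow> real^'n" where
  "cgrad f x = (\<chi> i. partial i f x)"

definition smooth_domain :: "(real^'n::finite) set \<Rightarrow> bool" where
  "smooth_domain \<Omega> \<longleftrightarrow> open \<Omega> \<and> connected \<Omega> \<and> \<Omega> \<noteq> {} \<and> bounded \<Omega> \<and>
     (\<forall>p\<in>frontier \<Omega>. \<exists>r>0. \<exists>\<rho>. smooth \<rho> \<and>
        \<Omega> \<inter> ball p r = {x \<in> ball p r. \<rho> x < 0} \<and>
        (\<forall>x\<in>ball p r. \<rho> x = 0 \<longrightarrow> cgrad \<rho> x \<noteq> 0))"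

definition L2 :: "'a::euclidean_space set \<Rightarrow> ('a \<Rightarrow> real) \<Rightarrow> bool" where
  "L2 U f \<longleftrightarrow> f \<in> borel_measurable (lebesgue_on U) \<and> integrable (lebesgue_on U) (\<lambda>x. (f x)\<^sup>2)"

definition L2vec :: "'a::euclidean_space set \<Rightarrow> ('a \<Rightarrow> 'b::euclidean_space) \<Rightarrow> bool" where
  "L2vec U g \<longleftrightarrow> g \<in> borel_measurable (lebesgue_on U) \<and> integrable (lebesgue_on U) (\<lambda>x. (norm (g x))\<^sup>2)"

definition L2sq :: "'a::euclidean_space set \<Rightarrow> ('a \<Rightarrow> real) \<Rightarrow> real" where
  "L2sq U f = (\<integral>x. (f x)\<^sup>2 \<partial>lebesgue_on U)"

definition L2vsq :: "'a::euclidean_space set \<Rightarrow> ('a \<Rightarrow> 'b::euclidean_space) \<Rightarrow> real" where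
  "L2vsq U g = (\<integral>x. (norm (g x))\<^sup>2 \<partial>lebesgue_on U)"

definition loc_integrable :: "'a::euclidean_space set \<Rightarrow> ('a \<Rightarrow> real) \<Rightarrow> bool" where
  "loc_integrable U f \<longleftrightarrow> f \<in> borel_measurable (lebesgue_on U) \<and>
     (\<forall>K. compact K \<and> K \<subseteq> U \<longrightarrow> integrable (lebesgue_on K) f)"

definition weak_grad :: "(real^'n::finite) set \<Rightarrow> (real^'n \<Rightarrow> real) \<Rightarrow> (real^'n \<Rightarrow> real^'n) \<Rightarrow> bool" where
  "weak_grad U w g \<longleftrightarrow> loc_integrable U w \<and> (\<forall>i. loc_integrable U (\<lambda>x. g x $ i)) \<and>
     (\<forall>\<phi> i. test_fun U \<phi> \<longrightarrow>
        (\<integral>x. w x * partial i \<phi> x \<partial>lebesgue_on U) = - (\<integral>x. g x $ i * \<phi> x \<partial>lebesgue_on U))"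

definition H01 :: "(real^'n::finite) set \<Rightarrow> (real^'n \<Rightarrow> real) \<Rightarrow> bool" where
  "H01 U w \<longleftrightarrow> L2 U w \<and> (\<exists>g. weak_grad U w g \<and> L2vec U g \<and>
     (\<exists>\<phi>s. (\<forall>n. test_fun U (\<phi>s n)) \<and>
        ((\<lambda>n. L2sq U (\<lambda>x. \<phi>s n x - w x) + L2vsq U (\<lambda>x. cgrad (\<phi>s n) x - g x)) \<longlonglongrightarrow> 0)))"

definition W1inf :: "(real^'n::finite) set \<Rightarrow> (real^'n \<Rightarrow> real) \<Rightarrow> bool" where
  "W1inf U a \<longleftrightarrow> a \<in> borel_measurable (lebesgue_on U) \<and>
     (\<exists>C. AE x in lebesgue_on U. \<bar>a x\<bar> \<le> C) \<and>
     (\<exists>g C. weak_grad U a g \<and> g \<in> borel_measurable (lebesgue_on U) \<and>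
        (AE x in lebesgue_on U. norm (g x) \<le> C))"

definition dt :: "((real^'n::finite) \<times> real \<Rightarrow> real) \<Rightarrow> (real^'n) \<times> real \<Rightarrow> real" where
  "dt \<phi> = dderiv [(0, 1)] \<phi>"

definition gradx :: "((real^'n::finite) \<times> real \<Rightarrow> real) \<Rightarrow> (real^'n) \<times> real \<Rightarrow> real^'n" where
  "gradx \<phi> p = (\<chi> i. dderiv [(axis i 1, 0)] \<phi> p)"

text \<open>Weak (distributional) solution of
  u_tt - \<Delta>u - div(a \<nabla>u_t) + u^5 = 0 in \<Omega> x (0,T), u = 0 on the boundary,
  u(0) = u0, u_t(0) = u1, in the energy space C([0,T];H^1_0) \<inter> C^1([0,T];L^2).
  G t is the weak gradient of u t and U1 t the L^2-time derivative of u.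
  Distributional form: for all test functions \<phi> on \<Omega> x (0,T),
  \<integral>\<integral> u \<phi>_tt + \<nabla>u\<cdot>\<nabla>\<phi> - a \<nabla>u\<cdot>\<nabla>\<phi>_t + u^5 \<phi> = 0.\<close>
definition energy_solution ::
  "(real^3) set \<Rightarrow> (real^3 \<Rightarrow> real) \<Rightarrow> real \<Rightarrow> (real^3 \<Rightarrow> real) \<Rightarrow> (real^3 \<Rightarrow> real)
     \<Rightarrow> (real \<Rightarrow> real^3 \<Rightarrow> real) \<Rightarrow> bool" where
  "energy_solution \<Omega> a T u0 u1 u \<longleftrightarrow>
    (\<exists>G U1.
      (\<forall>t\<in>{0..T}. H01 \<Omega> (u t) \<and> weak_grad \<Omega> (u t) (G t) \<and> L2vec \<Omega> (G t) \<and> L2 \<Omega> (U1 t)) \<and>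
      (\<forall>t\<in>{0..T}. ((\<lambda>s. L2sq \<Omega> (\<lambda>x. u s x - u t x) + L2vsq \<Omega> (\<lambda>x. G s x - G t x))
                      \<longlongrightarrow> 0) (at t within {0..T})) \<and>
      (\<forall>t\<in>{0..T}. ((\<lambda>s. L2sq \<Omega> (\<lambda>x. U1 s x - U1 t x)) \<longlongrightarrow> 0) (at t within {0..T})) \<and>
      (\<forall>t\<in>{0..T}. ((\<lambda>s. L2sq \<Omega> (\<lambda>x. (u s x - u t x) / (s - t) - U1 t x))
                      \<longlongrightarrow> 0) (at t within {0..T})) \<and>
      (AE x in lebesgue_on \<Omega>. u 0 x = u0 x) \<and>
      (AE x in lebesgue_on \<Omega>. U1 0 x = u1 x) \<and>
      (\<forall>\<phi>. test_fun (\<Omega> \<times> {0<..<T}) \<phi> \<longrightarrow>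
         (\<integral>t. (\<integral>x. u t x * dt (dt \<phi>) (x, t) + G t x \<bullet> gradx \<phi> (x, t)
                      - a x * (G t x \<bullet> gradx (dt \<phi>) (x, t)) + (u t x) ^ 5 * \<phi> (x, t)
                  \<partial>lebesgue_on \<Omega>) \<partial>lebesgue_on {0..T}) = 0))"

definition L4_L12 :: "(real^3) set \<Rightarrow> real \<Rightarrow> (real \<Rightarrow> real^3 \<Rightarrow> real) \<Rightarrow> bool" where
  "L4_L12 \<Omega> T u \<longleftrightarrow>
     (AE t in lebesgue_on {0..T}. u t \<in> borel_measurable (lebesgue_on \<Omega>) \<and>
                                 integrable (lebesgue_on \<Omega>) (\<lambda>x. \<bar>u t x\<bar> powr 12)) \<and>
     integrable (lebesgue_on {0..T}) (\<lambda>t. (\<integral>x. \<bar>u t x\<bar> powr 12 \<partial>lebesgue_on \<Omega>) powr (1/3))"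

end

theory Submission
  imports Defs
begin

text \<open>
  Let \<open>w = u - v\<close>. The function \<open>w\<^sub>t\<close> is not an admissible test function, since \<open>a \<nabla>w\<^sub>t\<close> need not
  make sense. The equation is therefore integrated once in time,
  \<open>\<langle>w\<^sub>t(r), \<psi>\<rangle> + \<langle>a \<nabla>w(r), \<nabla>\<psi>\<rangle> + \<integral>\<^sub>0\<^sup>r (\<langle>\<nabla>w, \<nabla>\<psi>\<rangle> + \<langle>u\<^sup>5 - v\<^sup>5, \<psi>\<rangle>) = 0\<close>,
  and tested with \<open>\<psi> = w(r)\<close>, which does lie in \<open>H01\<close>. Integrating over \<open>r \<in> [0,s]\<close> and writing
  \<open>\<zeta>(s) = \<integral>\<^sub>0\<^sup>s w\<close>, the term with \<open>a \<ge> 0\<close> has a good sign and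
  \<open>|w(s)|\<^sup>2 + |\<nabla>\<zeta>(s)|\<^sup>2 \<le> -2 \<integral>\<^sub>0\<^sup>s \<langle>(u\<^sup>5 - v\<^sup>5)(\<tau>), \<zeta>(s) - \<zeta>(\<tau>)\<rangle> d\<tau>\<close>.
  By Hoelder with exponents 3, 2, 6 and the Sobolev inequality, the integrand is at most a constant times
  \<open>(|u(\<tau>)|\<^sub>1\<^sub>2\<^sup>4 + |v(\<tau>)|\<^sub>1\<^sub>2\<^sup>4) |w(\<tau>)| (|\<nabla>\<zeta>(s)| + |\<nabla>\<zeta>(\<tau>)|)\<close> with \<open>L\<^sup>2\<close> norms on the right,
  and the first factor is integrable in time, so a Gronwall argument gives \<open>w = 0\<close>.

  No space of vector-valued functions is needed: \<open>|\<nabla>\<zeta>(s)|\<^sup>2\<close> is the double integral \<open>N(s)\<close> of the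
  scalar kernel \<open>k(t,t') = \<langle>\<nabla>w(t), \<nabla>w(t')\<rangle>\<close>, and the estimate of \<open>\<langle>\<cdot>, \<zeta>(s)\<rangle>\<close> is obtained from
  Riemann sums of \<open>w\<close>.
\<close>

section \<open>Smooth functions\<close>

text \<open>The energy obtained controls \<open>w\<close> and the gradient of its primitive \<zeta>,
  but never the gradient of \<open>w\<close> itself. The nonlinear term arises as an integral of
  \<langle>(u^5 - v^5)(\<tau>), w(t)\<rangle> over \<tau> \<le> t \<le> s, and the order of
  integration has to be exchanged so that the integral in t falls on w and yields \<zeta>(s) -
  \<zeta>(\<tau>). The exponents fit exactly: L^12 puts u^4 into L^3, 1/3 + 1/2 + 1/6 = 1 with 6 the
  Sobolev exponent, and the exponent 4 in time makes the fourth power of the L^12 norm integrable.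
  The L^12 bound holds only for almost every time. At every time, H01 contained in L^6 already makes
  the pairing with u^5 finite and uniformly bounded; passing from test functions to H01 and Fubini
  rest on this. Since the estimate involves s and \<tau> at once, the Gronwall argument is run at a
  maximum point of the energy on a short interval. The weak form sees only interior times, so the
  initial data enter through continuity at time 0.\<close>

lemma dderiv_append: "dderiv (vs @ ws) f = dderiv vs (dderiv ws f)"
  by (induction vs) auto

text \<open>A coinduction principle: \<open>dderiv\<close> applies the head of the list last, so a
  class that is stable under a single basis derivative contains all iterated ones. It replaces
  closed formulas for higher derivatives of products and compositions.\<close>

lemma smooth_coinduct:
  assumes "P f"
    and step: "\<And>f. P f \<Longrightarrow> continuous_on UNIV f \<and>
      (\<forall>v\<in>Basis. \<exists>f'. P f' \<and> (\<forall>x. ((\<lambda>t. f (x + t *\<^sub>R v)) has_real_derivative f' x) (at 0)))"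
  shows "smooth f"
proof -
  have P: "P (dderiv vs f)" if "set vs \<subseteq> Basis" for vs
    using that
  proof (induction vs)
    case Nil
    then show ?case using assms(1) by simp
  next
    case (Cons v vs)
    then have "P (dderiv vs f)" "v \<in> Basis" by auto
    then obtain f' where f': "P f'"
      "\<And>x. ((\<lambda>t. dderiv vs f (x + t *\<^sub>R v)) has_real_derivative f' x) (at 0)"
      using step by blast
    then have "dderiv (v # vs) f = f'"
      by (auto intro!: DERIV_imp_deriv)
    then show ?case using f' by simp
  qed
  show ?thesis
    unfolding smooth_def
    using step[OF P] by (meson real_differentiable_def)
qed

lemma smooth_continuous: "smooth f \<Longrightarrow> continuous_on UNIV f"
  unfolding smooth_def by (metis dderiv.simps(1) empty_iff empty_set subsetI)

lemma smooth_has_dderiv: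
  assumes "smooth f" "v \<in> Basis"
  shows "((\<lambda>t. f (x + t *\<^sub>R v)) has_real_derivative dderiv [v] f x) (at 0)"
proof -
  have "(\<lambda>t. dderiv [] f (x + t *\<^sub>R v)) differentiable (at 0)"
    using assms unfolding smooth_def by (metis empty_iff empty_set subsetI)
  then show ?thesis
    by (simp add: DERIV_deriv_iff_real_differentiable)
qed

lemma smooth_dderiv:
  assumes "smooth f" "v \<in> Basis" shows "smooth (dderiv [v] f)"
  unfolding smooth_def
proof (intro allI impI)
  fix vs :: "'a list" assume "set vs \<subseteq> Basis"
  then have "set (vs @ [v]) \<subseteq> Basis" using assms by auto
  then have "continuous_on UNIV (dderiv (vs @ [v]) f) \<and>
        (\<forall>u\<in>Basis. \<forall>x. (\<lambda>t. dderiv (vs @ [v]) f (x + t *\<^sub>R u)) differentiable (at 0))"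
    using assms(1) unfolding smooth_def by blast
  then show "continuous_on UNIV (dderiv vs (dderiv [v] f)) \<and>
        (\<forall>u\<in>Basis. \<forall>x. (\<lambda>t. dderiv vs (dderiv [v] f) (x + t *\<^sub>R u)) differentiable (at 0))"
    unfolding dderiv_append .
qed

lemma smooth_has_dderiv_at:
  assumes "smooth f" "v \<in> Basis"
  shows "((\<lambda>t. f (x + t *\<^sub>R v)) has_real_derivative dderiv [v] f (x + s *\<^sub>R v)) (at s)"
proof -
  have "((\<lambda>t. f (x + s *\<^sub>R v + t *\<^sub>R v)) has_real_derivative dderiv [v] f (x + s *\<^sub>R v)) (at 0)"
    by (rule smooth_has_dderiv[OF assms])
  then have "((\<lambda>t. f (x + (t + s) *\<^sub>R v)) has_real_derivative dderiv [v] f (x + s *\<^sub>R v)) (at 0)"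
    by (simp add: algebra_simps)
  then show ?thesis
    using DERIV_shift[of "\<lambda>t. f (x + t *\<^sub>R v)" _ 0 s] by simp
qed

declare dderiv.simps(2) [simp del]

text \<open>The derivative of a product is no longer a product but a sum of products. Closing under
  both operations gives a class that is stable under differentiation, as
  \<open>smooth_coinduct\<close> requires.\<close>

inductive smooth_algebra :: "('a::euclidean_space \<Rightarrow> real) \<Rightarrow> bool" where
  base: "smooth f \<Longrightarrow> smooth_algebra f"
| add: "smooth_algebra f \<Longrightarrow> smooth_algebra g \<Longrightarrow> smooth_algebra (\<lambda>x. f x + g x)"
| mult: "smooth_algebra f \<Longrightarrow> smooth_algebra g \<Longrightarrow> smooth_algebra (\<lambda>x. f x * g x)"

lemma smooth_algebra_smooth:
  assumes "smooth_algebra f" shows "smooth f"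
proof (rule smooth_coinduct[of smooth_algebra, OF assms])
  fix f :: "'a \<Rightarrow> real" assume "smooth_algebra f"
  then show "continuous_on UNIV f \<and>
      (\<forall>v\<in>Basis. \<exists>f'. smooth_algebra f' \<and>
         (\<forall>x. ((\<lambda>t. f (x + t *\<^sub>R v)) has_real_derivative f' x) (at 0)))"
  proof induction
    case (base f)
    then show ?case
      by (blast intro: smooth_continuous smooth_algebra.base smooth_dderiv smooth_has_dderiv)
  next
    case (add f g)
    show ?case
    proof (intro conjI ballI)
      fix v :: 'a assume v: "v \<in> Basis"
      then obtain f' g' where *: "smooth_algebra f'" "smooth_algebra g'"
        "\<And>x. ((\<lambda>t. f (x + t *\<^sub>R v)) has_real_derivative f' x) (at 0)"
        "\<And>x. ((\<lambda>t. g (x + t *\<^sub>R v)) has_real_derivative g' x) (at 0)"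
        using add by metis
      then show "\<exists>h. smooth_algebra h \<and> (\<forall>x. ((\<lambda>t. f (x + t *\<^sub>R v) + g (x + t *\<^sub>R v))
          has_real_derivative h x) (at 0))"
        by (intro exI[of _ "\<lambda>x. f' x + g' x"]) (auto intro!: smooth_algebra.add DERIV_add)
    qed (use add in \<open>auto intro: continuous_intros\<close>)
  next
    case (mult f g)
    show ?case
    proof (intro conjI ballI)
      fix v :: 'a assume v: "v \<in> Basis"
      then obtain f' g' where *: "smooth_algebra f'" "smooth_algebra g'"
        "\<And>x. ((\<lambda>t. f (x + t *\<^sub>R v)) has_real_derivative f' x) (at 0)"
        "\<And>x. ((\<lambda>t. g (x + t *\<^sub>R v)) has_real_derivative g' x) (at 0)"
        using mult by metis
      have "((\<lambda>t. f (x + t *\<^sub>R v) * g (x + t *\<^sub>R v))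
          has_real_derivative f' x * g x + g' x * f x) (at 0)" for x
        using DERIV_mult[OF *(3)[of x] *(4)[of x]] by simp
      then show "\<exists>h. smooth_algebra h \<and> (\<forall>x. ((\<lambda>t. f (x + t *\<^sub>R v) * g (x + t *\<^sub>R v))
          has_real_derivative h x) (at 0))"
        using mult * by (intro exI[of _ "\<lambda>x. f' x * g x + g' x * f x"])
            (auto intro!: smooth_algebra.add smooth_algebra.mult)
    qed (use mult in \<open>auto intro: continuous_intros\<close>)
  qed
qed

lemma smooth_const: "smooth (\<lambda>x. c)"
proof (rule smooth_coinduct[of "\<lambda>f. \<exists>c. f = (\<lambda>x. c)"])
  fix f :: "'a \<Rightarrow> real" assume "\<exists>c. f = (\<lambda>x. c)"
  then show "continuous_on UNIV f \<and> (\<forall>v\<in>Basis. \<exists>f'. (\<exists>c. f' = (\<lambda>x. c)) \<and>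
       (\<forall>x. ((\<lambda>t. f (x + t *\<^sub>R v)) has_real_derivative f' x) (at 0)))"
    by (auto intro!: exI[of _ "\<lambda>x. 0"])
qed auto

lemma smooth_add: "smooth f \<Longrightarrow> smooth g \<Longrightarrow> smooth (\<lambda>x. f x + g x)"
  by (blast intro: smooth_algebra_smooth smooth_algebra.intros)

lemma smooth_mult: "smooth f \<Longrightarrow> smooth g \<Longrightarrow> smooth (\<lambda>x. f x * g x)"
  by (blast intro: smooth_algebra_smooth smooth_algebra.intros)

lemma smooth_cmult: "smooth f \<Longrightarrow> smooth (\<lambda>x. c * f x)"
  by (intro smooth_mult smooth_const)

lemma smooth_diff: "smooth f \<Longrightarrow> smooth g \<Longrightarrow> smooth (\<lambda>x. f x - g x)"
  using smooth_add[of f "\<lambda>x. -1 * g x"] smooth_cmult[of g "-1"] by simp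

lemma smooth_prod:
  assumes "finite I" "\<And>i. i \<in> I \<Longrightarrow> smooth (f i)"
  shows "smooth (\<lambda>x. \<Prod>i\<in>I. f i x)"
  using assms by (induction I rule: finite_induct) (auto intro: smooth_const smooth_mult)

text \<open>Along \<open>b\<close> the derivative is again such a composition; along any other basis
  vector it is 0, the composition with a zero function.\<close>

lemma smooth_comp_inner:
  fixes b :: "'a::euclidean_space"
  assumes "smooth \<theta>" "b \<in> Basis" shows "smooth (\<lambda>x. \<theta> (x \<bullet> b))"
proof (rule smooth_coinduct[of "\<lambda>f. (\<exists>\<theta>. smooth \<theta> \<and> f = (\<lambda>x. \<theta> (x \<bullet> b)))"])
  fix f :: "'a \<Rightarrow> real" assume "\<exists>\<theta>. smooth \<theta> \<and> f = (\<lambda>x. \<theta> (x \<bullet> b))"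
  then obtain \<theta> where \<theta>: "smooth \<theta>" "f = (\<lambda>x. \<theta> (x \<bullet> b))" by blast
  have "continuous_on UNIV f"
    unfolding \<theta>(2)
    by (rule continuous_on_compose2[OF smooth_continuous[OF \<theta>(1)]]) (auto intro: continuous_intros)
  moreover have "\<exists>f'. (\<exists>\<theta>. smooth \<theta> \<and> f' = (\<lambda>x. \<theta> (x \<bullet> b))) \<and>
       (\<forall>x. ((\<lambda>t. f (x + t *\<^sub>R v)) has_real_derivative f' x) (at 0))" if v: "v \<in> Basis" for v
  proof (cases "v = b")
    case True
    have "((\<lambda>t. \<theta> (x + t *\<^sub>R 1)) has_real_derivative dderiv [1] \<theta> x) (at 0)" for x
      by (rule smooth_has_dderiv[OF \<theta>(1)]) simp
    then show ?thesis
      using True assms(2) \<theta> smooth_dderiv[OF \<theta>(1), of 1]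
      by (intro exI[of _ "\<lambda>x. dderiv [1] \<theta> (x \<bullet> b)"]) (auto simp: inner_add_left)
  next
    case False
    then have "v \<bullet> b = 0" using v assms(2) by (auto simp: inner_Basis)
    then show ?thesis
      by (intro exI[of _ "\<lambda>x. 0"]) (auto simp: \<theta> inner_add_left intro: exI[of _ "\<lambda>x. 0"] smooth_const)
  qed
  ultimately show "continuous_on UNIV f \<and> (\<forall>v\<in>Basis. \<exists>f'. (\<exists>\<theta>. smooth \<theta> \<and> f' = (\<lambda>x. \<theta> (x \<bullet> b))) \<and>
       (\<forall>x. ((\<lambda>t. f (x + t *\<^sub>R v)) has_real_derivative f' x) (at 0)))" by blast
qed (use assms in blast)

lemma smooth_comp_fst:
  fixes \<psi> :: "'a::euclidean_space \<Rightarrow> real"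
  assumes "smooth \<psi>" shows "smooth (\<lambda>p::'a \<times> 'b::euclidean_space. \<psi> (fst p))"
proof (rule smooth_coinduct[of "\<lambda>f. (\<exists>\<psi>. smooth \<psi> \<and> f = (\<lambda>p. \<psi> (fst p)))"])
  fix f :: "'a \<times> 'b \<Rightarrow> real" assume "\<exists>\<psi>. smooth \<psi> \<and> f = (\<lambda>p. \<psi> (fst p))"
  then obtain \<psi> where \<psi>: "smooth \<psi>" "f = (\<lambda>p. \<psi> (fst p))" by blast
  have "continuous_on UNIV f"
    unfolding \<psi>(2)
    by (rule continuous_on_compose2[OF smooth_continuous[OF \<psi>(1)]]) (auto intro: continuous_intros)
  moreover have "\<exists>f'. (\<exists>\<psi>. smooth \<psi> \<and> f' = (\<lambda>p. \<psi> (fst p))) \<and>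
       (\<forall>x. ((\<lambda>t. f (x + t *\<^sub>R v)) has_real_derivative f' x) (at 0))" if v: "v \<in> Basis" for v
  proof (cases "snd v = 0")
    case True
    then have "fst v \<in> Basis" using v unfolding Basis_prod_def by auto
    then show ?thesis
      using smooth_has_dderiv[OF \<psi>(1), of "fst v"] \<psi> smooth_dderiv[OF \<psi>(1), of "fst v"]
      by (intro exI[of _ "\<lambda>p. dderiv [fst v] \<psi> (fst p)"]) auto
  next
    case False
    then have "fst v = 0" using v unfolding Basis_prod_def by auto
    then show ?thesis
      by (intro exI[of _ "\<lambda>x. 0"]) (auto simp: \<psi> intro: exI[of _ "\<lambda>x. 0"] smooth_const)
  qed
  ultimately show "continuous_on UNIV f \<and> (\<forall>v\<in>Basis. \<exists>f'. (\<exists>\<psi>. smooth \<psi> \<and> f' = (\<lambda>p. \<psi> (fst p))) \<and>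
       (\<forall>x. ((\<lambda>t. f (x + t *\<^sub>R v)) has_real_derivative f' x) (at 0)))" by blast
qed (use assms in blast)

lemma smooth_comp_snd:
  fixes \<theta> :: "real \<Rightarrow> real"
  assumes "smooth \<theta>" shows "smooth (\<lambda>p::'a::euclidean_space \<times> real. \<theta> (snd p))"
  using smooth_comp_inner[OF assms, of "(0::'a, 1::real)"] by (simp add: Basis_prod_def inner_prod_def)

lemma smooth_real_has_derivative:
  fixes \<theta> :: "real \<Rightarrow> real"
  assumes "smooth \<theta>" shows "(\<theta> has_real_derivative dderiv [1] \<theta> t) (at t)"
  using smooth_has_dderiv_at[OF assms, of 1 0 t] by simp

lemma smooth_comp_affine:
  fixes \<theta> :: "real \<Rightarrow> real"
  assumes "smooth \<theta>" shows "smooth (\<lambda>t. \<theta> (c * t + d))"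
proof -
  \<comment> \<open>Every differentiation brings out a factor \<open>c\<close>, so the class has to
    carry a constant \<open>k\<close>; the given function is the case \<open>k = 1\<close>.\<close>
  have "smooth (\<lambda>t. 1 * \<theta> (c * t + d))"
  proof (rule smooth_coinduct[of "\<lambda>f. (\<exists>k \<theta>. smooth \<theta> \<and> f = (\<lambda>t. k * \<theta> (c * t + d)))"])
    fix f :: "real \<Rightarrow> real" assume "\<exists>k \<theta>. smooth \<theta> \<and> f = (\<lambda>t. k * \<theta> (c * t + d))"
    then obtain k \<theta> where \<theta>: "smooth \<theta>" "f = (\<lambda>t. k * \<theta> (c * t + d))" by blast
    have "continuous_on UNIV f"
      unfolding \<theta>(2)
      by (intro continuous_on_mult continuous_on_const
          continuous_on_compose2[OF smooth_continuous[OF \<theta>(1)]]) (auto intro!: continuous_intros)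
    moreover have "((\<lambda>t. f (x + t)) has_real_derivative (k * c) * dderiv [1] \<theta> (c * x + d)) (at 0)" for x
    proof -
      have "((\<lambda>t. \<theta> (c * (x + t) + d)) has_real_derivative dderiv [1] \<theta> (c * (x + 0) + d) * c) (at 0)"
        by (rule DERIV_chain2[OF smooth_real_has_derivative[OF \<theta>(1)]]) (auto intro!: derivative_eq_intros)
      from DERIV_cmult[OF this, of k] show ?thesis by (simp add: \<theta>(2) mult_ac)
    qed
    moreover have "smooth (dderiv [1] \<theta>)" using smooth_dderiv[OF \<theta>(1)] by simp
    ultimately show "continuous_on UNIV f \<and> (\<forall>v\<in>Basis. \<exists>f'. (\<exists>k \<theta>. smooth \<theta> \<and> f' = (\<lambda>t. k * \<theta> (c * t + d))) \<and>
       (\<forall>x. ((\<lambda>t. f (x + t *\<^sub>R v)) has_real_derivative f' x) (at 0)))"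
      by simp blast
  qed (use assms in blast)
  then show ?thesis by simp
qed

section \<open>Cut-off functions and test functions\<close>

lemma tendsto_poly_exp_neg: "((\<lambda>y. poly p y * exp (- y)) \<longlongrightarrow> (0::real)) at_top"
proof -
  have "((\<lambda>y. \<Sum>i\<le>degree p. coeff p i * (y ^ i / exp y)) \<longlongrightarrow> (\<Sum>i\<le>degree p. coeff p i * 0)) at_top"
    by (intro tendsto_intros tendsto_power_div_exp_0)
  moreover have "(\<Sum>i\<le>degree p. coeff p i * (y ^ i / exp y)) = poly p y * exp (- y)" for y
    by (simp add: poly_altdef sum_distrib_right exp_minus divide_inverse mult.assoc)
  ultimately show ?thesis by simp
qed

text \<open>A class of flat functions closed under differentiation that contains \<open>exp (-1/t)\<close>.\<close>

definition flat_poly :: "real poly \<Rightarrow> real \<Rightarrow> real" where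
  "flat_poly p t = (if t \<le> 0 then 0 else poly p (1/t) * exp (- (1/t)))"

text \<open>With y = 1/t one has dy/dt = - y^2, so p(y) exp(-y) becomes y^2 (p - p')(y) exp(-y); the
  factor \<open>[:0,0,1:]\<close> is y^2. At 0 from the right the difference quotient is y p(y)
  exp(-y), hence \<open>pCons 0 p\<close>, and it decays as y tends to infinity.\<close>

lemma flat_poly_has_derivative:
  "(flat_poly p has_real_derivative flat_poly ([:0,0,1:] * (p - pderiv p)) x) (at x)"
proof -
  consider "x < 0" | "x = 0" | "x > 0" by linarith
  then show ?thesis
  proof cases
    case 1
    have "((\<lambda>x. 0) has_real_derivative 0) (at x)" by simp
    then have "(flat_poly p has_real_derivative 0) (at x)"
      by (rule has_field_derivative_transform_within_open[of _ _ _ "{..<0}"])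
        (use 1 in \<open>auto simp: flat_poly_def\<close>)
    then show ?thesis using 1 by (simp add: flat_poly_def)
  next
    case 2
    have R: "((\<lambda>h. (flat_poly p (0 + h) - flat_poly p 0) / h) \<longlongrightarrow> 0) (at_right 0)"
    proof -
      have "((\<lambda>h. poly (pCons 0 p) (inverse h) * exp (- inverse h)) \<longlongrightarrow> (0::real)) (at_right 0)"
        by (rule filterlim_compose[OF tendsto_poly_exp_neg filterlim_inverse_at_top_right])
      moreover have "eventually (\<lambda>h::real. poly (pCons 0 p) (inverse h) * exp (- inverse h) =
          (flat_poly p (0 + h) - flat_poly p 0) / h) (at_right 0)"
        by (auto simp: eventually_at_right_field flat_poly_def divide_simps intro!: exI[of _ 1])
      ultimately show ?thesis by (rule Lim_transform_eventually)
    qed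
    have L: "((\<lambda>h. (flat_poly p (0 + h) - flat_poly p 0) / h) \<longlongrightarrow> 0) (at_left 0)"
    proof -
      have "eventually (\<lambda>h::real. 0 = (flat_poly p (0 + h) - flat_poly p 0) / h) (at_left 0)"
        by (auto simp: eventually_at_left_field flat_poly_def intro!: exI[of _ "-1"])
      then show ?thesis by (rule Lim_transform_eventually[OF tendsto_const])
    qed
    have "((\<lambda>h. (flat_poly p (0 + h) - flat_poly p 0) / h) \<longlongrightarrow> 0) (at 0)"
      using filterlim_split_at[OF L R] .
    then show ?thesis using 2 unfolding DERIV_def by (simp add: flat_poly_def)
  next
    case 3
    have "((\<lambda>t. poly p (1/t) * exp (- (1/t))) has_real_derivative
        flat_poly ([:0,0,1:] * (p - pderiv p)) x) (at x)"
    proof -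
      have 1: "((\<lambda>t. 1 / t) has_real_derivative - (1/x) * (1/x)) (at x)"
        using 3 by (auto intro!: derivative_eq_intros simp: field_simps)
      have 2: "((\<lambda>t. poly p (1/t)) has_real_derivative poly (pderiv p) (1/x) * (- (1/x) * (1/x))) (at x)"
        by (rule DERIV_chain2[OF poly_DERIV 1])
      have 4: "((\<lambda>t. exp (- (1/t))) has_real_derivative exp (- (1/x)) * - (- (1/x) * (1/x))) (at x)"
        by (rule DERIV_chain2[OF DERIV_exp DERIV_minus[OF 1]])
      show ?thesis
        by (rule DERIV_cong[OF DERIV_mult[OF 2 4]]) (use 3 in \<open>simp add: flat_poly_def field_simps\<close>)
    qed
    then show ?thesis
      by (rule has_field_derivative_transform_within_open[of _ _ _ "{0<..}"])
        (use 3 in \<open>auto simp: flat_poly_def\<close>)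
  qed
qed

text \<open>Adding \<open>g\<close> to the smooth functions keeps the class stable, since the
  derivative of \<open>g\<close> lies in it already.\<close>

lemma smooth_antiderivative:
  fixes g :: "real \<Rightarrow> real"
  assumes "\<And>t. (g has_real_derivative h t) (at t)" "smooth h"
  shows "smooth g"
proof (rule smooth_coinduct[of "\<lambda>f. smooth f \<or> f = g"])
  fix f :: "real \<Rightarrow> real" assume f: "smooth f \<or> f = g"
  show "continuous_on UNIV f \<and> (\<forall>v\<in>Basis. \<exists>f'. (smooth f' \<or> f' = g) \<and>
       (\<forall>x. ((\<lambda>t. f (x + t *\<^sub>R v)) has_real_derivative f' x) (at 0)))"
  proof (cases "smooth f")
    case True
    then show ?thesis
      by (blast intro: smooth_continuous smooth_dderiv smooth_has_dderiv)
  next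
    case False
    then have [simp]: "f = g" using f by simp
    have "((\<lambda>t. g (x + t)) has_real_derivative h x) (at 0)" for x
      using assms(1)[of x] DERIV_shift[of g "h x" 0 x] by (simp add: add.commute)
    then show ?thesis
      using assms by (auto intro!: exI[of _ h] continuous_at_imp_continuous_on DERIV_isCont)
  qed
qed simp

lemma smooth_flat_poly: "smooth (flat_poly p)"
proof (rule smooth_coinduct[of "\<lambda>f. \<exists>p. f = flat_poly p"])
  fix f :: "real \<Rightarrow> real" assume "\<exists>p. f = flat_poly p"
  then obtain p where p: "f = flat_poly p" by blast
  have "continuous_on UNIV f"
    unfolding p
    by (intro continuous_at_imp_continuous_on ballI DERIV_isCont[OF flat_poly_has_derivative])
  moreover have "((\<lambda>t. f (x + t)) has_real_derivative flat_poly ([:0,0,1:] * (p - pderiv p)) x) (at 0)" for x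
    using flat_poly_has_derivative[of p x]
      DERIV_shift[of "flat_poly p" _ 0 x] by (simp add: p add.commute)
  ultimately show "continuous_on UNIV f \<and> (\<forall>v\<in>Basis. \<exists>f'. (\<exists>p. f' = flat_poly p) \<and>
       (\<forall>x. ((\<lambda>t. f (x + t *\<^sub>R v)) has_real_derivative f' x) (at 0)))"
    by (auto simp del: mult_pCons_left)
qed blast

text \<open>The normalised primitive of a bump supported in [0,1]. The sign of the derivative is
  recorded because its rescalings serve below as nonnegative mollifiers in time.\<close>

lemma smooth_step_exists:
  "\<exists>\<eta>::real \<Rightarrow> real. smooth \<eta> \<and> (\<forall>t\<le>0. \<eta> t = 0) \<and> (\<forall>t\<ge>1. \<eta> t = 1) \<and>
    (\<forall>t. 0 \<le> \<eta> t) \<and> (\<forall>t. \<eta> t \<le> 1) \<and> (\<forall>t. dderiv [1] \<eta> t \<ge> 0)"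
proof -
  define \<rho> where "\<rho> = (\<lambda>t. flat_poly 1 t * flat_poly 1 (1 - t))"
  have sm: "smooth \<rho>"
    using smooth_mult[OF smooth_flat_poly[of 1] smooth_comp_affine[OF smooth_flat_poly[of 1], of "-1" 1]]
    by (simp add: \<rho>_def)
  have cont: "continuous_on A \<rho>" for A
    using smooth_continuous[OF sm] continuous_on_subset by blast
  have int: "\<rho> integrable_on {a..b}" for a b
    by (rule integrable_continuous_real[OF cont])
  have nn: "\<rho> t \<ge> 0" for t by (simp add: \<rho>_def flat_poly_def)
  have out: "\<rho> t = 0" if "t \<le> 0 \<or> t \<ge> 1" for t using that by (auto simp: \<rho>_def flat_poly_def)
  \<comment> \<open>Starting at -1, where \<rho> vanishes already, makes every t \<ge> 0 an interior
    point of {-1..t+1}, so that the derivative within the interval is a full derivative.\<close>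
  define I where "I t = integral {-1..t} \<rho>" for t
  have der: "(I has_real_derivative \<rho> t) (at t)" for t
  proof (cases "t < 0")
    case True
    have "((\<lambda>x. 0) has_real_derivative 0) (at t)" by simp
    moreover have "I x = 0" if "x \<in> {..<0}" for x
      unfolding I_def by (rule integral_unique has_integral_is_0)+
        (use that out in auto)
    ultimately have "(I has_real_derivative 0) (at t)"
      using has_field_derivative_transform_within_open[of "\<lambda>x. 0" 0 t "{..<0}" I] True by auto
    then show ?thesis using True out by simp
  next
    case False
    have "((\<lambda>x. integral {-1..x} \<rho>) has_real_derivative \<rho> t) (at t within {-1..t+1})"
      by (rule integral_has_real_derivative[OF cont]) (use False in auto)
    then show ?thesis
      using False at_within_interior[of t "{-1..t+1}"] unfolding I_def by simp
  qed
  have mono: "I s \<le> I t" if "s \<le> t" for s t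
    unfolding I_def by (rule integral_subset_le) (use that int nn in auto)
  have I0: "I t = 0" if "t \<le> 0" for t
    unfolding I_def by (rule integral_unique has_integral_is_0)+ (use that out in auto)
  have I1: "I t = I 1" if "t \<ge> 1" for t
  proof -
    have "integral {1..t} \<rho> = 0" by (rule integral_unique has_integral_is_0)+ (use out in auto)
    then show ?thesis
      unfolding I_def using Henstock_Kurzweil_Integration.integral_combine[OF _ that int[of "-1" t]] by simp
  qed
  have "I 1 \<noteq> 0"
  proof
    assume "I 1 = 0"
    then have "\<rho> (1/2) = 0"
      unfolding I_def using integral_eq_0_iff[OF cont, of "-1" 1] nn by auto
    then show False by (simp add: \<rho>_def flat_poly_def)
  qed
  with mono[of 0 1] I0[of 0] have pos: "I 1 > 0" by simp
  have inn: "I t \<ge> 0" for t using mono[of 0 t] mono[of t 0] I0[of 0] I0[of t] by linarith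
  have ile: "I t \<le> I 1" for t using mono[of t 1] I1[of t] by linarith
  define \<eta> where "\<eta> t = I t / I 1" for t
  have der': "(\<eta> has_real_derivative \<rho> t / I 1) (at t)" for t
    unfolding \<eta>_def by (rule DERIV_cdivide[OF der])
  have "smooth (\<lambda>t. (1 / I 1) * \<rho> t)" by (rule smooth_cmult[OF sm])
  then have "smooth (\<lambda>t. \<rho> t / I 1)" by simp
  from smooth_antiderivative[OF der' this] have sme: "smooth \<eta>" .
  have "dderiv [1] \<eta> t = \<rho> t / I 1" for t
    using DERIV_unique[OF smooth_real_has_derivative[OF sme] der'] .
  then have "dderiv [1] \<eta> t \<ge> 0" for t using nn[of t] pos by simp
  moreover have "\<eta> t = 0" if "t \<le> 0" for t using I0[OF that] by (simp add: \<eta>_def)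
  moreover have "\<eta> t = 1" if "t \<ge> 1" for t using I1[OF that] pos by (simp add: \<eta>_def)
  moreover have "\<eta> t \<ge> 0" "\<eta> t \<le> 1" for t using inn[of t] ile[of t] pos by (simp_all add: \<eta>_def)
  ultimately show ?thesis using sme by blast
qed

section \<open>Operations on test functions\<close>

lemma test_funD:
  assumes "test_fun U \<phi>"
  shows "smooth \<phi>" "continuous_on UNIV \<phi>" "\<phi> \<in> borel_measurable borel" "x \<notin> U \<Longrightarrow> \<phi> x = 0"
  using assms smooth_continuous[of \<phi>]
  by (auto simp: test_fun_def intro: borel_measurable_continuous_onI)

text \<open>Off the compact set \<open>K\<close> the function vanishes on an open set, so the same
  \<open>K\<close> serves for the derivative.\<close>

lemma test_fun_dderiv:
  assumes "test_fun U \<phi>" "v \<in> Basis" shows "test_fun U (dderiv [v] \<phi>)"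
proof -
  obtain K where K: "compact K" "K \<subseteq> U" "\<And>x. x \<notin> K \<Longrightarrow> \<phi> x = 0" and sm: "smooth \<phi>"
    using assms(1) unfolding test_fun_def by blast
  have "dderiv [v] \<phi> x = 0" if x: "x \<notin> K" for x
  proof -
    have op: "open ((\<lambda>t. x + t *\<^sub>R v) -` (- K))"
      by (intro open_vimage) (auto simp: compact_imp_closed[OF K(1)] intro!: continuous_intros)
    have "((\<lambda>t. 0) has_real_derivative 0) (at 0)" by simp
    then have "((\<lambda>t. \<phi> (x + t *\<^sub>R v)) has_real_derivative 0) (at 0)"
      by (rule has_field_derivative_transform_within_open[OF _ op]) (use x K in auto)
    then show ?thesis
      using DERIV_unique smooth_has_dderiv[OF sm assms(2)] by blast
  qed
  then show ?thesis
    unfolding test_fun_def using K smooth_dderiv[OF sm assms(2)] by blast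
qed

lemma test_fun_add:
  assumes "test_fun U f" "test_fun U g" shows "test_fun U (\<lambda>x. f x + g x)"
proof -
  obtain K L where "compact K" "K \<subseteq> U" "\<forall>x. x \<notin> K \<longrightarrow> f x = 0" "compact L" "L \<subseteq> U" "\<forall>x. x \<notin> L \<longrightarrow> g x = 0"
    using assms unfolding test_fun_def by metis
  then have "compact (K \<union> L) \<and> K \<union> L \<subseteq> U \<and> (\<forall>x. x \<notin> K \<union> L \<longrightarrow> f x + g x = 0)" by auto
  then show ?thesis
    using assms smooth_add unfolding test_fun_def by blast
qed

lemma test_fun_cmult: "test_fun U f \<Longrightarrow> test_fun U (\<lambda>x. c * f x)"
  unfolding test_fun_def using smooth_cmult mult_zero_right by metis

lemma test_fun_bounded:
  assumes "test_fun U \<phi>" obtains B where "B \<ge> 0" "\<And>x. \<bar>\<phi> x\<bar> \<le> B"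
proof -
  obtain K where K: "compact K" "\<And>x. x \<notin> K \<Longrightarrow> \<phi> x = 0"
    using assms unfolding test_fun_def by blast
  have "compact (\<phi> ` K)"
    using K(1) test_funD(2)[OF assms] compact_continuous_image continuous_on_subset by blast
  then obtain B where "\<And>x. x \<in> K \<Longrightarrow> \<bar>\<phi> x\<bar> \<le> B"
    using compact_imp_bounded bounded_real by (metis image_eqI)
  then have "\<bar>\<phi> x\<bar> \<le> max B 0" for x using K(2)[of x] by (cases "x \<in> K") (auto simp: le_max_iff_disj)
  then show ?thesis using that[of "max B 0"] by simp
qed

lemma dderiv_add:
  assumes "smooth f" "smooth g" "v \<in> Basis"
  shows "dderiv [v] (\<lambda>x. f x + g x) x = dderiv [v] f x + dderiv [v] g x"
  using DERIV_unique[OF smooth_has_dderiv[OF smooth_add[OF assms(1,2)] assms(3), of x]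
      DERIV_add[OF smooth_has_dderiv[OF assms(1,3), of x] smooth_has_dderiv[OF assms(2,3), of x]]] .

lemma dderiv_cmult:
  assumes "smooth f" "v \<in> Basis"
  shows "dderiv [v] (\<lambda>x. c * f x) x = c * dderiv [v] f x"
  using DERIV_unique[OF smooth_has_dderiv[OF smooth_cmult[OF assms(1)] assms(2), where x = x]
      DERIV_cmult[OF smooth_has_dderiv[OF assms, of x], of c]] .

lemma cgrad_add: "smooth f \<Longrightarrow> smooth g \<Longrightarrow> cgrad (\<lambda>x. f x + g x) x = cgrad f x + cgrad g x"
  by (simp add: cgrad_def partial_def dderiv_add axis_in_Basis_iff vec_eq_iff)

lemma cgrad_cmult: "smooth f \<Longrightarrow> cgrad (\<lambda>x. c * f x) x = c *\<^sub>R cgrad f x"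
  by (simp add: cgrad_def partial_def dderiv_cmult axis_in_Basis_iff vec_eq_iff)

lemma test_fun_partial: "test_fun U \<phi> \<Longrightarrow> test_fun U (partial i \<phi>)"
  unfolding partial_def by (intro test_fun_dderiv) (auto simp: axis_in_Basis_iff)

text \<open>The distributional equation is tested with such products only; for each fixed spatial
  factor they turn it into a scalar equation in time.\<close>

lemma test_fun_tensor:
  fixes \<psi> :: "real^'n::finite \<Rightarrow> real" and \<theta> :: "real \<Rightarrow> real"
  assumes "test_fun U \<psi>" "test_fun J \<theta>"
  shows "test_fun (U \<times> J) (\<lambda>p. \<psi> (fst p) * \<theta> (snd p))"
proof -
  obtain K L where "compact K" "K \<subseteq> U" "\<forall>x. x \<notin> K \<longrightarrow> \<psi> x = 0" "compact L" "L \<subseteq> J" "\<forall>x. x \<notin> L \<longrightarrow> \<theta> x = 0"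
    using assms unfolding test_fun_def by metis
  then have "compact (K \<times> L) \<and> K \<times> L \<subseteq> U \<times> J \<and> (\<forall>p. p \<notin> K \<times> L \<longrightarrow> \<psi> (fst p) * \<theta> (snd p) = 0)"
    by (auto intro: compact_Times)
  then show ?thesis
    using smooth_mult[OF smooth_comp_fst[OF test_funD(1)[OF assms(1)]] smooth_comp_snd[OF test_funD(1)[OF assms(2)]]]
    unfolding test_fun_def by blast
qed

lemma dt_tensor:
  fixes \<psi> :: "real^'n::finite \<Rightarrow> real"
  assumes "smooth \<theta>"
  shows "dt (\<lambda>p. \<psi> (fst p) * \<theta> (snd p)) = (\<lambda>p. \<psi> (fst p) * dderiv [1] \<theta> (snd p))"
proof
  fix p :: "(real^'n) \<times> real"
  have "((\<lambda>t. \<psi> (fst p) * \<theta> (snd p + t *\<^sub>R 1)) has_real_derivative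
     \<psi> (fst p) * dderiv [1] \<theta> (snd p)) (at 0)"
    by (intro DERIV_cmult smooth_has_dderiv assms) auto
  from DERIV_imp_deriv[OF this]
  show "dt (\<lambda>p. \<psi> (fst p) * \<theta> (snd p)) p = \<psi> (fst p) * dderiv [1] \<theta> (snd p)"
    by (simp add: dt_def dderiv.simps)
qed

lemma gradx_tensor:
  fixes \<psi> :: "real^'n::finite \<Rightarrow> real"
  assumes "smooth \<psi>"
  shows "gradx (\<lambda>p. \<psi> (fst p) * \<theta> (snd p)) (x, t) = \<theta> t *\<^sub>R cgrad \<psi> x"
proof -
  have "((\<lambda>h. \<psi> (x + h *\<^sub>R axis i 1) * \<theta> t) has_real_derivative
     dderiv [axis i 1] \<psi> x * \<theta> t) (at 0)" for i
    by (intro DERIV_cmult_right smooth_has_dderiv assms) (auto simp: axis_in_Basis_iff)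
  from DERIV_imp_deriv[OF this]
  show ?thesis by (simp add: gradx_def cgrad_def partial_def vec_eq_iff dderiv.simps)
qed

section \<open>The fundamental lemma of the calculus of variations\<close>

lemma box_indicator_approx:
  fixes c d :: "'a::euclidean_space"
  shows "\<exists>\<phi> :: nat \<Rightarrow> 'a \<Rightarrow> real. (\<forall>n. smooth (\<phi> n)) \<and> (\<forall>n x. x \<notin> cbox c d \<longrightarrow> \<phi> n x = 0) \<and>
    (\<forall>n x. \<bar>\<phi> n x\<bar> \<le> 1) \<and> (\<forall>x. (\<lambda>n. \<phi> n x) \<longlonglongrightarrow> indicator (box c d) x)"
proof -
  obtain \<eta> :: "real \<Rightarrow> real" where \<eta>: "smooth \<eta>" "\<And>t. t \<le> 0 \<Longrightarrow> \<eta> t = 0" "\<And>t. t \<ge> 1 \<Longrightarrow> \<eta> t = 1"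
    "\<And>t. 0 \<le> \<eta> t" "\<And>t. \<eta> t \<le> 1" "\<And>t. dderiv [1] \<eta> t \<ge> 0"
    using smooth_step_exists by metis
  \<comment> \<open>Two steps per coordinate, rescaled by \<open>n\<close>, rising from the lower
    face and falling towards the upper one. Since the step vanishes for nonpositive arguments, every
    \<phi> n is already zero on the faces, so the limit is the indicator of the open box.\<close>
  define \<phi> where "\<phi> n x = (\<Prod>b\<in>Basis. \<eta> (real n * (x \<bullet> b) + - (real n * (c \<bullet> b))) * \<eta> (- real n * (x \<bullet> b) + real n * (d \<bullet> b)))"
    for n and x :: 'a
  have sm: "smooth (\<phi> n)" for n
    unfolding \<phi>_def
    by (intro smooth_prod smooth_mult smooth_comp_inner[OF smooth_comp_affine[OF \<eta>(1)]]) auto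
  have z: "\<phi> n x = 0" if b: "b \<in> Basis" "x \<bullet> b \<le> c \<bullet> b \<or> x \<bullet> b \<ge> d \<bullet> b" for n x b
  proof -
    have "real n * (x \<bullet> b) + - (real n * (c \<bullet> b)) \<le> 0 \<or> - real n * (x \<bullet> b) + real n * (d \<bullet> b) \<le> 0"
      using b(2) by (auto intro: mult_left_mono)
    then show ?thesis
      unfolding \<phi>_def by (intro prod_zero finite_Basis bexI[OF _ b(1)]) (use \<eta>(2) in auto)
  qed
  have "\<phi> n x = 0" if "x \<notin> cbox c d" for n x
  proof -
    have "\<exists>b\<in>Basis. \<not> (x \<bullet> b \<ge> c \<bullet> b \<and> x \<bullet> b \<le> d \<bullet> b)"
      using that unfolding mem_box(2) by blast
    then obtain b where "b \<in> Basis" "\<not> (x \<bullet> b \<ge> c \<bullet> b \<and> x \<bullet> b \<le> d \<bullet> b)" ..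
    then show ?thesis using z[of b x n] by linarith
  qed
  moreover have "\<bar>\<phi> n x\<bar> \<le> 1" for n x
    unfolding \<phi>_def abs_prod by (intro prod_le_1) (auto simp: abs_mult \<eta> intro!: mult_le_one)
  moreover have "(\<lambda>n. \<phi> n x) \<longlonglongrightarrow> indicator (box c d) x" for x
  proof (cases "x \<in> box c d")
    case False
    then have "\<exists>b\<in>Basis. \<not> (x \<bullet> b > c \<bullet> b \<and> x \<bullet> b < d \<bullet> b)"
      unfolding mem_box(1) by blast
    then obtain b where "b \<in> Basis" "\<not> (x \<bullet> b > c \<bullet> b \<and> x \<bullet> b < d \<bullet> b)" ..
    then have "\<phi> n x = 0" for n using z[of b x n] by linarith
    then show ?thesis using False by simp
  next
    case True
    have lim1: "(\<lambda>n. \<eta> (real n * e)) \<longlonglongrightarrow> 1" if "e > 0" for e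
    proof -
      have "eventually (\<lambda>n. real n * e \<ge> 1) sequentially"
      proof -
        obtain N :: nat where N: "real N > 1 / e" using reals_Archimedean2 by blast
        show ?thesis
        proof (rule eventually_sequentiallyI[of N])
          fix n assume "N \<le> n"
          then have "real n > 1 / e" using N by (meson less_le_trans of_nat_le_iff)
          then show "real n * e \<ge> 1" using that by (simp add: field_simps)
        qed
      qed
      then have "eventually (\<lambda>n. 1 = \<eta> (real n * e)) sequentially"
        by (rule eventually_mono) (use \<eta>(3) in auto)
      then show ?thesis by (rule Lim_transform_eventually[OF tendsto_const])
    qed
    have "(\<lambda>n. \<phi> n x) \<longlonglongrightarrow> (\<Prod>b\<in>(Basis::'a set). 1 * 1)"
      unfolding \<phi>_def
    proof (intro tendsto_prod tendsto_mult)
      fix b :: 'a assume "b \<in> Basis"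
      then have *: "x \<bullet> b - c \<bullet> b > 0" "d \<bullet> b - x \<bullet> b > 0" using True by (auto simp: mem_box)
      show "(\<lambda>n. \<eta> (real n * (x \<bullet> b) + - (real n * (c \<bullet> b)))) \<longlonglongrightarrow> 1"
        using lim1[OF *(1)] by (simp add: algebra_simps)
      show "(\<lambda>n. \<eta> (- real n * (x \<bullet> b) + real n * (d \<bullet> b))) \<longlonglongrightarrow> 1"
        using lim1[OF *(2)] by (simp add: algebra_simps)
    qed
    then show ?thesis using True by simp
  qed
  ultimately show ?thesis using sm by blast
qed

text \<open>Uniqueness of densities asks for all measurable sets. The sets with zero integral form a
  Dynkin class, the total integral supplying complements, and boxes are stable under intersection,
  so all Borel sets are reached. A Lebesgue set differs from a Borel set by a null set.\<close>

lemma AE_zero_if_box_integrals_zero: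
  fixes k :: "'a::euclidean_space \<Rightarrow> real"
  assumes k: "integrable lebesgue k" and tot: "(\<integral>x. k x \<partial>lebesgue) = 0"
    and box: "\<And>l u. (\<integral>x. indicator (box l u) x * k x \<partial>lebesgue) = 0"
  shows "AE x in lebesgue. k x = 0"
proof (rule density_unique_real[OF k integrable_zero])
  have int: "integrable lebesgue (\<lambda>x. indicator A x * k x)" if "A \<in> sets lebesgue" for A
    using integrable_mult_indicator[OF that k] by simp
  have B: "(\<integral>x. indicator A x * k x \<partial>lebesgue) = 0" if "A \<in> sets borel" for A
  proof -
    let ?G = "range (\<lambda>(a, b). box a b :: 'a set)"
    have sig: "sets borel = sigma_sets UNIV ?G"
      by (subst borel_eq_box) simp
    have st: "Int_stable ?G"
      unfolding Int_stable_def by (auto simp: box_Int_box)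
    show ?thesis
    proof (induction A rule: sigma_sets_induct_disjoint[OF st, of UNIV, case_names G A basic empty compl union])
      case A
      then show ?case using that sig by simp
    next
      case (basic A)
      then show ?case using box by auto
    next
      case (compl A)
      then have A: "A \<in> sets lebesgue" using sig by auto
      have "(\<integral>x. indicator (UNIV - A) x * k x \<partial>lebesgue) = (\<integral>x. k x - indicator A x * k x \<partial>lebesgue)"
        by (intro Bochner_Integration.integral_cong) (auto simp: indicator_def)
      also have "\<dots> = 0" using compl int[OF A] k tot by simp
      finally show ?case .
    next
      case (union A)
      then have "A i \<in> sets borel" for i using sig by (metis range_subsetD)
      then have A: "A i \<in> sets lebesgue" for i by simp
      have UA: "(\<Union>i. A i) \<in> sets lebesgue" using A by auto
      have "(LINT x:(\<Union>i. A i)|lebesgue. k x) = (\<Sum>i. (LINT x:(A i)|lebesgue. k x))"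
        by (intro lebesgue_integral_countable_add[OF A])
          (use union(1) int[OF UA] in \<open>auto simp: disjoint_family_on_def set_integrable_def\<close>)
      then show ?case using union(3) by (simp add: set_lebesgue_integral_def)
    qed auto
  qed
  fix A :: "'a set" assume A: "A \<in> sets lebesgue"
  then obtain S N N' where S: "A = S \<union> N" "N \<subseteq> N'" "N' \<in> null_sets lborel" "S \<in> sets lborel"
    by (rule sets_completionE)
  have "AE x in lebesgue. indicator A x * k x = indicator S x * k x"
  proof (rule AE_I')
    show "N' \<in> null_sets lebesgue" using S(3) by (simp add: null_sets_completionI)
    show "{x \<in> space lebesgue. indicator A x * k x \<noteq> indicator S x * k x} \<subseteq> N'"
      using S(1,2) by (auto simp: indicator_def split: if_splits)
  qed
  moreover have "S \<in> sets lebesgue" using S(4) by simp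
  ultimately have "(\<integral>x. indicator A x * k x \<partial>lebesgue) = (\<integral>x. indicator S x * k x \<partial>lebesgue)"
    using int[OF A] int by (intro integral_cong_AE borel_measurable_integrable) auto
  then show "set_lebesgue_integral lebesgue A k = set_lebesgue_integral lebesgue A (\<lambda>x. 0)"
    using B[of S] S(4) by (simp add: set_lebesgue_integral_def)
qed

text \<open>Smooth approximations of indicators give vanishing integrals over every box whose closed
  box lies in \<open>U\<close>. Cutting \<open>h\<close> off to one such box makes it integrable
  over the whole space, where \<open>AE_zero_if_box_integrals_zero\<close> applies; countably many
  closed boxes cover \<open>U\<close>.\<close>

lemma fundamental_lemma:
  fixes h :: "'a::euclidean_space \<Rightarrow> real"
  assumes U: "open U" and h: "loc_integrable U h"
    and orth: "\<And>\<phi>. test_fun U \<phi> \<Longrightarrow> (\<integral>x. h x * \<phi> x \<partial>lebesgue_on U) = 0"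
  shows "AE x in lebesgue_on U. h x = 0"
proof -
  have Um: "U \<in> sets lebesgue" using U by auto
  have hl: "integrable (lebesgue_on (cbox c d)) h" if "cbox c d \<subseteq> U" for c d
    using h that compact_cbox[of c d] unfolding loc_integrable_def by blast
  have box0: "(\<integral>x. indicator (box c d) x * h x \<partial>lebesgue) = 0" if cd: "cbox c d \<subseteq> U" for c d
  proof -
    obtain \<phi> :: "nat \<Rightarrow> 'a \<Rightarrow> real" where *: "(\<forall>n. smooth (\<phi> n)) \<and> (\<forall>n x. x \<notin> cbox c d \<longrightarrow> \<phi> n x = 0) \<and>
        (\<forall>n x. \<bar>\<phi> n x\<bar> \<le> 1) \<and> (\<forall>x. (\<lambda>n. \<phi> n x) \<longlonglongrightarrow> indicator (box c d) x)"
      using box_indicator_approx[of c d] ..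
    have \<phi>: "\<And>n. smooth (\<phi> n)" "\<And>n x. x \<notin> cbox c d \<Longrightarrow> \<phi> n x = 0" "\<And>n x. \<bar>\<phi> n x\<bar> \<le> 1"
        "\<And>x. (\<lambda>n. \<phi> n x) \<longlonglongrightarrow> indicator (box c d) x"
      using * by simp_all
    have t: "test_fun U (\<phi> n)" for n
      unfolding test_fun_def using \<phi>(1,2) cd by (intro conjI exI[of _ "cbox c d"]) auto
    have hi: "integrable lebesgue (\<lambda>x. indicator (cbox c d) x * h x)"
      using hl[OF cd] integrable_restrict_space[of "cbox c d" lebesgue h] by simp
    have meas: "(\<lambda>x. \<phi> n x * (indicator (cbox c d) x * h x)) \<in> borel_measurable lebesgue" for n
    proof -
      have "\<phi> n \<in> borel_measurable lebesgue"
        using test_funD(3)[OF t[of n]] by (simp add: measurable_completion)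
      then show ?thesis by (rule borel_measurable_times[OF _ borel_measurable_integrable[OF hi]])
    qed
    have "(\<integral>x. \<phi> n x * (indicator (cbox c d) x * h x) \<partial>lebesgue) = (\<integral>x. h x * \<phi> n x \<partial>lebesgue_on U)" for n
      using Um cd \<phi>(2) by (auto simp: integral_restrict_space indicator_def intro!: Bochner_Integration.integral_cong)
    then have z: "(\<integral>x. \<phi> n x * (indicator (cbox c d) x * h x) \<partial>lebesgue) = 0" for n
      using orth[OF t[of n]] by simp
    have "(\<lambda>n. (\<integral>x. \<phi> n x * (indicator (cbox c d) x * h x) \<partial>lebesgue)) \<longlonglongrightarrow>
          (\<integral>x. indicator (box c d) x * (indicator (cbox c d) x * h x) \<partial>lebesgue)"
    proof (rule integral_dominated_convergence[where w="\<lambda>x. \<bar>indicator (cbox c d) x * h x\<bar>"])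
      show "AE x in lebesgue. norm (\<phi> n x * (indicator (cbox c d) x * h x)) \<le> \<bar>indicator (cbox c d) x * h x\<bar>" for n
        using \<phi>(3)[of n] by (auto simp: abs_mult intro!: mult_left_le_one_le AE_I2)
      show "AE x in lebesgue. (\<lambda>n. \<phi> n x * (indicator (cbox c d) x * h x))
           \<longlonglongrightarrow> indicator (box c d) x * (indicator (cbox c d) x * h x)"
        using \<phi>(4) by (intro AE_I2 tendsto_mult tendsto_const)
      show "(\<lambda>x. indicator (box c d) x * (indicator (cbox c d) x * h x)) \<in> borel_measurable lebesgue"
        by (rule borel_measurable_times[OF borel_measurable_indicator borel_measurable_integrable[OF hi]]) auto
    qed (use hi meas in auto)
    then have "(\<integral>x. indicator (box c d) x * (indicator (cbox c d) x * h x) \<partial>lebesgue) = 0"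
      unfolding z using LIMSEQ_unique tendsto_const by blast
    moreover have "indicator (box c d) x * (indicator (cbox c d) x * h x) = indicator (box c d) x * h x" for x
      using box_subset_cbox[of c d] by (auto simp: indicator_def)
    ultimately show ?thesis by (simp only:)
  qed
  have cd0: "AE x in lebesgue. x \<in> box c d \<longrightarrow> h x = 0" if cd: "cbox c d \<subseteq> U" for c d
  proof -
    let ?k = "\<lambda>x. indicator (box c d) x * h x"
    have hi: "integrable lebesgue (\<lambda>x. indicator (cbox c d) x * h x)"
      using hl[OF cd] integrable_restrict_space[of "cbox c d" lebesgue h] by simp
    have "integrable lebesgue (\<lambda>x. indicator (box c d) x *\<^sub>R (indicator (cbox c d) x * h x))"
      by (rule integrable_mult_indicator[OF _ hi]) auto
    moreover have "indicator (box c d) x *\<^sub>R (indicator (cbox c d) x * h x) = ?k x" for x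
      using box_subset_cbox[of c d] by (auto simp: indicator_def)
    ultimately have k: "integrable lebesgue ?k" by (simp only:)
    have "AE x in lebesgue. ?k x = 0"
    proof (rule AE_zero_if_box_integrals_zero[OF k])
      show "integral\<^sup>L lebesgue ?k = 0" using box0[OF cd] .
      fix l u
      obtain l' u' where e: "box l u \<inter> box c d = box l' u'" using box_Int_box[of l u c d] by blast
      show "(\<integral>x. indicator (box l u) x * ?k x \<partial>lebesgue) = 0"
      \<comment> \<open>For an empty open box the closed box with the same corners may be nonempty
        and leave \<open>U\<close>, so \<open>box0\<close> applies only in the other case.\<close>
      proof (cases "box l' u' = {}")
        case True
        then have "indicator (box l u) x * ?k x = 0" for x using e by (auto simp: indicator_def)
        then show ?thesis by (simp only: Bochner_Integration.integral_zero)
      next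
        case False
        have "box l' u' \<subseteq> cbox c d" using e box_subset_cbox[of c d] by blast
        then have "cbox l' u' \<subseteq> cbox c d"
          using closure_minimal[OF _ closed_cbox, of "box l' u'" c d] unfolding closure_box[OF False] by blast
        from box0[OF subset_trans[OF this cd]]
        show ?thesis unfolding e[symmetric] by (simp add: indicator_inter_arith mult.assoc)
      qed
    qed
    then show ?thesis by (rule AE_mp) (auto simp: indicator_def)
  qed
  have cd1: "AE x in lebesgue. x \<in> cbox c d \<longrightarrow> h x = 0" if cd: "cbox c d \<subseteq> U" for c d
  proof -
    have "cbox c d - box c d \<in> null_sets lebesgue"
      using negligible_frontier_interval negligible_iff_null_sets by blast
    then have "AE x in lebesgue. x \<notin> cbox c d - box c d" by (rule AE_not_in)
    with cd0[OF cd] show ?thesis by eventually_elim auto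
  qed
  obtain \<D> where D: "countable \<D>" "\<D> \<subseteq> Pow U" "\<And>X. X \<in> \<D> \<Longrightarrow> \<exists>a b. X = cbox a b" "\<Union>\<D> = U"
    using open_countable_Union_open_cbox[OF U] by metis
  have "AE x in lebesgue. \<forall>X\<in>\<D>. x \<in> X \<longrightarrow> h x = 0"
    by (rule AE_ball_countable'[OF _ D(1)]) (use D(2,3) cd1 in blast)
  then have "AE x in lebesgue. x \<in> U \<longrightarrow> h x = 0"
    by (rule AE_mp) (use D(4) in auto)
  then show ?thesis using Um by (simp add: AE_restrict_space_iff)
qed

section \<open>Square-integrable functions and the space H01\<close>

text \<open>The codomain is any Euclidean space, so that functions and their gradients share one
  theory. Functions are not identified modulo null sets and the integral is total, which is why the
  additive rules below ask for \<open>L2vec\<close>.\<close>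

definition l2_inner :: "'a::euclidean_space set \<Rightarrow> ('a \<Rightarrow> 'b::euclidean_space) \<Rightarrow> ('a \<Rightarrow> 'b) \<Rightarrow> real" where
  "l2_inner U f g = (\<integral>x. f x \<bullet> g x \<partial>lebesgue_on U)"

definition l2_norm :: "'a::euclidean_space set \<Rightarrow> ('a \<Rightarrow> 'b::euclidean_space) \<Rightarrow> real" where
  "l2_norm U f = sqrt (L2vsq U f)"

lemma L2_eq_L2vec: "L2 U f = L2vec U f"
  by (simp add: L2_def L2vec_def)

lemma L2sq_eq_L2vsq: "L2sq U f = L2vsq U f"
  by (simp add: L2sq_def L2vsq_def)

lemma L2vec_inner_integrable:
  assumes "L2vec U f" "L2vec U g" shows "integrable (lebesgue_on U) (\<lambda>x. f x \<bullet> g x)"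
proof (rule Bochner_Integration.integrable_bound)
  show "integrable (lebesgue_on U) (\<lambda>x. (norm (f x))\<^sup>2 + (norm (g x))\<^sup>2)"
    using assms by (auto simp: L2vec_def)
  show "(\<lambda>x. f x \<bullet> g x) \<in> borel_measurable (lebesgue_on U)"
    using assms by (auto simp: L2vec_def)
  show "AE x in lebesgue_on U. norm (f x \<bullet> g x) \<le> norm ((norm (f x))\<^sup>2 + (norm (g x))\<^sup>2)"
  proof (rule AE_I2)
    fix x
    have "\<bar>f x \<bullet> g x\<bar> \<le> norm (f x) * norm (g x)" by (rule Cauchy_Schwarz_ineq2)
    also have "\<dots> \<le> (norm (f x))\<^sup>2 + (norm (g x))\<^sup>2"
      using sum_squares_bound[of "norm (f x)" "norm (g x)"] mult_nonneg_nonneg[OF norm_ge_zero[of "f x"] norm_ge_zero[of "g x"]]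
      by linarith
    finally show "norm (f x \<bullet> g x) \<le> norm ((norm (f x))\<^sup>2 + (norm (g x))\<^sup>2)" by simp
  qed
qed

lemma L2vec_norm: "L2vec U f \<Longrightarrow> L2vec U (\<lambda>x. norm (f x))"
  by (auto simp: L2vec_def)

lemma L2vec_add:
  assumes "L2vec U f" "L2vec U g" shows "L2vec U (\<lambda>x. f x + g x)"
proof -
  have "(norm (f x + g x))\<^sup>2 = (norm (f x))\<^sup>2 + (norm (g x))\<^sup>2 + 2 * (f x \<bullet> g x)" for x
    by (simp add: power2_norm_eq_inner inner_add inner_commute)
  then show ?thesis
    using assms L2vec_inner_integrable[OF assms] by (auto simp: L2vec_def)
qed

lemma L2vec_scaleR: "L2vec U f \<Longrightarrow> L2vec U (\<lambda>x. c *\<^sub>R f x)"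
  by (auto simp: L2vec_def power_mult_distrib)

lemma L2vec_diff: "L2vec U f \<Longrightarrow> L2vec U g \<Longrightarrow> L2vec U (\<lambda>x. f x - g x)"
  using L2vec_add[of U f "\<lambda>x. (-1) *\<^sub>R g x"] L2vec_scaleR[of U g "-1"] by simp

lemma L2vec_zero: "L2vec U (\<lambda>x. 0)"
  by (simp add: L2vec_def)

lemma l2_inner_commute: "l2_inner U f g = l2_inner U g f"
  by (simp add: l2_inner_def inner_commute)

lemma l2_inner_self: "l2_inner U f f = L2vsq U f"
  by (simp add: l2_inner_def L2vsq_def power2_norm_eq_inner)

lemma l2_inner_add_left:
  "L2vec U f \<Longrightarrow> L2vec U g \<Longrightarrow> L2vec U h \<Longrightarrow> l2_inner U (\<lambda>x. f x + g x) h = l2_inner U f h + l2_inner U g h"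
  by (simp add: l2_inner_def inner_add_left L2vec_inner_integrable)

lemma l2_inner_diff_left:
  "L2vec U f \<Longrightarrow> L2vec U g \<Longrightarrow> L2vec U h \<Longrightarrow> l2_inner U (\<lambda>x. f x - g x) h = l2_inner U f h - l2_inner U g h"
  by (simp add: l2_inner_def inner_diff_left L2vec_inner_integrable)

lemma l2_inner_diff_right:
  "L2vec U f \<Longrightarrow> L2vec U g \<Longrightarrow> L2vec U h \<Longrightarrow> l2_inner U h (\<lambda>x. f x - g x) = l2_inner U h f - l2_inner U h g"
  by (simp add: l2_inner_def inner_diff_right L2vec_inner_integrable)

lemma l2_inner_scaleR_left: "l2_inner U (\<lambda>x. c *\<^sub>R f x) g = c * l2_inner U f g"
  by (simp add: l2_inner_def)

lemma l2_inner_sum_left: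
  "finite I \<Longrightarrow> (\<And>i. i \<in> I \<Longrightarrow> L2vec U (f i)) \<Longrightarrow> L2vec U g \<Longrightarrow>
    l2_inner U (\<lambda>x. \<Sum>i\<in>I. f i x) g = (\<Sum>i\<in>I. l2_inner U (f i) g)"
  by (simp add: l2_inner_def inner_sum_left L2vec_inner_integrable)

lemma L2vsq_nonneg: "0 \<le> L2vsq U f"
  by (simp add: L2vsq_def)

lemma l2_norm_nonneg: "0 \<le> l2_norm U f"
  by (simp add: l2_norm_def L2vsq_nonneg)

lemma l2_norm_square: "(l2_norm U f)\<^sup>2 = L2vsq U f"
  by (simp add: l2_norm_def L2vsq_nonneg)

lemma l2_norm_norm: "l2_norm U (\<lambda>x. norm (f x)) = l2_norm U f"
  by (simp add: l2_norm_def L2vsq_def)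

lemma L2vsq_diff_commute: "L2vsq U (\<lambda>x. f x - g x) = L2vsq U (\<lambda>x. g x - f x)"
proof -
  have "norm (f x - g x) = norm (g x - f x)" for x by (rule norm_minus_commute)
  then show ?thesis unfolding L2vsq_def by (simp only:)
qed

lemma l2_norm_diff_commute: "l2_norm U (\<lambda>x. f x - g x) = l2_norm U (\<lambda>x. g x - f x)"
  unfolding l2_norm_def L2vsq_diff_commute[of U f g] ..

text \<open>The squared norm of f + t g is a nonnegative quadratic in \<open>t\<close>; it is
  evaluated at its minimum t = - I / B.\<close>

lemma l2_Cauchy_Schwarz:
  assumes f: "L2vec U f" and g: "L2vec U g"
  shows "\<bar>l2_inner U f g\<bar> \<le> l2_norm U f * l2_norm U g"
proof -
  let ?A = "L2vsq U f" and ?B = "L2vsq U g" and ?I = "l2_inner U f g"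
  have q: "0 \<le> ?A + 2 * t * ?I + t\<^sup>2 * ?B" for t
  proof -
    have tg: "L2vec U (\<lambda>x. t *\<^sub>R g x)" by (rule L2vec_scaleR[OF g])
    have "0 \<le> L2vsq U (\<lambda>x. f x + t *\<^sub>R g x)" by (rule L2vsq_nonneg)
    also have "\<dots> = l2_inner U f (\<lambda>x. f x + t *\<^sub>R g x) + l2_inner U (\<lambda>x. t *\<^sub>R g x) (\<lambda>x. f x + t *\<^sub>R g x)"
      unfolding l2_inner_self[symmetric] by (rule l2_inner_add_left[OF f tg L2vec_add[OF f tg]])
    also have "\<dots> = ?A + 2 * t * ?I + t\<^sup>2 * ?B"
      using l2_inner_add_left[OF f tg f] l2_inner_add_left[OF f tg g]
      by (simp add: l2_inner_scaleR_left l2_inner_commute[of U f "\<lambda>x. f x + t *\<^sub>R g x"]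
          l2_inner_commute[of U g "\<lambda>x. f x + t *\<^sub>R g x"] l2_inner_commute[of U g f] l2_inner_self power2_eq_square algebra_simps)
    finally show ?thesis .
  qed
  have "?I\<^sup>2 \<le> ?A * ?B"
  proof (cases "?B = 0")
    case True
    have "?I = 0"
    proof (rule ccontr)
      assume I: "?I \<noteq> 0"
      \<comment> \<open>Without quadratic part the polynomial is affine in \<open>t\<close>; this
        choice of \<open>t\<close> gives it the negative value - A - 2.\<close>
      have "0 \<le> ?A + 2 * (- (?A + 1) / ?I) * ?I" using q[of "- (?A + 1) / ?I"] True by simp
      also have "\<dots> = - ?A - 2" using I by (simp add: field_simps)
      finally show False using L2vsq_nonneg[of U f] by simp
    qed
    then show ?thesis using True by simp
  next
    case False
    then have B: "?B > 0" using L2vsq_nonneg[of U g] by linarith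
    have "0 \<le> ?A + 2 * (- ?I / ?B) * ?I + (- ?I / ?B)\<^sup>2 * ?B" by (rule q)
    also have "\<dots> = ?A - ?I\<^sup>2 / ?B" using B by (simp add: field_simps power2_eq_square)
    finally show ?thesis using B by (simp add: field_simps)
  qed
  then have "sqrt (?I\<^sup>2) \<le> sqrt (?A * ?B)" by (rule real_sqrt_le_mono)
  then show ?thesis by (simp add: l2_norm_def real_sqrt_mult)
qed

lemma l2_norm_triangle:
  assumes f: "L2vec U f" and g: "L2vec U g"
  shows "l2_norm U (\<lambda>x. f x + g x) \<le> l2_norm U f + l2_norm U g"
proof -
  note fg = L2vec_add[OF f g]
  have "L2vsq U (\<lambda>x. f x + g x) = l2_inner U f (\<lambda>x. f x + g x) + l2_inner U g (\<lambda>x. f x + g x)"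
    unfolding l2_inner_self[symmetric] by (rule l2_inner_add_left[OF f g fg])
  also have "\<dots> = L2vsq U f + 2 * l2_inner U f g + L2vsq U g"
    using l2_inner_add_left[OF f g f] l2_inner_add_left[OF f g g]
    by (simp add: l2_inner_commute[of U f "\<lambda>x. f x + g x"]
          l2_inner_commute[of U g "\<lambda>x. f x + g x"] l2_inner_commute[of U g f] l2_inner_self)
  also have "\<dots> \<le> (l2_norm U f + l2_norm U g)\<^sup>2"
    using l2_Cauchy_Schwarz[OF f g] by (simp add: power2_sum l2_norm_square)
  finally have "(l2_norm U (\<lambda>x. f x + g x))\<^sup>2 \<le> (l2_norm U f + l2_norm U g)\<^sup>2"
    by (simp add: l2_norm_square)
  then show ?thesis by (rule power2_le_imp_le) (simp add: l2_norm_nonneg)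
qed

lemma tendsto_l2_norm_iff:
  "((\<lambda>s. L2vsq U (f s)) \<longlongrightarrow> 0) F \<longleftrightarrow> ((\<lambda>s. l2_norm U (f s)) \<longlongrightarrow> 0) F"
proof
  assume "((\<lambda>s. L2vsq U (f s)) \<longlongrightarrow> 0) F"
  then show "((\<lambda>s. l2_norm U (f s)) \<longlongrightarrow> 0) F"
    unfolding l2_norm_def using tendsto_real_sqrt by fastforce
next
  assume "((\<lambda>s. l2_norm U (f s)) \<longlongrightarrow> 0) F"
  then have "((\<lambda>s. (l2_norm U (f s))\<^sup>2) \<longlongrightarrow> 0\<^sup>2) F" by (rule tendsto_power)
  then show "((\<lambda>s. L2vsq U (f s)) \<longlongrightarrow> 0) F" by (simp add: l2_norm_square)
qed

text \<open>The main source of continuity and differentiability in time: strong convergence of both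
  factors suffices. The difference of the products splits into (f - f0)(g - g0), (f - f0) g0 and f0
  (g - g0).\<close>

lemma tendsto_l2_inner:
  assumes f: "\<And>s. s \<in> S \<Longrightarrow> L2vec U (f s)" and g: "\<And>s. s \<in> S \<Longrightarrow> L2vec U (g s)"
    and f0: "L2vec U f0" and g0: "L2vec U g0" and S: "eventually (\<lambda>s. s \<in> S) F"
    and lf: "((\<lambda>s. l2_norm U (\<lambda>x. f s x - f0 x)) \<longlongrightarrow> 0) F"
    and lg: "((\<lambda>s. l2_norm U (\<lambda>x. g s x - g0 x)) \<longlongrightarrow> 0) F"
  shows "((\<lambda>s. l2_inner U (f s) (g s)) \<longlongrightarrow> l2_inner U f0 g0) F"
proof -
  let ?a = "\<lambda>s. l2_norm U (\<lambda>x. f s x - f0 x)" and ?b = "\<lambda>s. l2_norm U (\<lambda>x. g s x - g0 x)"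
  have bnd: "\<bar>l2_inner U (f s) (g s) - l2_inner U f0 g0\<bar> \<le> ?a s * ?b s + ?a s * l2_norm U g0 + l2_norm U f0 * ?b s"
    if "s \<in> S" for s
  proof -
    note fs = f[OF that] and gs = g[OF that]
    note df = L2vec_diff[OF fs f0] and dg = L2vec_diff[OF gs g0]
    have "l2_inner U (f s) (g s) - l2_inner U f0 g0 =
       l2_inner U (\<lambda>x. f s x - f0 x) (\<lambda>x. g s x - g0 x) + l2_inner U (\<lambda>x. f s x - f0 x) g0
       + l2_inner U f0 (\<lambda>x. g s x - g0 x)"
      by (simp add: l2_inner_diff_left fs f0 dg g0 l2_inner_diff_right gs)
    then show ?thesis
      using l2_Cauchy_Schwarz[OF df dg] l2_Cauchy_Schwarz[OF df g0] l2_Cauchy_Schwarz[OF f0 dg]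
      by linarith
  qed
  have "((\<lambda>s. ?a s * ?b s + ?a s * l2_norm U g0 + l2_norm U f0 * ?b s) \<longlongrightarrow>
     0 * 0 + 0 * l2_norm U g0 + l2_norm U f0 * 0) F"
    by (intro tendsto_intros lf lg)
  then have "((\<lambda>s. ?a s * ?b s + ?a s * l2_norm U g0 + l2_norm U f0 * ?b s) \<longlongrightarrow> 0) F"
    by simp
  then have "((\<lambda>s. l2_inner U (f s) (g s) - l2_inner U f0 g0) \<longlongrightarrow> 0) F"
    by (rule Lim_null_comparison[rotated]) (use S bnd in \<open>auto elim!: eventually_mono\<close>)
  then show ?thesis by (simp add: Lim_null[symmetric])
qed

lemma L2vsq_eq_0_AE:
  assumes "L2vec U f" "L2vsq U f = 0" shows "AE x in lebesgue_on U. f x = 0"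
  using assms integral_nonneg_eq_0_iff_AE[of "lebesgue_on U" "\<lambda>x. (norm (f x))\<^sup>2"]
  by (auto simp: L2vec_def L2vsq_def)

lemma L2vec_bounded_mult:
  assumes "L2vec U g" "a \<in> borel_measurable (lebesgue_on U)" "AE x in lebesgue_on U. \<bar>a x\<bar> \<le> C"
  shows "L2vec U (\<lambda>x. a x *\<^sub>R g x)"
  unfolding L2vec_def
proof
  show "integrable (lebesgue_on U) (\<lambda>x. (norm (a x *\<^sub>R g x))\<^sup>2)"
  proof (rule Bochner_Integration.integrable_bound)
    show "integrable (lebesgue_on U) (\<lambda>x. C\<^sup>2 * (norm (g x))\<^sup>2)"
      using assms(1) by (auto simp: L2vec_def)
    show "AE x in lebesgue_on U. norm ((norm (a x *\<^sub>R g x))\<^sup>2) \<le> norm (C\<^sup>2 * (norm (g x))\<^sup>2)"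
      using assms(3)
    proof eventually_elim
      case (elim x)
      then have "\<bar>a x\<bar>\<^sup>2 * (norm (g x))\<^sup>2 \<le> C\<^sup>2 * (norm (g x))\<^sup>2"
        by (intro mult_right_mono power_mono) auto
      then show ?case by (simp add: power_mult_distrib)
    qed
  qed (use assms in \<open>auto simp: L2vec_def\<close>)
qed (use assms in \<open>auto simp: L2vec_def\<close>)

lemma L2vec_integrable:
  assumes "L2vec U f" "U \<in> lmeasurable" shows "integrable (lebesgue_on U) f"
proof -
  have "L2vec U (\<lambda>x. 1::real)"
    using finite_measure.integrable_const[OF finite_measure_lebesgue_on[OF assms(2)]] by (simp add: L2vec_def)
  then have "integrable (lebesgue_on U) (\<lambda>x. norm (f x) \<bullet> (1::real))"
    using L2vec_inner_integrable[OF L2vec_norm[OF assms(1)]] by blast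
  then show ?thesis
    using assms(1) by (auto simp: L2vec_def intro: integrable_norm_cancel)
qed

lemma lebesgue_on_subset_integrable:
  fixes f :: "'a::euclidean_space \<Rightarrow> 'b::{banach, second_countable_topology}"
  assumes "integrable (lebesgue_on U) f" "K \<subseteq> U" "K \<in> sets lebesgue" "U \<in> sets lebesgue"
  shows "integrable (lebesgue_on K) f"
proof -
  have "integrable lebesgue (\<lambda>x. indicator U x *\<^sub>R f x)"
    using assms by (simp add: integrable_restrict_space)
  from integrable_mult_indicator[OF assms(3) this]
  have "integrable lebesgue (\<lambda>x. indicator K x *\<^sub>R f x)"
    by (rule back_subst[of "integrable lebesgue"]) (use assms(2) in \<open>auto simp: indicator_def fun_eq_iff of_bool_def\<close>)
  then show ?thesis using assms by (simp add: integrable_restrict_space)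
qed

lemma L2vec_loc_integrable:
  fixes f :: "'a::euclidean_space \<Rightarrow> real"
  assumes "L2vec U f" "U \<in> lmeasurable" shows "loc_integrable U f"
  using assms lebesgue_on_subset_integrable[OF L2vec_integrable[OF assms]]
  by (auto simp: loc_integrable_def L2vec_def fmeasurableD lmeasurable_compact)

lemma continuous_bounded_L2vec:
  fixes f :: "'a::euclidean_space \<Rightarrow> 'b::euclidean_space"
  assumes c: "continuous_on UNIV f" and B: "\<And>x. norm (f x) \<le> B" and U: "U \<in> lmeasurable"
  shows "L2vec U f"
  unfolding L2vec_def
proof
  have m: "f \<in> borel_measurable borel" using c by (rule borel_measurable_continuous_onI)
  then show mU: "f \<in> borel_measurable (lebesgue_on U)"
    by (simp add: measurable_completion measurable_restrict_space1)
  interpret finite_measure "lebesgue_on U" by (rule finite_measure_lebesgue_on[OF U])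
  show "integrable (lebesgue_on U) (\<lambda>x. (norm (f x))\<^sup>2)"
    by (rule integrable_const_bound[of _ "B\<^sup>2"]) (use B mU in \<open>auto intro!: AE_I2 power_mono\<close>)
qed

lemma test_fun_L2vec:
  assumes "test_fun U \<phi>" "U \<in> lmeasurable" shows "L2vec U \<phi>"
proof -
  obtain B where "\<And>x. \<bar>\<phi> x\<bar> \<le> B" using test_fun_bounded[OF assms(1)] by blast
  then show ?thesis using continuous_bounded_L2vec[OF test_funD(2)[OF assms(1)] _ assms(2)] by auto
qed

lemma cgrad_continuous:
  assumes "smooth \<phi>" shows "continuous_on UNIV (cgrad \<phi>)"
proof -
  have "continuous_on UNIV (\<lambda>x. \<chi> i. partial i \<phi> x)"
    unfolding partial_def
    by (intro continuous_on_vec_lambda smooth_continuous smooth_dderiv assms) (auto simp: axis_in_Basis_iff)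
  then show ?thesis by (simp add: cgrad_def[abs_def])
qed

lemma cgrad_L2vec:
  fixes \<phi> :: "real^'n::finite \<Rightarrow> real"
  assumes "test_fun U \<phi>" "U \<in> lmeasurable" shows "L2vec U (cgrad \<phi>)"
proof -
  have "\<forall>i. \<exists>B. \<forall>x. \<bar>partial i \<phi> x\<bar> \<le> B"
    using test_fun_bounded[OF test_fun_partial[OF assms(1)]] by metis
  then obtain B where B: "\<And>i x. \<bar>partial i \<phi> x\<bar> \<le> B i" by metis
  have "norm (cgrad \<phi> x) \<le> (\<Sum>i\<in>UNIV. B i)" for x
    using norm_le_l1_cart[of "cgrad \<phi> x"] sum_mono[of UNIV "\<lambda>i. \<bar>partial i \<phi> x\<bar>" B] B
    by (simp add: cgrad_def)
  then show ?thesis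
    using continuous_bounded_L2vec[OF cgrad_continuous[OF test_funD(1)[OF assms(1)]] _ assms(2)] by blast
qed

text \<open>The closure of the pairs (\<phi>, \<open>cgrad\<close> \<phi>) in L^2 x L^2. With the
  gradient as an explicit component, linear operations and limits act on function and gradient at
  once.\<close>

definition H01_pair :: "(real^'n::finite) set \<Rightarrow> (real^'n \<Rightarrow> real) \<Rightarrow> (real^'n \<Rightarrow> real^'n) \<Rightarrow> bool" where
  "H01_pair U w g \<longleftrightarrow> L2vec U w \<and> L2vec U g \<and> (\<exists>\<phi>. (\<forall>n. test_fun U (\<phi> n)) \<and>
     (\<lambda>n. l2_norm U (\<lambda>x. \<phi> n x - w x)) \<longlonglongrightarrow> 0 \<and> (\<lambda>n. l2_norm U (\<lambda>x. cgrad (\<phi> n) x - g x)) \<longlonglongrightarrow> 0)"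

text \<open>\<open>H01\<close> asserts only that some gradient exists, while a solution comes with
  its own \<open>G\<close>; uniqueness identifies the two. It also matches the gradients of two
  solutions at time 0. The fundamental lemma is applied to each component of the difference.\<close>

lemma weak_grad_unique:
  assumes "open U" "U \<in> lmeasurable" "weak_grad U w g" "weak_grad U w' g'" "L2vec U g" "L2vec U g'"
    and "AE x in lebesgue_on U. w x = w' x"
  shows "AE x in lebesgue_on U. g x = g' x"
proof -
  have "AE x in lebesgue_on U. g x $ i - g' x $ i = 0" for i
  proof (rule fundamental_lemma[OF assms(1)])
    have m: "L2vec U (\<lambda>x. g x $ i)" if "L2vec U g" for g :: "real^'a \<Rightarrow> real^'a"
      unfolding L2vec_def
    proof
      show mi: "(\<lambda>x. g x $ i) \<in> borel_measurable (lebesgue_on U)"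
        using that by (auto simp: L2vec_def cart_eq_inner_axis)
      show "integrable (lebesgue_on U) (\<lambda>x. (norm (g x $ i))\<^sup>2)"
      proof (rule Bochner_Integration.integrable_bound)
        show "integrable (lebesgue_on U) (\<lambda>x. (norm (g x))\<^sup>2)" using that by (simp add: L2vec_def)
        show "AE x in lebesgue_on U. norm ((norm (g x $ i))\<^sup>2) \<le> norm ((norm (g x))\<^sup>2)"
        proof (rule AE_I2)
          fix x
          have "(norm (g x $ i))\<^sup>2 \<le> (norm (g x))\<^sup>2"
            using component_le_norm_cart[of "g x" i] by (intro power_mono) auto
          then show "norm ((norm (g x $ i))\<^sup>2) \<le> norm ((norm (g x))\<^sup>2)" by simp
        qed
      qed (use mi in auto)
    qed
    show "loc_integrable U (\<lambda>x. g x $ i - g' x $ i)"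
      by (rule L2vec_loc_integrable[OF L2vec_diff[OF m[OF assms(5)] m[OF assms(6)]] assms(2)])
    fix \<phi> assume \<phi>: "test_fun U \<phi>"
    have 1: "integrable (lebesgue_on U) (\<lambda>x. g x $ i * \<phi> x)" "integrable (lebesgue_on U) (\<lambda>x. g' x $ i * \<phi> x)"
      using L2vec_inner_integrable[OF m[OF assms(5)] test_fun_L2vec[OF \<phi> assms(2)]]
        L2vec_inner_integrable[OF m[OF assms(6)] test_fun_L2vec[OF \<phi> assms(2)]] by simp_all
    have pm: "partial i \<phi> \<in> borel_measurable (lebesgue_on U)"
      using test_fun_L2vec[OF test_fun_partial[OF \<phi>] assms(2)] by (auto simp: L2vec_def)
    have "(\<integral>x. w x * partial i \<phi> x \<partial>lebesgue_on U) = (\<integral>x. w' x * partial i \<phi> x \<partial>lebesgue_on U)"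
    proof (rule integral_cong_AE)
      show "(\<lambda>x. w x * partial i \<phi> x) \<in> borel_measurable (lebesgue_on U)"
        "(\<lambda>x. w' x * partial i \<phi> x) \<in> borel_measurable (lebesgue_on U)"
        using assms(3,4) pm by (auto simp: weak_grad_def loc_integrable_def)
      show "AE x in lebesgue_on U. w x * partial i \<phi> x = w' x * partial i \<phi> x"
        using assms(7) by (rule AE_mp) auto
    qed
    then have "(\<integral>x. g x $ i * \<phi> x \<partial>lebesgue_on U) = (\<integral>x. g' x $ i * \<phi> x \<partial>lebesgue_on U)"
      using assms(3,4) \<phi> by (simp add: weak_grad_def)
    then show "(\<integral>x. (g x $ i - g' x $ i) * \<phi> x \<partial>lebesgue_on U) = 0"
      using 1 by (simp add: left_diff_distrib)
  qed
  then have "AE x in lebesgue_on U. \<forall>i. g x $ i - g' x $ i = 0"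
    by (simp add: AE_all_countable)
  then show ?thesis by (rule AE_mp) (auto simp: vec_eq_iff)
qed

lemma L2vsq_cong_AE:
  assumes "f \<in> borel_measurable (lebesgue_on U)" "g \<in> borel_measurable (lebesgue_on U)"
    "AE x in lebesgue_on U. f x = g x"
  shows "L2vsq U f = L2vsq U g"
  unfolding L2vsq_def by (rule integral_cong_AE) (use assms in \<open>auto elim!: AE_mp\<close>)

lemma H01_pairI:
  assumes U: "open U" "U \<in> lmeasurable" and w: "H01 U w" and g: "weak_grad U w g" "L2vec U g"
  shows "H01_pair U w g"
proof -
  obtain g' \<phi> where g': "weak_grad U w g'" "L2vec U g'" "\<And>n. test_fun U (\<phi> n)"
    and lim: "(\<lambda>n. L2sq U (\<lambda>x. \<phi> n x - w x) + L2vsq U (\<lambda>x. cgrad (\<phi> n) x - g' x)) \<longlonglongrightarrow> 0"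
    and w2: "L2vec U w"
    using w unfolding H01_def L2_eq_L2vec by blast
  have ae: "AE x in lebesgue_on U. g' x = g x"
    by (rule weak_grad_unique[OF U g'(1) g(1) g'(2) g(2)]) simp
  have eq: "L2vsq U (\<lambda>x. cgrad (\<phi> n) x - g' x) = L2vsq U (\<lambda>x. cgrad (\<phi> n) x - g x)" for n
    using L2vec_diff[OF cgrad_L2vec[OF g'(3) U(2)] g'(2)] L2vec_diff[OF cgrad_L2vec[OF g'(3) U(2)] g(2)] ae
    by (intro L2vsq_cong_AE) (auto simp: L2vec_def elim!: AE_mp)
  have "(\<lambda>n. L2vsq U (\<lambda>x. \<phi> n x - w x)) \<longlonglongrightarrow> 0"
    by (rule Lim_null_comparison[OF _ lim]) (auto simp: L2vsq_nonneg L2sq_eq_L2vsq)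
  moreover have "(\<lambda>n. L2vsq U (\<lambda>x. cgrad (\<phi> n) x - g x)) \<longlonglongrightarrow> 0"
    unfolding eq[symmetric]
    by (rule Lim_null_comparison[OF _ lim]) (auto simp: L2vsq_nonneg L2sq_eq_L2vsq)
  ultimately show ?thesis
    using g'(3) w2 g(2) unfolding H01_pair_def tendsto_l2_norm_iff by blast
qed

lemma H01_pair_L2vec: assumes "H01_pair U w g" shows "L2vec U w" "L2vec U g"
  using assms by (auto simp: H01_pair_def)

lemma H01_pair_test_fun:
  assumes "test_fun U \<phi>" "U \<in> lmeasurable" shows "H01_pair U \<phi> (cgrad \<phi>)"
  unfolding H01_pair_def
  by (intro conjI test_fun_L2vec[OF assms] cgrad_L2vec[OF assms] exI[of _ "\<lambda>n. \<phi>"])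
    (simp_all add: l2_norm_def L2vsq_def assms)

lemma H01_pair_lincomb:
  assumes U: "U \<in> lmeasurable" and "H01_pair U w g" "H01_pair U w' g'"
  shows "H01_pair U (\<lambda>x. c * w x + w' x) (\<lambda>x. c *\<^sub>R g x + g' x)"
proof -
  obtain \<phi> where \<phi>: "\<And>n. test_fun U (\<phi> n)" "(\<lambda>n. l2_norm U (\<lambda>x. \<phi> n x - w x)) \<longlonglongrightarrow> 0"
     "(\<lambda>n. l2_norm U (\<lambda>x. cgrad (\<phi> n) x - g x)) \<longlonglongrightarrow> 0" and L: "L2vec U w" "L2vec U g"
    using assms(2) unfolding H01_pair_def by blast
  obtain \<phi>' where \<phi>': "\<And>n. test_fun U (\<phi>' n)" "(\<lambda>n. l2_norm U (\<lambda>x. \<phi>' n x - w' x)) \<longlonglongrightarrow> 0"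
     "(\<lambda>n. l2_norm U (\<lambda>x. cgrad (\<phi>' n) x - g' x)) \<longlonglongrightarrow> 0" and L': "L2vec U w'" "L2vec U g'"
    using assms(3) unfolding H01_pair_def by blast
  have gen: "(\<lambda>n. l2_norm U (\<lambda>x. (c *\<^sub>R f n x + f' n x) - (c *\<^sub>R h x + h' x))) \<longlonglongrightarrow> 0"
    if "\<And>n. L2vec U (f n)" "\<And>n. L2vec U (f' n)" "L2vec U h" "L2vec U h'"
      "(\<lambda>n. l2_norm U (\<lambda>x. f n x - h x)) \<longlonglongrightarrow> 0" "(\<lambda>n. l2_norm U (\<lambda>x. f' n x - h' x)) \<longlonglongrightarrow> 0"
    for f f' :: "nat \<Rightarrow> real^'a \<Rightarrow> 'c::euclidean_space" and h h'
  proof -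
    have sc: "l2_norm U (\<lambda>x. c *\<^sub>R k x) = \<bar>c\<bar> * l2_norm U k" for k :: "real^'a \<Rightarrow> 'c"
      by (simp add: l2_norm_def L2vsq_def power_mult_distrib real_sqrt_mult)
    have "(\<lambda>n. \<bar>c\<bar> * l2_norm U (\<lambda>x. f n x - h x) + l2_norm U (\<lambda>x. f' n x - h' x)) \<longlonglongrightarrow> \<bar>c\<bar> * 0 + 0"
      by (intro tendsto_intros that)
    then have "(\<lambda>n. \<bar>c\<bar> * l2_norm U (\<lambda>x. f n x - h x) + l2_norm U (\<lambda>x. f' n x - h' x)) \<longlonglongrightarrow> 0" by simp
    then show ?thesis
    proof (rule Lim_null_comparison[rotated], intro always_eventually allI)
      fix n
      have "l2_norm U (\<lambda>x. (c *\<^sub>R f n x + f' n x) - (c *\<^sub>R h x + h' x)) =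
         l2_norm U (\<lambda>x. c *\<^sub>R (f n x - h x) + (f' n x - h' x))"
        by (simp add: algebra_simps)
      also have "\<dots> \<le> l2_norm U (\<lambda>x. c *\<^sub>R (f n x - h x)) + l2_norm U (\<lambda>x. f' n x - h' x)"
        by (intro l2_norm_triangle L2vec_scaleR L2vec_diff that)
      finally show "norm (l2_norm U (\<lambda>x. (c *\<^sub>R f n x + f' n x) - (c *\<^sub>R h x + h' x)))
         \<le> \<bar>c\<bar> * l2_norm U (\<lambda>x. f n x - h x) + l2_norm U (\<lambda>x. f' n x - h' x)"
        by (simp add: sc l2_norm_nonneg)
    qed
  qed
  show ?thesis
    unfolding H01_pair_def
  proof (intro conjI exI[of _ "\<lambda>n x. c * \<phi> n x + \<phi>' n x"] allI)
    show "L2vec U (\<lambda>x. c * w x + w' x)" using L2vec_add[OF L2vec_scaleR[OF L(1)] L'(1)] by simp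
    show "L2vec U (\<lambda>x. c *\<^sub>R g x + g' x)" using L2vec_add[OF L2vec_scaleR[OF L(2)] L'(2)] by simp
    show "test_fun U (\<lambda>x. c * \<phi> n x + \<phi>' n x)" for n
      by (intro test_fun_add test_fun_cmult \<phi> \<phi>')
    show "(\<lambda>n. l2_norm U (\<lambda>x. c * \<phi> n x + \<phi>' n x - (c * w x + w' x))) \<longlonglongrightarrow> 0"
      using gen[OF test_fun_L2vec[OF \<phi>(1) U] test_fun_L2vec[OF \<phi>'(1) U] L(1) L'(1) \<phi>(2) \<phi>'(2)] by simp
    have "cgrad (\<lambda>x. c * \<phi> n x + \<phi>' n x) x = c *\<^sub>R cgrad (\<phi> n) x + cgrad (\<phi>' n) x" for n x
      by (simp add: cgrad_add cgrad_cmult smooth_cmult test_funD(1)[OF \<phi>(1)] test_funD(1)[OF \<phi>'(1)])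
    then show "(\<lambda>n. l2_norm U (\<lambda>x. cgrad (\<lambda>x. c * \<phi> n x + \<phi>' n x) x - (c *\<^sub>R g x + g' x))) \<longlonglongrightarrow> 0"
      using gen[OF cgrad_L2vec[OF \<phi>(1) U] cgrad_L2vec[OF \<phi>'(1) U] L(2) L'(2) \<phi>(3) \<phi>'(3)] by simp
  qed
qed

lemma H01_pair_zero:
  fixes U :: "(real^'n::finite) set"
  shows "H01_pair U (\<lambda>x. 0) (\<lambda>x. 0)"
proof -
  have "test_fun U (\<lambda>x. 0)" unfolding test_fun_def by (auto intro: smooth_const exI[of _ "{}"])
  moreover have "cgrad (\<lambda>x::real^'n. 0) = (\<lambda>x. 0)"
    using cgrad_cmult[OF smooth_const[of 0], of 0] by auto
  ultimately show ?thesis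
    unfolding H01_pair_def
    by (auto intro!: exI[of _ "\<lambda>n x. 0"] simp: L2vec_zero l2_norm_def L2vsq_def)
qed

lemma H01_pair_diff:
  assumes "U \<in> lmeasurable" "H01_pair U w g" "H01_pair U w' g'"
  shows "H01_pair U (\<lambda>x. w x - w' x) (\<lambda>x. g x - g' x)"
  using H01_pair_lincomb[OF assms(1,3,2), of "-1"] by simp

lemma H01_pair_sum:
  assumes "U \<in> lmeasurable" "finite I" "\<And>i. i \<in> I \<Longrightarrow> H01_pair U (w i) (g i)"
  shows "H01_pair U (\<lambda>x. \<Sum>i\<in>I. c i * w i x) (\<lambda>x. \<Sum>i\<in>I. c i *\<^sub>R g i x)"
  using assms(2,3)
proof (induction I rule: finite_induct)
  case empty
  then show ?case by (simp add: H01_pair_zero)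
next
  case (insert i I)
  then show ?case
    using H01_pair_lincomb[OF assms(1), of "w i" "g i"] by simp
qed

section \<open>The Sobolev inequality\<close>

text \<open>Total on the extended reals, so that line integrals can enter the Sobolev proof without
  a finiteness check.\<close>

definition esqrt :: "ennreal \<Rightarrow> ennreal" where
  "esqrt F = (if F = top then top else ennreal (sqrt (enn2real F)))"

lemma esqrt_square: "(esqrt F)\<^sup>2 = F"
proof (cases "F = top")
  case False
  then have "F < top" by (simp add: less_top)
  then show ?thesis using False by (simp add: esqrt_def ennreal_power)
qed (simp add: esqrt_def)

lemma esqrt_measurable [measurable]: "esqrt \<in> borel_measurable borel"
  unfolding esqrt_def[abs_def] by measurable

lemma le_esqrt:
  assumes "0 \<le> a" "ennreal (a\<^sup>2) \<le> F" shows "ennreal a \<le> esqrt F"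
proof (cases "F = top")
  case False
  then obtain r where r: "F = ennreal r" "r \<ge> 0" by (cases F) auto
  then have "a\<^sup>2 \<le> r" using assms by simp
  then have "a \<le> sqrt r" by (rule real_le_rsqrt)
  then show ?thesis using r by (simp add: esqrt_def)
qed (simp add: esqrt_def)

text \<open>Each factor misses one coordinate. Cauchy-Schwarz in (y, z) splits off
  \<open>f1\<close>; a second one in \<open>x\<close> bounds the square of the rest by a function of
  \<open>z\<close> times a function of \<open>y\<close>, whose double integral factorises. Stating
  the square of the inequality avoids roots of integrals.\<close>

lemma Loomis_Whitney:
  fixes f1 f2 f3 :: "real \<times> real \<Rightarrow> ennreal"
  assumes [measurable]: "f1 \<in> borel_measurable borel" "f2 \<in> borel_measurable borel" "f3 \<in> borel_measurable borel"
  shows "(\<integral>\<^sup>+y. \<integral>\<^sup>+z. \<integral>\<^sup>+x. f1 (y, z) * f2 (x, z) * f3 (x, y) \<partial>lborel \<partial>lborel \<partial>lborel)\<^sup>2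
    \<le> (\<integral>\<^sup>+y. \<integral>\<^sup>+z. (f1 (y, z))\<^sup>2 \<partial>lborel \<partial>lborel) * (\<integral>\<^sup>+z. \<integral>\<^sup>+x. (f2 (x, z))\<^sup>2 \<partial>lborel \<partial>lborel)
       * (\<integral>\<^sup>+y. \<integral>\<^sup>+x. (f3 (x, y))\<^sup>2 \<partial>lborel \<partial>lborel)"
proof -
  note [measurable] = borel_prod[symmetric]
  have [measurable]: "f1 \<in> borel_measurable (borel \<Otimes>\<^sub>M borel)" "f2 \<in> borel_measurable (borel \<Otimes>\<^sub>M borel)" "f3 \<in> borel_measurable (borel \<Otimes>\<^sub>M borel)"
    using assms by (simp_all add: borel_prod)
  define A where "A = (\<lambda>(y, z). \<integral>\<^sup>+x. f2 (x, z) * f3 (x, y) \<partial>lborel)"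
  have A_m [measurable]: "A \<in> borel_measurable (lborel \<Otimes>\<^sub>M lborel)"
    unfolding A_def by measurable
  have A2: "(A (y, z))\<^sup>2 \<le> (\<integral>\<^sup>+x. (f2 (x, z))\<^sup>2 \<partial>lborel) * (\<integral>\<^sup>+x. (f3 (x, y))\<^sup>2 \<partial>lborel)" for y z
    unfolding A_def split by (rule Cauchy_Schwarz_nn_integral) measurable
  have "(\<integral>\<^sup>+y. \<integral>\<^sup>+z. \<integral>\<^sup>+x. f1 (y, z) * f2 (x, z) * f3 (x, y) \<partial>lborel \<partial>lborel \<partial>lborel)
      = (\<integral>\<^sup>+y. \<integral>\<^sup>+z. f1 (y, z) * A (y, z) \<partial>lborel \<partial>lborel)"
    unfolding A_def split by (intro nn_integral_cong) (simp add: mult.assoc nn_integral_cmult)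
  also have "\<dots> = (\<integral>\<^sup>+p. f1 p * A p \<partial>(lborel \<Otimes>\<^sub>M lborel))"
    by (subst lborel.nn_integral_fst[symmetric]) measurable
  finally have "(\<integral>\<^sup>+y. \<integral>\<^sup>+z. \<integral>\<^sup>+x. f1 (y, z) * f2 (x, z) * f3 (x, y) \<partial>lborel \<partial>lborel \<partial>lborel)\<^sup>2
     \<le> (\<integral>\<^sup>+p. (f1 p)\<^sup>2 \<partial>(lborel \<Otimes>\<^sub>M lborel)) * (\<integral>\<^sup>+p. (A p)\<^sup>2 \<partial>(lborel \<Otimes>\<^sub>M lborel))"
    using Cauchy_Schwarz_nn_integral[of f1 "lborel \<Otimes>\<^sub>M lborel" A] by simp
  also have "(\<integral>\<^sup>+p. (f1 p)\<^sup>2 \<partial>(lborel \<Otimes>\<^sub>M lborel)) = (\<integral>\<^sup>+y. \<integral>\<^sup>+z. (f1 (y, z))\<^sup>2 \<partial>lborel \<partial>lborel)"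
    by (subst lborel.nn_integral_fst[symmetric]) measurable
  also have "(\<integral>\<^sup>+p. (A p)\<^sup>2 \<partial>(lborel \<Otimes>\<^sub>M lborel)) = (\<integral>\<^sup>+y. \<integral>\<^sup>+z. (A (y, z))\<^sup>2 \<partial>lborel \<partial>lborel)"
    by (subst lborel.nn_integral_fst[symmetric]) measurable
  also have "\<dots> \<le> (\<integral>\<^sup>+y. \<integral>\<^sup>+z. (\<integral>\<^sup>+x. (f2 (x, z))\<^sup>2 \<partial>lborel) * (\<integral>\<^sup>+x. (f3 (x, y))\<^sup>2 \<partial>lborel) \<partial>lborel \<partial>lborel)"
    by (intro nn_integral_mono A2)
  also have "\<dots> = (\<integral>\<^sup>+z. \<integral>\<^sup>+x. (f2 (x, z))\<^sup>2 \<partial>lborel \<partial>lborel) * (\<integral>\<^sup>+y. \<integral>\<^sup>+x. (f3 (x, y))\<^sup>2 \<partial>lborel \<partial>lborel)"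
    by (simp add: nn_integral_multc nn_integral_cmult)
  finally show ?thesis by (simp add: mult.assoc mult_left_mono)
qed

section \<open>Integration over three-space by coordinates, and along lines\<close>

definition vec3 :: "real \<times> real \<times> real \<Rightarrow> real^3" where
  "vec3 p = (\<chi> i. if i = 1 then fst p else if i = 2 then fst (snd p) else snd (snd p))"

lemma vec3_measurable [measurable]: "vec3 \<in> borel_measurable borel"
  unfolding vec3_def[abs_def]
proof (intro borel_measurable_continuous_onI continuous_on_vec_lambda)
  show "continuous_on UNIV (\<lambda>p::real \<times> real \<times> real. if i = 1 then fst p else if i = 2 then fst (snd p) else snd (snd p))"
    for i :: 3
    by (cases "i = 1"; cases "i = 2") (auto intro!: continuous_intros)
qed

lemma vec3_shift:
  "vec3 (x, y, z) = vec3 (0, y, z) + x *\<^sub>R axis 1 1"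
  "vec3 (x, y, z) = vec3 (x, 0, z) + y *\<^sub>R axis 2 1"
  "vec3 (x, y, z) = vec3 (x, y, 0) + z *\<^sub>R axis 3 1"
  by (auto simp: vec3_def vec_eq_iff axis_def exhaust_3 forall_3)

text \<open>Lebesgue measure is determined by its values on boxes, and \<open>vec3\<close> pulls a
  box back to a product of intervals.\<close>

lemma lborel_vec3: "distr lborel borel vec3 = lborel"
proof (rule lborel_eqI[symmetric])
  fix l u :: "real^3" assume lu: "\<And>b. b \<in> Basis \<Longrightarrow> l \<bullet> b \<le> u \<bullet> b"
  have le: "l $ i \<le> u $ i" for i
    using lu[of "axis i 1"] by (simp add: inner_axis axis_in_Basis_iff)
  have pre: "vec3 -` box l u \<inter> space lborel = {l $ 1<..<u $ 1} \<times> ({l $ 2<..<u $ 2} \<times> {l $ 3<..<u $ 3})"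
    by (auto simp: vec3_def mem_box_cart forall_3)
  have "emeasure (distr lborel borel vec3) (box l u) = emeasure lborel (vec3 -` box l u \<inter> space lborel)"
    by (rule emeasure_distr) auto
  also have "\<dots> = emeasure (lborel \<Otimes>\<^sub>M (lborel \<Otimes>\<^sub>M lborel)) ({l $ 1<..<u $ 1} \<times> ({l $ 2<..<u $ 2} \<times> {l $ 3<..<u $ 3}))"
    unfolding pre by (simp add: lborel_prod)
  also have "\<dots> = ennreal (u $ 1 - l $ 1) * (ennreal (u $ 2 - l $ 2) * ennreal (u $ 3 - l $ 3))"
  proof -
    have "{l $ 2<..<u $ 2} \<times> {l $ 3<..<u $ 3} \<in> sets lborel"
      unfolding sets_lborel borel_prod[symmetric] by (rule pair_measureI) auto
    then have "emeasure (lborel \<Otimes>\<^sub>M lborel) ({l $ 1<..<u $ 1} \<times> ({l $ 2<..<u $ 2} \<times> {l $ 3<..<u $ 3})) =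
       emeasure lborel {l $ 1<..<u $ 1} * emeasure lborel ({l $ 2<..<u $ 2} \<times> {l $ 3<..<u $ 3})"
      by (intro lborel.emeasure_pair_measure_Times) auto
    moreover have "emeasure (lborel \<Otimes>\<^sub>M lborel) ({l $ 2<..<u $ 2} \<times> {l $ 3<..<u $ 3}) =
       emeasure lborel {l $ 2<..<u $ 2} * emeasure lborel {l $ 3<..<u $ 3}"
      by (intro lborel.emeasure_pair_measure_Times) auto
    ultimately show ?thesis using le by (simp add: lborel_prod)
  qed
  also have "\<dots> = ennreal (\<Prod>i\<in>UNIV. (u - l) $ i)"
  proof -
    have "(\<Prod>i\<in>UNIV. (u - l) $ i) = (u $ 1 - l $ 1) * ((u $ 2 - l $ 2) * (u $ 3 - l $ 3))"
      unfolding UNIV_3 by simp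
    then show ?thesis using le[of 1] le[of 2] le[of 3] by (simp add: ennreal_mult)
  qed
  also have "(\<Prod>i\<in>UNIV. (u - l) $ i) = (\<Prod>b\<in>Basis. (u - l) \<bullet> b)"
  proof -
    have B: "(Basis :: (real^3) set) = (\<lambda>i. axis i 1) ` UNIV" by (auto simp: Basis_vec_def)
    show ?thesis
      unfolding B by (subst prod.reindex) (auto simp: inj_on_def axis_eq_axis inner_axis)
  qed
  finally show "emeasure (distr lborel borel vec3) (box l u) = ennreal (\<Prod>b\<in>Basis. (u - l) \<bullet> b)" .
qed simp

lemma nn_integral_vec3:
  assumes [measurable]: "f \<in> borel_measurable borel"
  shows "(\<integral>\<^sup>+p. f p \<partial>lborel) = (\<integral>\<^sup>+x. \<integral>\<^sup>+y. \<integral>\<^sup>+z. f (vec3 (x, y, z)) \<partial>lborel \<partial>lborel \<partial>lborel)"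
proof -
  have [measurable]: "(\<lambda>p. f (vec3 p)) \<in> borel_measurable (borel \<Otimes>\<^sub>M borel \<Otimes>\<^sub>M borel)"
    unfolding borel_prod by measurable
  have "(\<integral>\<^sup>+p. f p \<partial>lborel) = (\<integral>\<^sup>+p. f (vec3 p) \<partial>lborel)"
    by (subst lborel_vec3[symmetric]) (simp add: nn_integral_distr)
  also have "\<dots> = (\<integral>\<^sup>+p. f (vec3 p) \<partial>(lborel \<Otimes>\<^sub>M (lborel \<Otimes>\<^sub>M lborel)))"
    by (simp add: lborel_prod)
  also have "\<dots> = (\<integral>\<^sup>+x. \<integral>\<^sup>+q. f (vec3 (x, q)) \<partial>(lborel \<Otimes>\<^sub>M lborel) \<partial>lborel)"
    by (subst sigma_finite_measure.nn_integral_fst[symmetric]) 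
       (auto simp: lborel_prod intro: sigma_finite_lborel)
  also have "\<dots> = (\<integral>\<^sup>+x. \<integral>\<^sup>+y. \<integral>\<^sup>+z. f (vec3 (x, y, z)) \<partial>lborel \<partial>lborel \<partial>lborel)"
    by (intro nn_integral_cong, subst lborel.nn_integral_fst[symmetric]) auto
  finally show ?thesis .
qed

text \<open>Vanishing on the left turns the value at \<open>x\<close> into an integral of the
  derivative. The bound is stated in the extended reals, so it holds whether or not the derivative
  is integrable over the line.\<close>

lemma le_nn_integral_deriv:
  fixes g g' :: "real \<Rightarrow> real"
  assumes der: "\<And>s. (g has_real_derivative g' s) (at s)" and c: "continuous_on UNIV g'"
    and z: "\<And>s. s \<le> R \<Longrightarrow> g s = 0"
  shows "ennreal (g x) \<le> (\<integral>\<^sup>+s. ennreal \<bar>g' s\<bar> \<partial>lborel)"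
proof (cases "x \<le> R")
  case True
  then show ?thesis using z by simp
next
  case False
  have i: "(g' has_integral (g x - g R)) {R..x}"
    by (rule fundamental_theorem_of_calculus)
      (use False der in \<open>auto simp: has_real_derivative_iff_has_vector_derivative[symmetric] intro: DERIV_subset\<close>)
  have ia: "(\<lambda>s. \<bar>g' s\<bar>) integrable_on {R..x}"
    by (intro integrable_continuous_real continuous_intros continuous_on_subset[OF c]) auto
  have "g x = integral {R..x} g'" using i z[of R] by (simp add: integral_unique)
  also have "\<dots> \<le> integral {R..x} (\<lambda>s. \<bar>g' s\<bar>)"
    by (rule integral_le) (use i ia in \<open>auto intro: has_integral_integrable\<close>)
  finally have "ennreal (g x) \<le> ennreal (integral {R..x} (\<lambda>s. \<bar>g' s\<bar>))" by (rule ennreal_leI)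
  also have "\<dots> = (\<integral>\<^sup>+s. ennreal (indicator {R..x} s * \<bar>g' s\<bar>) \<partial>lborel)"
    by (rule nn_integral_has_integral_lebesgue[symmetric]) (use ia in \<open>auto intro: integrable_integral\<close>)
  also have "\<dots> \<le> (\<integral>\<^sup>+s. ennreal \<bar>g' s\<bar> \<partial>lborel)"
    by (intro nn_integral_mono ennreal_leI) (auto simp: indicator_def)
  finally show ?thesis .
qed

text \<open>The fourth power makes the Gagliardo argument close in dimension three: its square root
  is \<phi>^2, three such factors give \<phi>^6, and in its derivative the factor \<phi>^3, whose
  square is again \<phi>^6, stands next to a partial derivative.\<close>

lemma test_fun_le_line_integral:
  fixes \<phi> :: "real^'n::finite \<Rightarrow> real"
  assumes \<phi>: "test_fun U \<phi>"
  shows "ennreal ((\<phi> (b + x *\<^sub>R axis i 1)) ^ 4) \<le>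
    (\<integral>\<^sup>+s. ennreal (4 * \<bar>\<phi> (b + s *\<^sub>R axis i 1)\<bar> ^ 3 * norm (cgrad \<phi> (b + s *\<^sub>R axis i 1))) \<partial>lborel)"
proof -
  let ?l = "\<lambda>s. b + s *\<^sub>R axis i 1 :: real^'n"
  have sm: "smooth \<phi>" and B: "axis i (1::real) \<in> Basis"
    using test_funD(1)[OF \<phi>] by (auto simp: axis_in_Basis_iff)
  obtain K where K: "compact K" "\<And>x. x \<notin> K \<Longrightarrow> \<phi> x = 0"
    using \<phi> unfolding test_fun_def by blast
  obtain r where r: "\<And>x. x \<in> K \<Longrightarrow> norm x \<le> r"
    using compact_imp_bounded[OF K(1)] unfolding bounded_iff by blast
  \<comment> \<open>So far to the left the line is outside the ball of radius \<open>r\<close> that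
    contains the support.\<close>
  have z: "\<phi> (?l s) = 0" if "s \<le> - (\<bar>r\<bar> + norm b + 1)" for s
  proof (rule K(2), rule notI)
    assume "?l s \<in> K"
    then have "norm (?l s) \<le> r" by (rule r)
    moreover have "norm (s *\<^sub>R axis i 1 :: real^'n) \<le> norm (?l s) + norm b"
      using norm_triangle_ineq4[of "?l s" b] by simp
    ultimately show False using that by (simp add: norm_axis_1)
  qed
  have d: "((\<lambda>s. (\<phi> (?l s)) ^ 4) has_real_derivative 4 * (\<phi> (?l s)) ^ 3 * partial i \<phi> (?l s)) (at s)" for s
    using DERIV_power[OF smooth_has_dderiv_at[OF sm B, of b s], of 4]
    by (simp add: partial_def mult_ac)
  have cp: "continuous_on UNIV (\<lambda>s. \<phi> (?l s))" "continuous_on UNIV (\<lambda>s. partial i \<phi> (?l s))"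
    by (auto intro!: continuous_on_compose2[OF test_funD(2)[OF \<phi>]] continuous_on_compose2[OF test_funD(2)[OF test_fun_partial[OF \<phi>, of i]]] continuous_intros)
  have "ennreal ((\<phi> (?l x)) ^ 4) \<le> (\<integral>\<^sup>+s. ennreal \<bar>4 * (\<phi> (?l s)) ^ 3 * partial i \<phi> (?l s)\<bar> \<partial>lborel)"
    by (rule le_nn_integral_deriv[OF d, of "- (\<bar>r\<bar> + norm b + 1)"]) (use z cp in \<open>auto intro!: continuous_intros\<close>)
  also have "\<dots> \<le> (\<integral>\<^sup>+s. ennreal (4 * \<bar>\<phi> (?l s)\<bar> ^ 3 * norm (cgrad \<phi> (?l s))) \<partial>lborel)"
  proof (intro nn_integral_mono ennreal_leI)
    fix s
    have "\<bar>partial i \<phi> (?l s)\<bar> \<le> norm (cgrad \<phi> (?l s))"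
      using component_le_norm_cart[of "cgrad \<phi> (?l s)" i] by (simp add: cgrad_def)
    then show "\<bar>4 * (\<phi> (?l s)) ^ 3 * partial i \<phi> (?l s)\<bar> \<le> 4 * \<bar>\<phi> (?l s)\<bar> ^ 3 * norm (cgrad \<phi> (?l s))"
      by (simp add: abs_mult power_abs mult_left_mono)
  qed
  finally show ?thesis .
qed

text \<open>X, Y and Z stand for the integrals of \<phi>^6, of |\<phi>|^3 |grad \<phi>| and of |grad
  \<phi>|^2. Then X^4 \<le> (4 Y)^6 \<le> 4096 X^3 Z^3 with 4096 = 4^6, and X^3 cancels because X is
  finite and, apart from a trivial case, nonzero.\<close>

lemma sobolev_algebra:
  fixes X Y Z :: ennreal
  assumes "X\<^sup>2 \<le> (4 * Y) ^ 3" "Y\<^sup>2 \<le> X * Z" "X < top"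
  shows "X \<le> 4096 * Z ^ 3"
proof (cases "Z = top \<or> X = 0")
  case True
  then show ?thesis by (auto simp: ennreal_mult_top power_top_ennreal)
next
  case False
  then obtain z where z: "Z = ennreal z" "z \<ge> 0" by (cases Z) auto
  obtain x where x: "X = ennreal x" "x \<ge> 0" using assms(3) by (cases X) auto
  have x0: "x > 0" using False x by auto
  have "Y\<^sup>2 < top" using assms(2) x z by (metis ennreal_less_top ennreal_mult le_less_trans)
  then obtain y where y: "Y = ennreal y" "y \<ge> 0" by (cases Y) (auto simp: power2_eq_square)
  have 1: "x\<^sup>2 \<le> (4 * y) ^ 3"
    using assms(1) x y by (simp add: ennreal_power ennreal_mult'[symmetric] flip: ennreal_numeral)
  have 2: "y\<^sup>2 \<le> x * z"
    using assms(2) x y z by (simp add: ennreal_power ennreal_mult'[symmetric])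
  have "x ^ 3 * x = (x\<^sup>2)\<^sup>2" by (simp add: eval_nat_numeral)
  also have "\<dots> \<le> ((4 * y) ^ 3)\<^sup>2" by (rule power_mono[OF 1]) simp
  also have "\<dots> = 4096 * (y\<^sup>2) ^ 3" by (simp add: power_mult_distrib flip: power_mult)
  also have "\<dots> \<le> 4096 * (x * z) ^ 3" by (intro mult_left_mono power_mono 2) auto
  also have "\<dots> = x ^ 3 * (4096 * z ^ 3)" by (simp add: power_mult_distrib)
  finally have "x \<le> 4096 * z ^ 3" using x0 by (simp add: mult_le_cancel_left)
  then have "ennreal x \<le> ennreal (4096 * z ^ 3)" by (rule ennreal_leI)
  then show ?thesis
    using x z by (simp add: ennreal_mult ennreal_power[symmetric])
qed

theorem sobolev_test_fun:
  fixes \<phi> :: "real^3 \<Rightarrow> real"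
  assumes \<phi>: "test_fun U \<phi>"
  shows "(\<integral>\<^sup>+x. ennreal (\<phi> x ^ 6) \<partial>lborel) \<le> 4096 * (\<integral>\<^sup>+x. ennreal ((norm (cgrad \<phi> x))\<^sup>2) \<partial>lborel) ^ 3"
proof (rule sobolev_algebra)
  let ?Y = "\<integral>\<^sup>+x. ennreal (\<bar>\<phi> x\<bar> ^ 3) * ennreal (norm (cgrad \<phi> x)) \<partial>lborel"
  define D where "D p = ennreal (4 * \<bar>\<phi> p\<bar> ^ 3 * norm (cgrad \<phi> p))" for p
  have [measurable]: "\<phi> \<in> borel_measurable borel" by (rule test_funD(3)[OF \<phi>])
  have [measurable]: "cgrad \<phi> \<in> borel_measurable borel"
    by (rule borel_measurable_continuous_onI[OF cgrad_continuous[OF test_funD(1)[OF \<phi>]]])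
  have Dm [measurable]: "D \<in> borel_measurable borel" unfolding D_def by measurable
  have [measurable]: "(\<lambda>p. D (vec3 p)) \<in> borel_measurable (borel \<Otimes>\<^sub>M borel \<Otimes>\<^sub>M borel)"
    unfolding borel_prod by measurable
  have [measurable]: "(\<lambda>p. ennreal (\<phi> (vec3 p) ^ 6)) \<in> borel_measurable (borel \<Otimes>\<^sub>M borel \<Otimes>\<^sub>M borel)"
    unfolding borel_prod by measurable
  \<comment> \<open>Each of these functions depends on two coordinates only and dominates \<phi>^2
    along the whole line in the missing direction, which is the shape that
    \<open>Loomis_Whitney\<close> expects.\<close>
  define f1 where "f1 = (\<lambda>(y, z). esqrt (\<integral>\<^sup>+s. D (vec3 (s, y, z)) \<partial>lborel))"
  define f2 where "f2 = (\<lambda>(x, z). esqrt (\<integral>\<^sup>+s. D (vec3 (x, s, z)) \<partial>lborel))"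
  define f3 where "f3 = (\<lambda>(x, y). esqrt (\<integral>\<^sup>+s. D (vec3 (x, y, s)) \<partial>lborel))"
  have m: "f1 \<in> borel_measurable borel" "f2 \<in> borel_measurable borel" "f3 \<in> borel_measurable borel"
    unfolding f1_def f2_def f3_def borel_prod[symmetric] by measurable
  have "?Y * 4 = (\<integral>\<^sup>+p. D p \<partial>lborel)"
    unfolding D_def by (subst nn_integral_multc[symmetric]) (auto simp: ennreal_mult' mult_ac intro!: nn_integral_cong)
  then have Y4: "4 * ?Y = (\<integral>\<^sup>+p. D p \<partial>lborel)" by (simp add: mult.commute)
  have b1: "ennreal ((\<phi> (vec3 (x, y, z)))\<^sup>2) \<le> f1 (y, z)" for x y z
    unfolding f1_def split
    using test_fun_le_line_integral[OF \<phi>, of "vec3 (0, y, z)" x 1]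
    by (intro le_esqrt) (auto simp: D_def vec3_shift(1)[of _ y z, symmetric] simp flip: power_mult)
  have b2: "ennreal ((\<phi> (vec3 (x, y, z)))\<^sup>2) \<le> f2 (x, z)" for x y z
    unfolding f2_def split
    using test_fun_le_line_integral[OF \<phi>, of "vec3 (x, 0, z)" y 2]
    by (intro le_esqrt) (auto simp: D_def vec3_shift(2)[of x _ z, symmetric] simp flip: power_mult)
  have b3: "ennreal ((\<phi> (vec3 (x, y, z)))\<^sup>2) \<le> f3 (x, y)" for x y z
    unfolding f3_def split
    using test_fun_le_line_integral[OF \<phi>, of "vec3 (x, y, 0)" z 3]
    by (intro le_esqrt) (auto simp: D_def vec3_shift(3)[of x y, symmetric] simp flip: power_mult)
  have pt: "ennreal (\<phi> (vec3 (x, y, z)) ^ 6) \<le> f1 (y, z) * f2 (x, z) * f3 (x, y)" for x y z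
  proof -
    let ?a = "\<phi> (vec3 (x, y, z))"
    have "ennreal (?a ^ 6) = ennreal (?a\<^sup>2) * ennreal (?a\<^sup>2) * ennreal (?a\<^sup>2)"
      by (simp add: ennreal_mult'[symmetric] flip: power_add)
    also have "\<dots> \<le> f1 (y, z) * f2 (x, z) * f3 (x, y)"
      by (intro mult_mono b1 b2 b3) auto
    finally show ?thesis .
  qed
  have "(\<integral>\<^sup>+x. ennreal (\<phi> x ^ 6) \<partial>lborel) = (\<integral>\<^sup>+x. \<integral>\<^sup>+y. \<integral>\<^sup>+z. ennreal (\<phi> (vec3 (x, y, z)) ^ 6) \<partial>lborel \<partial>lborel \<partial>lborel)"
    by (rule nn_integral_vec3) measurable
  \<comment> \<open>The integrals are brought into the order of \<open>Loomis_Whitney\<close>, with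
    \<open>y\<close> outermost and \<open>x\<close> innermost.\<close>
  also have "\<dots> = (\<integral>\<^sup>+y. \<integral>\<^sup>+x. \<integral>\<^sup>+z. ennreal (\<phi> (vec3 (x, y, z)) ^ 6) \<partial>lborel \<partial>lborel \<partial>lborel)"
    by (rule lborel_pair.Fubini') measurable
  also have "\<dots> = (\<integral>\<^sup>+y. \<integral>\<^sup>+z. \<integral>\<^sup>+x. ennreal (\<phi> (vec3 (x, y, z)) ^ 6) \<partial>lborel \<partial>lborel \<partial>lborel)"
    by (intro nn_integral_cong lborel_pair.Fubini') measurable
  also have "\<dots> \<le> (\<integral>\<^sup>+y. \<integral>\<^sup>+z. \<integral>\<^sup>+x. f1 (y, z) * f2 (x, z) * f3 (x, y) \<partial>lborel \<partial>lborel \<partial>lborel)"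
    by (intro nn_integral_mono pt)
  finally have "(\<integral>\<^sup>+x. ennreal (\<phi> x ^ 6) \<partial>lborel)\<^sup>2 \<le>
     (\<integral>\<^sup>+y. \<integral>\<^sup>+z. \<integral>\<^sup>+x. f1 (y, z) * f2 (x, z) * f3 (x, y) \<partial>lborel \<partial>lborel \<partial>lborel)\<^sup>2"
    by (rule power_mono) simp
  also have "\<dots> \<le> (\<integral>\<^sup>+y. \<integral>\<^sup>+z. (f1 (y, z))\<^sup>2 \<partial>lborel \<partial>lborel) * (\<integral>\<^sup>+z. \<integral>\<^sup>+x. (f2 (x, z))\<^sup>2 \<partial>lborel \<partial>lborel)
       * (\<integral>\<^sup>+y. \<integral>\<^sup>+x. (f3 (x, y))\<^sup>2 \<partial>lborel \<partial>lborel)"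
    by (rule Loomis_Whitney[OF m])
  also have "(\<integral>\<^sup>+y. \<integral>\<^sup>+z. (f1 (y, z))\<^sup>2 \<partial>lborel \<partial>lborel) = (\<integral>\<^sup>+p. D p \<partial>lborel)"
  proof -
    have "(\<integral>\<^sup>+p. D p \<partial>lborel) = (\<integral>\<^sup>+x. \<integral>\<^sup>+y. \<integral>\<^sup>+z. D (vec3 (x, y, z)) \<partial>lborel \<partial>lborel \<partial>lborel)"
      by (rule nn_integral_vec3[OF Dm])
    also have "\<dots> = (\<integral>\<^sup>+y. \<integral>\<^sup>+x. \<integral>\<^sup>+z. D (vec3 (x, y, z)) \<partial>lborel \<partial>lborel \<partial>lborel)"
      by (rule lborel_pair.Fubini') measurable
    also have "\<dots> = (\<integral>\<^sup>+y. \<integral>\<^sup>+z. \<integral>\<^sup>+x. D (vec3 (x, y, z)) \<partial>lborel \<partial>lborel \<partial>lborel)"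
      by (intro nn_integral_cong lborel_pair.Fubini') measurable
    finally show ?thesis by (simp add: f1_def esqrt_square)
  qed
  also have "(\<integral>\<^sup>+z. \<integral>\<^sup>+x. (f2 (x, z))\<^sup>2 \<partial>lborel \<partial>lborel) = (\<integral>\<^sup>+p. D p \<partial>lborel)"
  proof -
    have "(\<integral>\<^sup>+p. D p \<partial>lborel) = (\<integral>\<^sup>+x. \<integral>\<^sup>+y. \<integral>\<^sup>+z. D (vec3 (x, y, z)) \<partial>lborel \<partial>lborel \<partial>lborel)"
      by (rule nn_integral_vec3[OF Dm])
    also have "\<dots> = (\<integral>\<^sup>+x. \<integral>\<^sup>+z. \<integral>\<^sup>+y. D (vec3 (x, y, z)) \<partial>lborel \<partial>lborel \<partial>lborel)"
      by (intro nn_integral_cong lborel_pair.Fubini') measurable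
    also have "\<dots> = (\<integral>\<^sup>+z. \<integral>\<^sup>+x. \<integral>\<^sup>+y. D (vec3 (x, y, z)) \<partial>lborel \<partial>lborel \<partial>lborel)"
      by (rule lborel_pair.Fubini') measurable
    finally show ?thesis by (simp add: f2_def esqrt_square)
  qed
  also have "(\<integral>\<^sup>+y. \<integral>\<^sup>+x. (f3 (x, y))\<^sup>2 \<partial>lborel \<partial>lborel) = (\<integral>\<^sup>+p. D p \<partial>lborel)"
  proof -
    have "(\<integral>\<^sup>+p. D p \<partial>lborel) = (\<integral>\<^sup>+x. \<integral>\<^sup>+y. \<integral>\<^sup>+z. D (vec3 (x, y, z)) \<partial>lborel \<partial>lborel \<partial>lborel)"
      by (rule nn_integral_vec3[OF Dm])
    also have "\<dots> = (\<integral>\<^sup>+y. \<integral>\<^sup>+x. \<integral>\<^sup>+z. D (vec3 (x, y, z)) \<partial>lborel \<partial>lborel \<partial>lborel)"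
      by (rule lborel_pair.Fubini') measurable
    finally show ?thesis by (simp add: f3_def esqrt_square)
  qed
  finally show "(\<integral>\<^sup>+x. ennreal (\<phi> x ^ 6) \<partial>lborel)\<^sup>2 \<le> (4 * ?Y) ^ 3"
    unfolding Y4 by (simp add: power3_eq_cube)
  have "?Y\<^sup>2 \<le> (\<integral>\<^sup>+x. (ennreal (\<bar>\<phi> x\<bar> ^ 3))\<^sup>2 \<partial>lborel) * (\<integral>\<^sup>+x. (ennreal (norm (cgrad \<phi> x)))\<^sup>2 \<partial>lborel)"
    by (rule Cauchy_Schwarz_nn_integral) measurable
  then show "?Y\<^sup>2 \<le> (\<integral>\<^sup>+x. ennreal (\<phi> x ^ 6) \<partial>lborel) * (\<integral>\<^sup>+x. ennreal ((norm (cgrad \<phi> x))\<^sup>2) \<partial>lborel)"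
    by (simp add: ennreal_power power_even_abs flip: power_mult)
  show "(\<integral>\<^sup>+x. ennreal (\<phi> x ^ 6) \<partial>lborel) < top"
  proof -
    \<comment> \<open>Finiteness is what permits the cancellation in \<open>sobolev_algebra\<close>;
      it holds because \<phi> is bounded with compact support.\<close>
    obtain B where B: "B \<ge> 0" "\<And>x. \<bar>\<phi> x\<bar> \<le> B" using test_fun_bounded[OF \<phi>] by blast
    obtain K where K: "compact K" "\<And>x. x \<notin> K \<Longrightarrow> \<phi> x = 0"
      using \<phi> unfolding test_fun_def by blast
    have "(\<integral>\<^sup>+x. ennreal (\<phi> x ^ 6) \<partial>lborel) \<le> (\<integral>\<^sup>+x. ennreal (B ^ 6) * indicator K x \<partial>lborel)"
    proof (rule nn_integral_mono)
      fix x
      have "\<phi> x ^ 6 = \<bar>\<phi> x\<bar> ^ 6" by (simp add: power_even_abs)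
      also have "\<dots> \<le> B ^ 6" by (intro power_mono B) simp
      finally show "ennreal (\<phi> x ^ 6) \<le> ennreal (B ^ 6) * indicator K x"
        using K(2)[of x] by (cases "x \<in> K") (auto intro: ennreal_leI)
    qed
    also have "\<dots> = ennreal (B ^ 6) * emeasure lborel K"
      by (rule nn_integral_cmult_indicator) (use K(1) in \<open>simp add: borel_compact\<close>)
    also have "\<dots> < top"
      using emeasure_compact_finite[OF K(1)] by (simp add: ennreal_mult_less_top)
    finally show ?thesis .
  qed
qed

lemma nn_integral_lebesgue_on_eq_lborel:
  assumes "f \<in> borel_measurable borel" "\<And>x. x \<notin> U \<Longrightarrow> f x = 0" "U \<in> sets lebesgue"
  shows "(\<integral>\<^sup>+x. f x \<partial>lebesgue_on U) = (\<integral>\<^sup>+x. f x \<partial>lborel)"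
proof -
  have "(\<integral>\<^sup>+x. f x \<partial>lebesgue_on U) = (\<integral>\<^sup>+x. f x * indicator U x \<partial>lebesgue)"
    by (rule nn_integral_restrict_space) (use assms in auto)
  also have "\<dots> = (\<integral>\<^sup>+x. f x \<partial>lebesgue)"
    by (rule nn_integral_cong) (use assms(2) in \<open>auto simp: indicator_def\<close>)
  also have "\<dots> = (\<integral>\<^sup>+x. f x \<partial>lborel)"
    by (rule nn_integral_completion)
  finally show ?thesis .
qed

lemma sobolev_test_fun_on:
  fixes \<phi> :: "real^3 \<Rightarrow> real"
  assumes \<phi>: "test_fun U \<phi>" and U: "U \<in> lmeasurable"
  shows "(\<integral>\<^sup>+x. ennreal (\<phi> x ^ 6) \<partial>lebesgue_on U) \<le> ennreal (4096 * (L2vsq U (cgrad \<phi>)) ^ 3)"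
proof -
  have Um: "U \<in> sets lebesgue" using U by (simp add: fmeasurableD)
  have [measurable]: "\<phi> \<in> borel_measurable borel" by (rule test_funD(3)[OF \<phi>])
  have [measurable]: "cgrad \<phi> \<in> borel_measurable borel"
    by (rule borel_measurable_continuous_onI[OF cgrad_continuous[OF test_funD(1)[OF \<phi>]]])
  have cz: "cgrad \<phi> x = 0" if "x \<notin> U" for x
    using test_funD(4)[OF test_fun_partial[OF \<phi>] that] by (simp add: cgrad_def vec_eq_iff)
  have 1: "(\<integral>\<^sup>+x. ennreal (\<phi> x ^ 6) \<partial>lebesgue_on U) = (\<integral>\<^sup>+x. ennreal (\<phi> x ^ 6) \<partial>lborel)"
    by (rule nn_integral_lebesgue_on_eq_lborel) (use test_funD(4)[OF \<phi>] Um in auto)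
  have 2: "(\<integral>\<^sup>+x. ennreal ((norm (cgrad \<phi> x))\<^sup>2) \<partial>lebesgue_on U) = (\<integral>\<^sup>+x. ennreal ((norm (cgrad \<phi> x))\<^sup>2) \<partial>lborel)"
    by (rule nn_integral_lebesgue_on_eq_lborel) (use cz Um in auto)
  have 3: "(\<integral>\<^sup>+x. ennreal ((norm (cgrad \<phi> x))\<^sup>2) \<partial>lebesgue_on U) = ennreal (L2vsq U (cgrad \<phi>))"
    unfolding L2vsq_def by (rule nn_integral_eq_integral) (use cgrad_L2vec[OF \<phi> U] in \<open>auto simp: L2vec_def\<close>)
  show ?thesis
    using sobolev_test_fun[OF \<phi>] L2vsq_nonneg[of U "cgrad \<phi>"]
    unfolding 1 2[symmetric] 3 by (simp add: ennreal_mult ennreal_power[symmetric])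
qed

text \<open>Fatou's lemma along a subsequence of the approximating test functions that converges
  almost everywhere; the right-hand sides converge because the gradients converge in L^2.\<close>

theorem sobolev:
  fixes w :: "real^3 \<Rightarrow> real"
  assumes "H01_pair U w g" and U: "U \<in> lmeasurable"
  shows "integrable (lebesgue_on U) (\<lambda>x. w x ^ 6)"
    and "(\<integral>x. w x ^ 6 \<partial>lebesgue_on U) \<le> 4096 * (L2vsq U g) ^ 3"
proof -
  obtain \<phi> where \<phi>: "\<And>n. test_fun U (\<phi> n)" "(\<lambda>n. l2_norm U (\<lambda>x. \<phi> n x - w x)) \<longlonglongrightarrow> 0"
     "(\<lambda>n. l2_norm U (\<lambda>x. cgrad (\<phi> n) x - g x)) \<longlonglongrightarrow> 0" and L: "L2vec U w" "L2vec U g"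
    using assms(1) unfolding H01_pair_def by blast
  have wm [measurable]: "w \<in> borel_measurable (lebesgue_on U)" using L by (simp add: L2vec_def)
  have pm [measurable]: "\<phi> n \<in> borel_measurable (lebesgue_on U)" for n
    using test_fun_L2vec[OF \<phi>(1) U] by (simp add: L2vec_def)
  have i: "integrable (lebesgue_on U) (\<lambda>x. (\<phi> n x - w x)\<^sup>2)" for n
    using L2vec_diff[OF test_fun_L2vec[OF \<phi>(1) U] L(1)] by (simp add: L2vec_def)
  have "(\<lambda>n. \<integral>x. norm ((\<phi> n x - w x)\<^sup>2) \<partial>lebesgue_on U) \<longlonglongrightarrow> 0"
    using \<phi>(2) unfolding tendsto_l2_norm_iff[symmetric] by (simp add: L2vsq_def)
  from tendsto_L1_AE_subseq[OF i this]
  obtain r :: "nat \<Rightarrow> nat" where r: "strict_mono r" "AE x in lebesgue_on U. (\<lambda>n. (\<phi> (r n) x - w x)\<^sup>2) \<longlonglongrightarrow> 0"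
    by blast
  have ae: "AE x in lebesgue_on U. liminf (\<lambda>n. ennreal (\<phi> (r n) x ^ 6)) = ennreal (w x ^ 6)"
    using r(2)
  proof eventually_elim
    case (elim x)
    then have "(\<lambda>n. sqrt ((\<phi> (r n) x - w x)\<^sup>2)) \<longlonglongrightarrow> sqrt 0" by (rule tendsto_real_sqrt)
    then have "(\<lambda>n. \<phi> (r n) x - w x) \<longlonglongrightarrow> 0" by (simp add: tendsto_rabs_zero_iff)
    then have "(\<lambda>n. \<phi> (r n) x) \<longlonglongrightarrow> w x" by (simp add: Lim_null[symmetric])
    then have "(\<lambda>n. ennreal (\<phi> (r n) x ^ 6)) \<longlonglongrightarrow> ennreal (w x ^ 6)"
      by (intro tendsto_ennrealI tendsto_power)
    then show ?case by (intro lim_imp_Liminf) auto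
  qed
  have lg: "(\<lambda>n. L2vsq U (cgrad (\<phi> n))) \<longlonglongrightarrow> L2vsq U g"
    unfolding l2_inner_self[symmetric]
    by (rule tendsto_l2_inner[of UNIV]) (use cgrad_L2vec[OF \<phi>(1) U] L \<phi>(3) in auto)
  have "(\<lambda>n. 4096 * (L2vsq U (cgrad (\<phi> (r n)))) ^ 3) \<longlonglongrightarrow> 4096 * (L2vsq U g) ^ 3"
    using LIMSEQ_subseq_LIMSEQ[OF lg r(1)] by (intro tendsto_intros) (simp add: comp_def)
  then have lim: "(\<lambda>n. ennreal (4096 * (L2vsq U (cgrad (\<phi> (r n)))) ^ 3)) \<longlonglongrightarrow> ennreal (4096 * (L2vsq U g) ^ 3)"
    by (rule tendsto_ennrealI)
  have "(\<integral>\<^sup>+x. ennreal (w x ^ 6) \<partial>lebesgue_on U) = (\<integral>\<^sup>+x. liminf (\<lambda>n. ennreal (\<phi> (r n) x ^ 6)) \<partial>lebesgue_on U)"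
    by (rule nn_integral_cong_AE) (use ae in \<open>auto elim: AE_mp\<close>)
  also have "\<dots> \<le> liminf (\<lambda>n. \<integral>\<^sup>+x. ennreal (\<phi> (r n) x ^ 6) \<partial>lebesgue_on U)"
    by (rule nn_integral_liminf) measurable
  also have "\<dots> \<le> liminf (\<lambda>n. ennreal (4096 * (L2vsq U (cgrad (\<phi> (r n)))) ^ 3))"
    by (rule Liminf_mono) (use sobolev_test_fun_on[OF \<phi>(1) U] in auto)
  also have "\<dots> = ennreal (4096 * (L2vsq U g) ^ 3)"
    by (rule lim_imp_Liminf[OF _ lim]) simp
  finally have fin: "(\<integral>\<^sup>+x. ennreal (w x ^ 6) \<partial>lebesgue_on U) \<le> ennreal (4096 * (L2vsq U g) ^ 3)" .
  show int: "integrable (lebesgue_on U) (\<lambda>x. w x ^ 6)"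
    by (rule integrableI_nonneg) (use fin in \<open>auto simp: le_less_trans[OF _ ennreal_less_top]\<close>)
  have "ennreal (\<integral>x. w x ^ 6 \<partial>lebesgue_on U) \<le> ennreal (4096 * (L2vsq U g) ^ 3)"
    using fin nn_integral_eq_integral[OF int] by simp
  then show "(\<integral>x. w x ^ 6 \<partial>lebesgue_on U) \<le> 4096 * (L2vsq U g) ^ 3"
    using L2vsq_nonneg[of U g] by (simp add: ennreal_le_iff)
qed

section \<open>Hoelder estimates for the quintic nonlinearity\<close>

lemma Holder_cubes:
  fixes p q :: "'a \<Rightarrow> real"
  assumes [measurable]: "p \<in> borel_measurable M" "q \<in> borel_measurable M"
    and nn: "\<And>x. 0 \<le> p x" "\<And>x. 0 \<le> q x"
    and i: "integrable M (\<lambda>x. p x ^ 3)" "integrable M (\<lambda>x. q x ^ 3)"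
    and le: "(\<integral>x. p x ^ 3 \<partial>M) \<le> \<alpha> ^ 3" "(\<integral>x. q x ^ 3 \<partial>M) \<le> \<beta> ^ 3" and ab: "0 \<le> \<alpha>" "0 \<le> \<beta>"
  shows "integrable M (\<lambda>x. (p x)\<^sup>2 * q x)" "(\<integral>x. (p x)\<^sup>2 * q x \<partial>M) \<le> \<alpha>\<^sup>2 * \<beta>"
proof -
  \<comment> \<open>Young's inequality with weights 2/3 and 1/3: the two sides differ by a third of
    (a - b)^2 (2 a + b). Integrated after normalisation it gives Hoelder with exponents 3/2 and 3,
    stated through cubes so that no roots occur.\<close>
  have young: "a\<^sup>2 * b \<le> (2 * a ^ 3 + b ^ 3) / 3" if "0 \<le> a" "0 \<le> b" for a b :: real
  proof -
    have "0 \<le> (a - b)\<^sup>2 * (2 * a + b)" using that by simp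
    then show ?thesis by (simp add: power2_eq_square power3_eq_cube algebra_simps)
  qed
  show int: "integrable M (\<lambda>x. (p x)\<^sup>2 * q x)"
  proof (rule Bochner_Integration.integrable_bound)
    show "integrable M (\<lambda>x. (2 * p x ^ 3 + q x ^ 3) / 3)" using i by auto
    show "AE x in M. norm ((p x)\<^sup>2 * q x) \<le> norm ((2 * p x ^ 3 + q x ^ 3) / 3)"
      using young[OF nn(1) nn(2)] nn by (auto intro!: AE_I2)
  qed measurable
  have pos: "(\<integral>x. (p x)\<^sup>2 * q x \<partial>M) \<le> a\<^sup>2 * b" if a: "\<alpha> \<le> a" "0 < a" and b: "\<beta> \<le> b" "0 < b" for a b
  proof -
    have "(p x)\<^sup>2 * q x \<le> a\<^sup>2 * b * ((2 * p x ^ 3 / a ^ 3 + q x ^ 3 / b ^ 3) / 3)" for x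
    proof -
      have "(p x)\<^sup>2 * q x = a\<^sup>2 * b * ((p x / a)\<^sup>2 * (q x / b))"
        using a b by (simp add: power_divide)
      also have "\<dots> \<le> a\<^sup>2 * b * ((2 * (p x / a) ^ 3 + (q x / b) ^ 3) / 3)"
        using a b nn by (intro mult_left_mono young) auto
      finally show ?thesis by (simp add: power_divide)
    qed
    then have "(\<integral>x. (p x)\<^sup>2 * q x \<partial>M) \<le> (\<integral>x. a\<^sup>2 * b * ((2 * p x ^ 3 / a ^ 3 + q x ^ 3 / b ^ 3) / 3) \<partial>M)"
      by (intro integral_mono int) (use i in auto)
    also have "\<dots> = a\<^sup>2 * b * ((2 * ((\<integral>x. p x ^ 3 \<partial>M) / a ^ 3) + (\<integral>x. q x ^ 3 \<partial>M) / b ^ 3) / 3)"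
      using i by simp
    also have "\<dots> \<le> a\<^sup>2 * b * ((2 * 1 + 1) / 3)"
    proof -
      have "(\<integral>x. p x ^ 3 \<partial>M) \<le> a ^ 3" using le(1) power_mono[OF a(1) ab(1), of 3] by linarith
      moreover have "(\<integral>x. q x ^ 3 \<partial>M) \<le> b ^ 3" using le(2) power_mono[OF b(1) ab(2), of 3] by linarith
      ultimately show ?thesis
        using a b by (intro mult_left_mono divide_right_mono add_mono) (auto simp: divide_simps)
    qed
    finally show ?thesis by simp
  qed
  \<comment> \<open>\<alpha> and \<beta> may be zero, so the normalisation divides by slightly
    larger positive numbers and the excess \<open>e\<close> tends to 0.\<close>
  have "((\<lambda>e. (\<alpha> + e)\<^sup>2 * (\<beta> + e)) \<longlongrightarrow> (\<alpha> + 0)\<^sup>2 * (\<beta> + 0)) (at_right 0)"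
    by (intro tendsto_intros)
  then have "((\<lambda>e. (\<alpha> + e)\<^sup>2 * (\<beta> + e)) \<longlongrightarrow> \<alpha>\<^sup>2 * \<beta>) (at_right 0)" by simp
  then show "(\<integral>x. (p x)\<^sup>2 * q x \<partial>M) \<le> \<alpha>\<^sup>2 * \<beta>"
    by (rule tendsto_lowerbound)
      (use ab in \<open>auto simp: eventually_at_right_field intro!: exI[of _ 1] pos\<close>)
qed

text \<open>The fourth power of the L^12 norm of \<open>p\<close>, which is also the L^3 norm of
  \<open>p ^ 4\<close>; its cube is the integral itself.\<close>

definition L12_cube :: "(real^3) set \<Rightarrow> (real^3 \<Rightarrow> real) \<Rightarrow> real" where
  "L12_cube U p = (\<integral>x. \<bar>p x\<bar> powr 12 \<partial>lebesgue_on U) powr (1/3)"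

text \<open>\<open>Holder_cubes\<close> with p^4 and \<psi>^2 bounds the L^2 norm of p^4 |\<psi>|,
  and Cauchy-Schwarz pairs it with \<open>w\<close>. The Sobolev constant 4096 = 16^3 bounds the L^3
  norm of \<psi>^2 with factor 16, and the 4 is its square root.\<close>

lemma quartic_bound:
  fixes U :: "(real^3) set"
  assumes U: "U \<in> lmeasurable" and \<psi>: "H01_pair U \<psi> \<gamma>" and w: "L2vec U w"
    and pm [measurable]: "p \<in> borel_measurable (lebesgue_on U)"
    and p: "integrable (lebesgue_on U) (\<lambda>x. \<bar>p x\<bar> powr 12)"
  shows "integrable (lebesgue_on U) (\<lambda>x. p x ^ 4 * \<bar>w x\<bar> * \<bar>\<psi> x\<bar>)"
    "(\<integral>x. p x ^ 4 * \<bar>w x\<bar> * \<bar>\<psi> x\<bar> \<partial>lebesgue_on U) \<le> 4 * L12_cube U p * l2_norm U w * l2_norm U \<gamma>"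
proof -
  let ?\<alpha> = "L12_cube U p"
  have [measurable]: "\<psi> \<in> borel_measurable (lebesgue_on U)"
    using H01_pair_L2vec(1)[OF \<psi>] by (simp add: L2vec_def)
  have p12: "\<bar>y\<bar> powr 12 = (y ^ 4) ^ 3" for y :: real
    by (simp add: powr_numeral power_even_abs flip: power_mult)
  have a3: "?\<alpha> ^ 3 = (\<integral>x. (p x ^ 4) ^ 3 \<partial>lebesgue_on U)"
  proof -
    have nn: "0 \<le> (\<integral>x. (p x ^ 4) ^ 3 \<partial>lebesgue_on U)" by simp
    have "?\<alpha> ^ 3 = ((\<integral>x. (p x ^ 4) ^ 3 \<partial>lebesgue_on U) powr (1/3)) powr 3"
      unfolding L12_cube_def p12 by (simp add: powr_numeral)
    also have "\<dots> = (\<integral>x. (p x ^ 4) ^ 3 \<partial>lebesgue_on U)"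
      using nn by (simp add: powr_powr)
    finally show ?thesis .
  qed
  have i1: "integrable (lebesgue_on U) (\<lambda>x. (p x ^ 4) ^ 3)" using p unfolding p12 .
  have i2: "integrable (lebesgue_on U) (\<lambda>x. ((\<psi> x)\<^sup>2) ^ 3)"
    using sobolev(1)[OF \<psi> U] by (simp flip: power_mult)
  have le2: "(\<integral>x. ((\<psi> x)\<^sup>2) ^ 3 \<partial>lebesgue_on U) \<le> (16 * L2vsq U \<gamma>) ^ 3"
    using sobolev(2)[OF \<psi> U] by (simp add: power_mult_distrib flip: power_mult)
  have a0: "0 \<le> ?\<alpha>" "0 \<le> 16 * L2vsq U \<gamma>" by (auto simp: L12_cube_def L2vsq_nonneg)
  have m: "(\<lambda>x. p x ^ 4) \<in> borel_measurable (lebesgue_on U)" "(\<lambda>x. (\<psi> x)\<^sup>2) \<in> borel_measurable (lebesgue_on U)"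
    by measurable
  note h = Holder_cubes[OF m zero_le_even_power zero_le_even_power i1 i2 eq_refl[OF a3[symmetric]] le2 a0, simplified]
  have f: "L2vec U (\<lambda>x. p x ^ 4 * \<bar>\<psi> x\<bar>)"
    using h(1) by (simp add: L2vec_def power_mult_distrib flip: power_mult)
  have "(l2_norm U (\<lambda>x. p x ^ 4 * \<bar>\<psi> x\<bar>))\<^sup>2 \<le> (4 * ?\<alpha> * l2_norm U \<gamma>)\<^sup>2"
  proof -
    have "L2vsq U (\<lambda>x. p x ^ 4 * \<bar>\<psi> x\<bar>) = (\<integral>x. (p x ^ 4)\<^sup>2 * (\<psi> x)\<^sup>2 \<partial>lebesgue_on U)"
      by (simp add: L2vsq_def power_mult_distrib)
    then show ?thesis
      using h(2) by (simp add: l2_norm_square power_mult_distrib mult_ac)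
  qed
  then have nf: "l2_norm U (\<lambda>x. p x ^ 4 * \<bar>\<psi> x\<bar>) \<le> 4 * ?\<alpha> * l2_norm U \<gamma>"
    by (rule power2_le_imp_le) (simp add: L12_cube_def l2_norm_nonneg)
  have eq: "(\<lambda>x. p x ^ 4 * \<bar>w x\<bar> * \<bar>\<psi> x\<bar>) = (\<lambda>x. norm (w x) \<bullet> (p x ^ 4 * \<bar>\<psi> x\<bar>))"
    by (auto simp: mult_ac)
  show "integrable (lebesgue_on U) (\<lambda>x. p x ^ 4 * \<bar>w x\<bar> * \<bar>\<psi> x\<bar>)"
    unfolding eq by (rule L2vec_inner_integrable[OF L2vec_norm[OF w] f])
  have "(\<integral>x. p x ^ 4 * \<bar>w x\<bar> * \<bar>\<psi> x\<bar> \<partial>lebesgue_on U) \<le> l2_norm U w * l2_norm U (\<lambda>x. p x ^ 4 * \<bar>\<psi> x\<bar>)"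
    using l2_Cauchy_Schwarz[OF L2vec_norm[OF w] f] unfolding eq l2_inner_def l2_norm_norm by linarith
  also have "\<dots> \<le> l2_norm U w * (4 * ?\<alpha> * l2_norm U \<gamma>)"
    by (intro mult_left_mono nf l2_norm_nonneg)
  finally show "(\<integral>x. p x ^ 4 * \<bar>w x\<bar> * \<bar>\<psi> x\<bar> \<partial>lebesgue_on U) \<le> 4 * L12_cube U p * l2_norm U w * l2_norm U \<gamma>"
    by (simp add: mult_ac)
qed

lemma quintic_diff_bound: "\<bar>a ^ 5 - b ^ 5\<bar> \<le> 5 * (a ^ 4 + b ^ 4) * \<bar>a - b\<bar>" for a b :: real
proof -
  \<comment> \<open>A monomial of degree four is at most the fourth power of the larger of |a| and
    |b|; five of them occur in the quotient of a^5 - b^5 by a - b.\<close>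
  have m: "\<bar>a ^ i * b ^ j\<bar> \<le> a ^ 4 + b ^ 4" if "i + j = 4" for i j
  proof -
    let ?m = "max \<bar>a\<bar> \<bar>b\<bar>"
    have "\<bar>a ^ i * b ^ j\<bar> = \<bar>a\<bar> ^ i * \<bar>b\<bar> ^ j" by (simp add: abs_mult power_abs)
    also have "\<dots> \<le> ?m ^ i * ?m ^ j" by (intro mult_mono power_mono) auto
    also have "\<dots> = ?m ^ 4" using that by (simp flip: power_add)
    also have "\<dots> \<le> a ^ 4 + b ^ 4" by (auto simp: max_def power_even_abs)
    finally show ?thesis .
  qed
  have "a ^ 5 - b ^ 5 = (a - b) * (a ^ 4 * b ^ 0 + a ^ 3 * b ^ 1 + a ^ 2 * b ^ 2 + a ^ 1 * b ^ 3 + a ^ 0 * b ^ 4)"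
    by (simp add: eval_nat_numeral algebra_simps)
  then have "\<bar>a ^ 5 - b ^ 5\<bar> = \<bar>a - b\<bar> * \<bar>a ^ 4 * b ^ 0 + a ^ 3 * b ^ 1 + a ^ 2 * b ^ 2 + a ^ 1 * b ^ 3 + a ^ 0 * b ^ 4\<bar>"
    by (simp only: abs_mult)
  also have "\<dots> \<le> \<bar>a - b\<bar> * (5 * (a ^ 4 + b ^ 4))"
  proof (rule mult_left_mono)
    have "\<bar>a ^ 4 * b ^ 0\<bar> \<le> a ^ 4 + b ^ 4" "\<bar>a ^ 3 * b ^ 1\<bar> \<le> a ^ 4 + b ^ 4" "\<bar>a ^ 2 * b ^ 2\<bar> \<le> a ^ 4 + b ^ 4"
      "\<bar>a ^ 1 * b ^ 3\<bar> \<le> a ^ 4 + b ^ 4" "\<bar>a ^ 0 * b ^ 4\<bar> \<le> a ^ 4 + b ^ 4"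
      by (rule m; simp)+
    moreover have "\<bar>x1\<bar> \<le> S \<Longrightarrow> \<bar>x2\<bar> \<le> S \<Longrightarrow> \<bar>x3\<bar> \<le> S \<Longrightarrow> \<bar>x4\<bar> \<le> S \<Longrightarrow> \<bar>x5\<bar> \<le> S
        \<Longrightarrow> \<bar>x1 + x2 + x3 + x4 + x5\<bar> \<le> 5 * S" for x1 x2 x3 x4 x5 S :: real
      by linarith
    ultimately show "\<bar>a ^ 4 * b ^ 0 + a ^ 3 * b ^ 1 + a ^ 2 * b ^ 2 + a ^ 1 * b ^ 3 + a ^ 0 * b ^ 4\<bar> \<le> 5 * (a ^ 4 + b ^ 4)"
      by blast
  qed simp
  finally show ?thesis by (simp add: mult_ac)
qed

text \<open>Membership in H01 suffices, through L^6: the sixth power of the larger of |u| and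
  |\<psi>| dominates the product. The nonlinear pairing is thus meaningful at every time, not merely
  at almost every one.\<close>

lemma quintic_integrable:
  fixes U :: "(real^3) set"
  assumes U: "U \<in> lmeasurable" and u: "H01_pair U u g" and \<psi>: "H01_pair U \<psi> \<gamma>"
  shows "integrable (lebesgue_on U) (\<lambda>x. u x ^ 5 * \<psi> x)"
proof (rule Bochner_Integration.integrable_bound)
  show "integrable (lebesgue_on U) (\<lambda>x. u x ^ 6 + \<psi> x ^ 6)"
    using sobolev(1)[OF u U] sobolev(1)[OF \<psi> U] by auto
  show "(\<lambda>x. u x ^ 5 * \<psi> x) \<in> borel_measurable (lebesgue_on U)"
    using H01_pair_L2vec(1)[OF u] H01_pair_L2vec(1)[OF \<psi>] by (auto simp: L2vec_def)
  show "AE x in lebesgue_on U. norm (u x ^ 5 * \<psi> x) \<le> norm (u x ^ 6 + \<psi> x ^ 6)"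
  proof (rule AE_I2)
    fix x
    let ?m = "max \<bar>u x\<bar> \<bar>\<psi> x\<bar>"
    have "\<bar>u x ^ 5 * \<psi> x\<bar> = \<bar>u x\<bar> ^ 5 * \<bar>\<psi> x\<bar>" by (simp add: abs_mult power_abs)
    also have "\<dots> \<le> ?m ^ 5 * ?m" by (intro mult_mono power_mono) auto
    also have "\<dots> = ?m ^ 6" by (simp flip: power_Suc2)
    also have "\<dots> \<le> u x ^ 6 + \<psi> x ^ 6" by (auto simp: max_def power_even_abs)
    finally show "norm (u x ^ 5 * \<psi> x) \<le> norm (u x ^ 6 + \<psi> x ^ 6)" by simp
  qed
qed

text \<open>The right-hand side keeps what the energy controls: the difference in L^2 and the
  gradient of the function tested with. The 20 is the 5 of \<open>quintic_diff_bound\<close> times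
  the 4 of \<open>quartic_bound\<close>.\<close>

lemma quintic_diff_integral_bound:
  fixes U :: "(real^3) set"
  assumes U: "U \<in> lmeasurable" and \<psi>: "H01_pair U \<psi> \<gamma>" and u: "L2vec U u" and v: "L2vec U v"
    and pu: "integrable (lebesgue_on U) (\<lambda>x. \<bar>u x\<bar> powr 12)"
    and pv: "integrable (lebesgue_on U) (\<lambda>x. \<bar>v x\<bar> powr 12)"
  shows "\<bar>\<integral>x. (u x ^ 5 - v x ^ 5) * \<psi> x \<partial>lebesgue_on U\<bar>
    \<le> 20 * (L12_cube U u + L12_cube U v) * l2_norm U (\<lambda>x. u x - v x) * l2_norm U \<gamma>"
proof -
  note w = L2vec_diff[OF u v]
  have um: "u \<in> borel_measurable (lebesgue_on U)" and vm: "v \<in> borel_measurable (lebesgue_on U)"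
    using u v by (auto simp: L2vec_def)
  note bu = quartic_bound[OF U \<psi> w um pu] and bv = quartic_bound[OF U \<psi> w vm pv]
  have pm: "\<psi> \<in> borel_measurable (lebesgue_on U)"
    using H01_pair_L2vec(1)[OF \<psi>] by (simp add: L2vec_def)
  have dom: "integrable (lebesgue_on U) (\<lambda>x. 5 * (u x ^ 4 * \<bar>u x - v x\<bar> * \<bar>\<psi> x\<bar> + v x ^ 4 * \<bar>u x - v x\<bar> * \<bar>\<psi> x\<bar>))"
    using bu(1) bv(1) by auto
  have pt: "norm ((u x ^ 5 - v x ^ 5) * \<psi> x) \<le> 5 * (u x ^ 4 * \<bar>u x - v x\<bar> * \<bar>\<psi> x\<bar> + v x ^ 4 * \<bar>u x - v x\<bar> * \<bar>\<psi> x\<bar>)" for x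
  proof -
    have "norm ((u x ^ 5 - v x ^ 5) * \<psi> x) \<le> 5 * (u x ^ 4 + v x ^ 4) * \<bar>u x - v x\<bar> * \<bar>\<psi> x\<bar>"
      using quintic_diff_bound[of "u x" "v x"] by (simp add: abs_mult mult_right_mono)
    then show ?thesis by (simp add: algebra_simps)
  qed
  have "\<bar>\<integral>x. (u x ^ 5 - v x ^ 5) * \<psi> x \<partial>lebesgue_on U\<bar> \<le>
    (\<integral>x. 5 * (u x ^ 4 * \<bar>u x - v x\<bar> * \<bar>\<psi> x\<bar> + v x ^ 4 * \<bar>u x - v x\<bar> * \<bar>\<psi> x\<bar>) \<partial>lebesgue_on U)"
    unfolding real_norm_def[of "integral\<^sup>L _ _", symmetric]
    by (rule Bochner_Integration.integral_norm_bound_integral[OF Bochner_Integration.integrable_bound[OF dom] dom])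
      (use pt um vm pm in \<open>auto intro!: AE_I2 order_trans[OF _ abs_ge_self]\<close>)
  also have "\<dots> = 5 * ((\<integral>x. u x ^ 4 * \<bar>u x - v x\<bar> * \<bar>\<psi> x\<bar> \<partial>lebesgue_on U) + (\<integral>x. v x ^ 4 * \<bar>u x - v x\<bar> * \<bar>\<psi> x\<bar> \<partial>lebesgue_on U))"
    using bu(1) bv(1) by simp
  also have "\<dots> \<le> 5 * (4 * L12_cube U u * l2_norm U (\<lambda>x. u x - v x) * l2_norm U \<gamma> +
      4 * L12_cube U v * l2_norm U (\<lambda>x. u x - v x) * l2_norm U \<gamma>)"
    using bu(2) bv(2) by (intro mult_left_mono add_mono) auto
  finally show ?thesis by (simp add: algebra_simps)
qed

section \<open>From the distributional to the time-integrated equation\<close>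

lemma LINT_interval_eq_integral:
  fixes f :: "real \<Rightarrow> real"
  assumes "integrable (lebesgue_on {a..b}) f"
  shows "integral\<^sup>L (lebesgue_on {a..b}) f = integral {a..b} f"
  using lebesgue_integral_eq_integral[OF assms] by simp

lemma continuous_integrable_interval:
  fixes f :: "real \<Rightarrow> real"
  assumes "continuous_on {a..b} f"
  shows "integrable (lebesgue_on {a..b}) f"
  using assms continuous_imp_integrable_real by blast

text \<open>The kernels form an approximate identity concentrated on [r, r + 1/n], of mass one as
  soon as this interval lies in [0, T]. Being one-sided does no harm, since \<open>Q\<close> is
  continuous.\<close>

lemma step_mollifier_limit:
  fixes Q \<eta> :: "real \<Rightarrow> real"
  assumes \<eta>: "smooth \<eta>" "\<And>t. t \<le> 0 \<Longrightarrow> \<eta> t = 0" "\<And>t. t \<ge> 1 \<Longrightarrow> \<eta> t = 1" "\<And>t. dderiv [1] \<eta> t \<ge> 0"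
    and Q: "continuous_on {0..T} Q" and r: "0 < r" "r < T"
  shows "(\<lambda>n. integral {0..T} (\<lambda>t. Q t * (real n * dderiv [1] \<eta> (real n * (t - r))))) \<longlonglongrightarrow> Q r"
proof (rule LIMSEQ_I)
  fix e :: real assume e: "e > 0"
  let ?d = "\<lambda>n t. real n * dderiv [1] \<eta> (real n * (t - r))"
  have "continuous_on UNIV (dderiv [1] \<eta>)" using smooth_continuous[OF smooth_dderiv[OF \<eta>(1)]] by simp
  then have dc: "continuous_on S (?d n)" for S n
    by (intro continuous_intros) (auto intro!: continuous_on_compose2[of UNIV "dderiv [1] \<eta>"] continuous_intros)
  have dz: "dderiv [1] \<eta> t = 0" if "t < 0 \<or> t > 1" for t
  proof -
    have "(\<eta> has_real_derivative 0) (at t)"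
    proof (cases "t < 0")
      case True
      have "((\<lambda>t. 0) has_real_derivative 0) (at t)" by simp
      then show ?thesis
        by (rule has_field_derivative_transform_within_open[of _ _ _ "{..<0}"]) (use True \<eta> in auto)
    next
      case False
      have "((\<lambda>t. 1) has_real_derivative 0) (at t)" by simp
      then show ?thesis
        by (rule has_field_derivative_transform_within_open[of _ _ _ "{1<..}"]) (use False that \<eta> in auto)
    qed
    then show ?thesis using DERIV_unique[OF smooth_real_has_derivative[OF \<eta>(1)]] by blast
  qed
  obtain d where d: "d > 0" "\<And>t. t \<in> {0..T} \<Longrightarrow> dist t r < d \<Longrightarrow> dist (Q t) (Q r) < e / 2"
    using Q r e unfolding continuous_on_iff by (metis atLeastAtMost_iff half_gt_zero less_eq_real_def)
  \<comment> \<open>Once \<open>n\<close> exceeds 1/m, the kernel lives inside [0, T] and within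
    distance \<open>d\<close> of \<open>r\<close>.\<close>
  define m where "m = min d (T - r)"
  have m: "m > 0" "m \<le> d" "m \<le> T - r" using d r by (auto simp: m_def)
  obtain N :: nat where N: "real N > 1 / m" using reals_Archimedean2 by blast
  show "\<exists>no. \<forall>n\<ge>no. norm (integral {0..T} (\<lambda>t. Q t * ?d n t) - Q r) < e"
  proof (intro exI[of _ N] allI impI)
    fix n assume "n \<ge> N"
    then have n: "real n > 1 / m" using N by (meson less_le_trans of_nat_le_iff)
    then have n0: "real n > 0" using m(1) by (meson divide_pos_pos less_trans zero_less_one)
    have nm: "real n * m > 1" using n m(1) by (simp add: field_simps)
    have id: "(?d n has_integral (\<eta> (real n * (T - r)) - \<eta> (real n * (0 - r)))) {0..T}"
    proof (rule fundamental_theorem_of_calculus)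
      fix t
      have "((\<lambda>t. \<eta> (real n * (t - r))) has_real_derivative dderiv [1] \<eta> (real n * (t - r)) * real n) (at t within {0..T})"
        by (rule DERIV_chain2[OF smooth_real_has_derivative[OF \<eta>(1)]]) (auto intro!: derivative_eq_intros)
      then show "((\<lambda>t. \<eta> (real n * (t - r))) has_vector_derivative ?d n t) (at t within {0..T})"
        by (simp add: has_real_derivative_iff_has_vector_derivative mult.commute)
    qed (use r in auto)
    have "real n * (T - r) \<ge> 1"
      using nm mult_left_mono[OF m(3), of "real n"] n0 by linarith
    moreover have "real n * (0 - r) \<le> 0" using r n0 by (simp add: mult_nonneg_nonpos)
    ultimately have id1: "(?d n has_integral 1) {0..T}" using id \<eta>(2,3) by simp
    have iQ: "(\<lambda>t. Q t * ?d n t) integrable_on {0..T}"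
      by (intro integrable_continuous_real continuous_on_mult Q dc)
    have "((\<lambda>t. Q t * ?d n t - Q r * ?d n t) has_integral (integral {0..T} (\<lambda>t. Q t * ?d n t) - Q r * 1)) {0..T}"
      by (intro has_integral_diff has_integral_mult_right id1 integrable_integral iQ)
    then have I: "integral {0..T} (\<lambda>t. Q t * ?d n t - Q r * ?d n t) = integral {0..T} (\<lambda>t. Q t * ?d n t) - Q r"
      by (simp add: integral_unique)
    have "norm (integral {0..T} (\<lambda>t. Q t * ?d n t - Q r * ?d n t)) \<le> integral {0..T} (\<lambda>t. e / 2 * ?d n t)"
    proof (rule Henstock_Kurzweil_Integration.integral_norm_bound_integral)
      show "(\<lambda>t. Q t * ?d n t - Q r * ?d n t) integrable_on {0..T}"
        by (intro integrable_continuous_real continuous_intros Q dc)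
      show "(\<lambda>t. e / 2 * ?d n t) integrable_on {0..T}"
        by (intro integrable_continuous_real continuous_on_mult continuous_on_const dc)
      fix t assume t: "t \<in> {0..T}"
      show "norm (Q t * ?d n t - Q r * ?d n t) \<le> e / 2 * ?d n t"
      proof (cases "0 \<le> real n * (t - r) \<and> real n * (t - r) \<le> 1")
        case True
        have "t \<ge> r" using True n0 by (simp add: zero_le_mult_iff)
        moreover have "t - r < m"
        proof (rule ccontr)
          assume "\<not> t - r < m"
          then have "real n * m \<le> real n * (t - r)" using n0 by (intro mult_left_mono) auto
          then show False using True nm by linarith
        qed
        ultimately have "dist t r < d" using m by (simp add: dist_real_def)
        then have "\<bar>Q t - Q r\<bar> \<le> e / 2" using d(2)[OF t] by (simp add: dist_real_def)
        moreover have "?d n t \<ge> 0" using \<eta>(4) by simp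
        ultimately have "\<bar>Q t - Q r\<bar> * ?d n t \<le> e / 2 * ?d n t" by (intro mult_right_mono)
        moreover have "Q t * ?d n t - Q r * ?d n t = (Q t - Q r) * ?d n t" by (simp add: algebra_simps)
        ultimately show ?thesis using \<open>?d n t \<ge> 0\<close> by (simp add: abs_mult \<eta>(4))
      next
        case False
        then have "?d n t = 0" using dz by auto
        then show ?thesis by auto
      qed
    qed
    also have "\<dots> = e / 2" using integral_unique[OF has_integral_mult_right[OF id1, of "e / 2"]] by (simp only: mult_1_right)
    finally show "norm (integral {0..T} (\<lambda>t. Q t * ?d n t) - Q r) < e" unfolding I using e by linarith
  qed
qed

text \<open>In the application \<open>A\<close>, \<open>D\<close> and \<open>h\<close> are the
  pairings of the solution, of the damping flux and of the remaining terms with a fixed \<psi>. One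
  integration by parts removes the second derivative of \<theta> and leaves (A' + D)' = - h in the
  sense of distributions, which is integrated by testing with smooth approximations of an
  indicator.\<close>

lemma integrated_weak_equation:
  fixes A A' D h :: "real \<Rightarrow> real"
  assumes T: "T > 0"
    and A: "\<And>t. t \<in> {0..T} \<Longrightarrow> (A has_real_derivative A' t) (at t within {0..T})"
    and cA': "continuous_on {0..T} A'" and cD: "continuous_on {0..T} D"
    and h: "integrable (lebesgue_on {0..T}) h"
    and weak: "\<And>\<theta>. test_fun {0<..<T} \<theta> \<Longrightarrow>
      (\<integral>t. A t * dderiv [1] (dderiv [1] \<theta>) t + h t * \<theta> t - D t * dderiv [1] \<theta> t \<partial>lebesgue_on {0..T}) = 0"
    and r: "r \<in> {0..T}"
  shows "A' r + D r + integral {0..r} h = A' 0 + D 0"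
proof -
  have cA: "continuous_on {0..T} A"
    by (auto simp: continuous_on_eq_continuous_within intro!: DERIV_continuous A)
  define Q where "Q t = A' t + D t" for t
  have cQ: "continuous_on {0..T} Q" unfolding Q_def by (intro continuous_intros cA' cD)
  have hi: "h integrable_on {0..T}" using h integrable_on_lebesgue_on by fastforce
  have hsub: "h integrable_on {a..b}" if "0 \<le> a" "b \<le> T" for a b
    using integrable_subinterval_real[OF hi] that by simp
  have key: "integral {0..T} (\<lambda>t. Q t * dderiv [1] \<theta> t) = (\<integral>t. h t * \<theta> t \<partial>lebesgue_on {0..T})"
    if \<theta>: "test_fun {0<..<T} \<theta>" for \<theta>
  proof -
    let ?p = "dderiv [1] \<theta>"
    have p: "test_fun {0<..<T} ?p" by (rule test_fun_dderiv[OF \<theta>]) simp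
    have c: "continuous_on S \<theta>" "continuous_on S ?p" "continuous_on S (dderiv [1] ?p)" for S
      using test_funD(2)[OF \<theta>] test_funD(2)[OF p] test_funD(2)[OF test_fun_dderiv[OF p, of 1]]
      by (auto intro: continuous_on_subset)
    \<comment> \<open>Integration by parts; the boundary terms vanish because the derivative of a
      test function is again a test function.\<close>
    have "((\<lambda>t. A' t * ?p t + dderiv [1] ?p t * A t) has_integral (A T * ?p T - A 0 * ?p 0)) {0..T}"
    proof (rule fundamental_theorem_of_calculus)
      fix t assume t: "t \<in> {0..T}"
      have "((\<lambda>t. A t * ?p t) has_real_derivative A' t * ?p t + dderiv [1] ?p t * A t) (at t within {0..T})"
        by (rule DERIV_mult[OF A[OF t] DERIV_subset[OF smooth_real_has_derivative[OF test_funD(1)[OF p]]]]) simp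
      then show "((\<lambda>t. A t * ?p t) has_vector_derivative A' t * ?p t + dderiv [1] ?p t * A t) (at t within {0..T})"
        by (simp add: has_real_derivative_iff_has_vector_derivative)
    qed (use T in auto)
    moreover have "?p T = 0" "?p 0 = 0" using test_funD(4)[OF p] by auto
    ultimately have ibp: "integral {0..T} (\<lambda>t. A' t * ?p t + dderiv [1] ?p t * A t) = 0"
      by (simp add: integral_unique)
    have i1: "(\<lambda>t. A' t * ?p t) integrable_on {0..T}" "(\<lambda>t. dderiv [1] ?p t * A t) integrable_on {0..T}"
       "(\<lambda>t. D t * ?p t) integrable_on {0..T}"
      by (intro integrable_continuous_real continuous_on_mult cA' cD cA c)+
    have bt: "\<exists>B. \<forall>t. \<bar>\<theta> t\<bar> \<le> B" using test_fun_bounded[OF \<theta>] by metis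
    then obtain B where B: "\<And>t. \<bar>\<theta> t\<bar> \<le> B" by blast
    have ih: "integrable (lebesgue_on {0..T}) (\<lambda>t. h t * \<theta> t)"
    proof (rule Bochner_Integration.integrable_bound)
      show "integrable (lebesgue_on {0..T}) (\<lambda>t. \<bar>h t\<bar> * B)" using h by auto
      show "(\<lambda>t. h t * \<theta> t) \<in> borel_measurable (lebesgue_on {0..T})"
        using borel_measurable_integrable[OF h] borel_measurable_integrable[OF continuous_integrable_interval[OF c(1), of 0 T]]
        by (rule borel_measurable_times)
      show "AE t in lebesgue_on {0..T}. norm (h t * \<theta> t) \<le> norm (\<bar>h t\<bar> * B)"
      proof (rule AE_I2)
        fix t
        show "norm (h t * \<theta> t) \<le> norm (\<bar>h t\<bar> * B)"
          using mult_left_mono[OF B[of t], of "\<bar>h t\<bar>"] by (simp add: abs_mult) (metis abs_ge_self abs_ge_zero mult_left_mono order_trans)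
      qed
    qed
    have l: "integrable (lebesgue_on {0..T}) (\<lambda>t. A t * dderiv [1] ?p t)" "integrable (lebesgue_on {0..T}) (\<lambda>t. D t * ?p t)"
      by (intro continuous_integrable_interval continuous_on_mult cA cD c)+
    have "0 = (\<integral>t. A t * dderiv [1] ?p t + h t * \<theta> t - D t * ?p t \<partial>lebesgue_on {0..T})"
      using weak[OF \<theta>] by simp
    also have "\<dots> = (\<integral>t. A t * dderiv [1] ?p t \<partial>lebesgue_on {0..T}) + (\<integral>t. h t * \<theta> t \<partial>lebesgue_on {0..T})
         - (\<integral>t. D t * ?p t \<partial>lebesgue_on {0..T})"
      using l ih by simp
    also have "(\<integral>t. A t * dderiv [1] ?p t \<partial>lebesgue_on {0..T}) = integral {0..T} (\<lambda>t. A t * dderiv [1] ?p t)"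
      by (rule LINT_interval_eq_integral[OF l(1)])
    also have "\<dots> = - integral {0..T} (\<lambda>t. A' t * ?p t)"
      using ibp integral_add[OF i1(1,2)] by (simp add: mult.commute)
    also have "(\<integral>t. D t * ?p t \<partial>lebesgue_on {0..T}) = integral {0..T} (\<lambda>t. D t * ?p t)"
      by (rule LINT_interval_eq_integral[OF l(2)])
    finally have "(\<integral>t. h t * \<theta> t \<partial>lebesgue_on {0..T}) = integral {0..T} (\<lambda>t. A' t * ?p t) + integral {0..T} (\<lambda>t. D t * ?p t)"
      by linarith
    also have "\<dots> = integral {0..T} (\<lambda>t. Q t * ?p t)"
      using integral_add[OF i1(1,3)] by (simp add: Q_def distrib_right)
    finally show ?thesis by simp
  qed
  obtain \<eta> :: "real \<Rightarrow> real" where \<eta>: "smooth \<eta>" "\<And>t. t \<le> 0 \<Longrightarrow> \<eta> t = 0" "\<And>t. t \<ge> 1 \<Longrightarrow> \<eta> t = 1"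
    "\<And>t. 0 \<le> \<eta> t" "\<And>t. \<eta> t \<le> 1" "\<And>t. dderiv [1] \<eta> t \<ge> 0"
    using smooth_step_exists by metis
  have step: "Q r1 + integral {0..r1} h = Q r2 + integral {0..r2} h" if r12: "0 < r1" "r1 < r2" "r2 < T" for r1 r2
  proof -
    \<comment> \<open>\<open>\<theta> n\<close> tends to the indicator of the interval and its derivative to a difference of point masses.\<close>
    define \<theta> where "\<theta> n t = \<eta> (real n * t + - (real n * r1)) - \<eta> (real n * t + - (real n * r2))" for n t
    have sm: "smooth (\<lambda>t. \<eta> (real n * t + - (real n * s)))" for n s
      by (rule smooth_comp_affine[OF \<eta>(1)])
    have d1: "((\<lambda>t. \<eta> (real n * t + - (real n * s))) has_real_derivative real n * dderiv [1] \<eta> (real n * (t - s))) (at t)" for n s t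
    proof -
      have "((\<lambda>t. \<eta> (real n * t + - (real n * s))) has_real_derivative dderiv [1] \<eta> (real n * t + - (real n * s)) * real n) (at t)"
        by (rule DERIV_chain2[OF smooth_real_has_derivative[OF \<eta>(1)]]) (auto intro!: derivative_eq_intros)
      then show ?thesis by (simp add: mult.commute right_diff_distrib)
    qed
    have d\<theta>: "dderiv [1] (\<theta> n) t = real n * dderiv [1] \<eta> (real n * (t - r1)) - real n * dderiv [1] \<eta> (real n * (t - r2))" for n t
    proof -
      have "smooth (\<theta> n)" unfolding \<theta>_def by (intro smooth_diff sm)
      from DERIV_unique[OF smooth_real_has_derivative[OF this]] show ?thesis
        unfolding \<theta>_def using DERIV_diff[OF d1 d1] by blast
    qed
    \<comment> \<open>The second step is completed at r2 + 1/n, which has to stay below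
      \<open>T\<close> for \<open>\<theta> n\<close> to be a test function.\<close>
    obtain N :: nat where N: "real N > 1 / (T - r2)" using reals_Archimedean2 by blast
    have tf: "test_fun {0<..<T} (\<theta> n)" if n: "n \<ge> N" for n
      unfolding test_fun_def
    proof (intro conjI exI[of _ "{r1..r2 + 1 / real n}"] allI impI)
      have nN: "real n > 1 / (T - r2)" using n N by (meson less_le_trans of_nat_le_iff)
      have n0: "real n > 0" using nN r12 by (meson diff_gt_0_iff_gt divide_pos_pos less_trans zero_less_one)
      show "smooth (\<theta> n)" unfolding \<theta>_def by (intro smooth_diff sm)
      have "1 / real n < T - r2" using nN n0 r12 by (simp add: field_simps)
      then show "{r1..r2 + 1 / real n} \<subseteq> {0<..<T}" using r12 by auto
      fix t assume t: "t \<notin> {r1..r2 + 1 / real n}"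
      show "\<theta> n t = 0"
      proof (cases "t < r1")
        case True
        then have "real n * t \<le> real n * r1" "real n * t \<le> real n * r2" using r12 by (auto intro!: mult_left_mono)
        then show ?thesis by (simp add: \<theta>_def \<eta>(2))
      next
        case False
        then have "t > r2 + 1 / real n" using t by auto
        then have "real n * t \<ge> real n * (r2 + 1 / real n)" by (intro mult_left_mono) auto
        then have 1: "real n * t \<ge> real n * r2 + 1" using n0 by (simp add: distrib_left)
        moreover have "real n * r1 \<le> real n * r2" using r12 by (intro mult_left_mono) auto
        ultimately show ?thesis by (simp add: \<theta>_def \<eta>(3))
      qed
    qed simp
    have lim1: "(\<lambda>n. integral {0..T} (\<lambda>t. Q t * dderiv [1] (\<theta> n) t)) \<longlonglongrightarrow> Q r1 - Q r2"
    proof -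
      have "integral {0..T} (\<lambda>t. Q t * dderiv [1] (\<theta> n) t) =
        integral {0..T} (\<lambda>t. Q t * (real n * dderiv [1] \<eta> (real n * (t - r1)))) -
        integral {0..T} (\<lambda>t. Q t * (real n * dderiv [1] \<eta> (real n * (t - r2))))" for n
      proof -
        have "continuous_on UNIV (dderiv [1] \<eta>)" using smooth_continuous[OF smooth_dderiv[OF \<eta>(1)]] by simp
        then have "continuous_on {0..T} (\<lambda>t. Q t * (real n * dderiv [1] \<eta> (real n * (t - s))))" for s
          by (intro continuous_on_mult cQ continuous_on_const) (auto intro!: continuous_on_compose2[of UNIV "dderiv [1] \<eta>"] continuous_intros)
        then show ?thesis
          unfolding d\<theta> right_diff_distrib
          by (subst integral_diff) (auto intro: integrable_continuous_real simp: right_diff_distrib)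
      qed
      moreover have "(\<lambda>n. integral {0..T} (\<lambda>t. Q t * (real n * dderiv [1] \<eta> (real n * (t - r1)))) -
        integral {0..T} (\<lambda>t. Q t * (real n * dderiv [1] \<eta> (real n * (t - r2))))) \<longlonglongrightarrow> Q r1 - Q r2"
        by (intro tendsto_diff step_mollifier_limit[OF \<eta>(1,2,3,6) cQ]) (use r12 in auto)
      ultimately show ?thesis by simp
    qed
    have lim2: "(\<lambda>n. \<integral>t. h t * \<theta> n t \<partial>lebesgue_on {0..T}) \<longlonglongrightarrow> (\<integral>t. h t * indicator {r1<..r2} t \<partial>lebesgue_on {0..T})"
    proof (rule integral_dominated_convergence[where w="\<lambda>t. \<bar>h t\<bar>"])
      have hm: "h \<in> borel_measurable (lebesgue_on {0..T})" using h by (rule borel_measurable_integrable)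
      show "(\<lambda>t. h t * indicator {r1<..r2} t) \<in> borel_measurable (lebesgue_on {0..T})"
        by (intro borel_measurable_times hm borel_measurable_indicator) (use r12 in \<open>auto simp: sets_restrict_space_iff\<close>)
      show "(\<lambda>t. h t * \<theta> n t) \<in> borel_measurable (lebesgue_on {0..T})" for n
      proof (intro borel_measurable_times hm)
        have "smooth (\<theta> n)" unfolding \<theta>_def by (intro smooth_diff sm)
        then show "\<theta> n \<in> borel_measurable (lebesgue_on {0..T})"
          using continuous_on_subset[OF smooth_continuous] borel_measurable_integrable continuous_integrable_interval by blast
      qed
      show "integrable (lebesgue_on {0..T}) (\<lambda>t. \<bar>h t\<bar>)" using h by auto
      show "AE t in lebesgue_on {0..T}. norm (h t * \<theta> n t) \<le> \<bar>h t\<bar>" for n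
      proof (rule AE_I2)
        fix t
        have "\<bar>\<theta> n t\<bar> \<le> 1"
          using \<eta>(4)[of "real n * t + - (real n * r1)"] \<eta>(5)[of "real n * t + - (real n * r1)"]
            \<eta>(4)[of "real n * t + - (real n * r2)"] \<eta>(5)[of "real n * t + - (real n * r2)"] by (simp add: \<theta>_def abs_le_iff)
        then show "norm (h t * \<theta> n t) \<le> \<bar>h t\<bar>" by (simp add: abs_mult mult_left_le)
      qed
      \<comment> \<open>The step is 0 at the origin, so the limit of \<open>\<theta> n\<close> is 0
        at r1 and 1 at r2: the indicator of a half-open interval, which differs from the closed one
        by a null set.\<close>
      have pl: "(\<lambda>n. \<eta> (real n * t + - (real n * s))) \<longlonglongrightarrow> (if t \<le> s then 0 else 1)" for t s
      proof (cases "t \<le> s")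
        case True
        then have "\<eta> (real n * t + - (real n * s)) = 0" for n by (intro \<eta>(2)) (auto intro: mult_left_mono)
        then show ?thesis using True by simp
      next
        case False
        obtain N :: nat where N: "real N > 1 / (t - s)" using reals_Archimedean2 by blast
        have "eventually (\<lambda>n. 1 = \<eta> (real n * t + - (real n * s))) sequentially"
        proof (rule eventually_sequentiallyI[of N])
          fix n assume "N \<le> n"
          then have "real n > 1 / (t - s)" using N by (meson less_le_trans of_nat_le_iff)
          then have "real n * (t - s) \<ge> 1" using False by (simp add: field_simps)
          then show "1 = \<eta> (real n * t + - (real n * s))" by (intro \<eta>(3)[symmetric]) (simp add: right_diff_distrib)
        qed
        then show ?thesis using False by (simp add: Lim_transform_eventually[OF tendsto_const])
      qed
      show "AE t in lebesgue_on {0..T}. (\<lambda>n. h t * \<theta> n t) \<longlonglongrightarrow> h t * indicator {r1<..r2} t"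
      proof (rule AE_I2)
        fix t
        have "(\<lambda>n. h t * \<theta> n t) \<longlonglongrightarrow> h t * ((if t \<le> r1 then 0 else 1) - (if t \<le> r2 then 0 else 1))"
          unfolding \<theta>_def by (intro tendsto_intros pl)
        moreover have "((if t \<le> r1 then 0 else 1) - (if t \<le> r2 then 0 else 1)) = (indicator {r1<..r2} t :: real)"
          using r12 by (auto simp: indicator_def)
        ultimately show "(\<lambda>n. h t * \<theta> n t) \<longlonglongrightarrow> h t * indicator {r1<..r2} t" by simp
      qed
    qed
    have ev: "eventually (\<lambda>n. integral {0..T} (\<lambda>t. Q t * dderiv [1] (\<theta> n) t) = (\<integral>t. h t * \<theta> n t \<partial>lebesgue_on {0..T})) sequentially"
      by (rule eventually_sequentiallyI[of N]) (rule key[OF tf])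
    have sub: "{r1<..r2} \<subseteq> {0..T}" using r12 by auto
    from Lim_transform_eventually[OF lim1 ev] lim2
    have "Q r1 - Q r2 = (\<integral>t. h t * indicator {r1<..r2} t \<partial>lebesgue_on {0..T})"
      by (rule LIMSEQ_unique)
    also have "\<dots> = (\<integral>t. (if t \<in> {r1<..r2} then h t else 0) \<partial>lebesgue_on {0..T})"
      by (rule Bochner_Integration.integral_cong) (auto simp: indicator_def)
    also have "\<dots> = integral\<^sup>L (lebesgue_on {r1<..r2}) h"
      by (rule Lebesgue_Measure.integral_restrict) (use r12 in auto)
    also have "\<dots> = integral {r1<..r2} h"
      by (rule lebesgue_integral_eq_integral)
        (use lebesgue_on_subset_integrable[OF h sub] in auto)
    also have "\<dots> = integral {r1..r2} h"
      by (rule integral_spike_set) (auto intro: negligible_subset[of "{r1}"])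
    finally show ?thesis
      using Henstock_Kurzweil_Integration.integral_combine[of 0 r1 r2 h] hsub[of 0 r2] r12 by simp
  qed
  define \<Phi> where "\<Phi> t = Q t + integral {0..t} h" for t
  have c\<Phi>: "continuous_on {0..T} \<Phi>"
    unfolding \<Phi>_def by (intro continuous_on_add cQ indefinite_integral_continuous_1 hi)
  \<comment> \<open>Test functions vanish near both end points, so time 0 is reached only by
    continuity of \<Phi>; this is how the initial values enter.\<close>
  have cl: "closure {0<..<T} = {0..T}" using T by simp
  have const: "\<Phi> t = \<Phi> (T / 2)" if "t \<in> {0<..<T}" for t
    using step[of t "T / 2"] step[of "T / 2" t] that T unfolding \<Phi>_def
    by (cases t "T / 2" rule: linorder_cases) auto
  have "\<Phi> t = \<Phi> (T / 2)" if "t \<in> {0..T}" for t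
    using continuous_constant_on_closure[of "{0<..<T}" \<Phi> "\<Phi> (T / 2)" t] c\<Phi> const that unfolding cl by blast
  from this[OF r] this[of 0] show ?thesis using T by (simp add: \<Phi>_def Q_def)
qed

text \<open>\<open>G\<close> and \<open>U1\<close> stand for the spatial gradient and the time derivative of \<open>u\<close>.\<close>

locale energy_path =
  fixes U :: "(real^3) set" and T :: real and u :: "real \<Rightarrow> real^3 \<Rightarrow> real"
    and G :: "real \<Rightarrow> real^3 \<Rightarrow> real^3" and U1 :: "real \<Rightarrow> real^3 \<Rightarrow> real"
  assumes Um: "U \<in> lmeasurable" and T: "T > 0"
    and pair: "\<And>t. t \<in> {0..T} \<Longrightarrow> H01_pair U (u t) (G t)"
    and U1: "\<And>t. t \<in> {0..T} \<Longrightarrow> L2vec U (U1 t)"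
    and u_lim: "\<And>t. t \<in> {0..T} \<Longrightarrow> ((\<lambda>s. l2_norm U (\<lambda>x. u s x - u t x)) \<longlongrightarrow> 0) (at t within {0..T})"
    and G_lim: "\<And>t. t \<in> {0..T} \<Longrightarrow> ((\<lambda>s. l2_norm U (\<lambda>x. G s x - G t x)) \<longlongrightarrow> 0) (at t within {0..T})"
    and U1_lim: "\<And>t. t \<in> {0..T} \<Longrightarrow> ((\<lambda>s. l2_norm U (\<lambda>x. U1 s x - U1 t x)) \<longlongrightarrow> 0) (at t within {0..T})"
    and diff_lim: "\<And>t. t \<in> {0..T} \<Longrightarrow>
      ((\<lambda>s. l2_norm U (\<lambda>x. (u s x - u t x) / (s - t) - U1 t x)) \<longlongrightarrow> 0) (at t within {0..T})"
begin

lemma u_L2: "t \<in> {0..T} \<Longrightarrow> L2vec U (u t)" and G_L2: "t \<in> {0..T} \<Longrightarrow> L2vec U (G t)"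
  using pair H01_pair_L2vec by blast+

lemma ev_in: "eventually (\<lambda>s. s \<in> {0..T}) (at t within {0..T})"
  by (auto simp: eventually_at_filter)

lemma l2_norm_zero: "l2_norm V (\<lambda>x. 0) = 0"
  by (simp add: l2_norm_def L2vsq_def)

lemma cont_G: "L2vec U \<gamma> \<Longrightarrow> continuous_on {0..T} (\<lambda>t. l2_inner U (G t) \<gamma>)"
  unfolding continuous_on_def
  by (intro ballI tendsto_l2_inner[OF G_L2 _ _ _ ev_in G_lim]) (auto simp: G_L2 l2_norm_zero)

lemma cont_U1: "L2vec U \<psi> \<Longrightarrow> continuous_on {0..T} (\<lambda>t. l2_inner U (U1 t) \<psi>)"
  unfolding continuous_on_def
  by (intro ballI tendsto_l2_inner[OF U1 _ _ _ ev_in U1_lim]) (auto simp: U1 l2_norm_zero)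

lemma cont_U1_u: "continuous_on {0..T} (\<lambda>t. l2_inner U (U1 t) (u t))"
  unfolding continuous_on_def
  by (intro ballI tendsto_l2_inner[OF U1 u_L2 _ _ ev_in U1_lim u_lim]) (auto simp: U1 u_L2)

lemma cont_norm_u: "continuous_on {0..T} (\<lambda>t. l2_norm U (u t))"
proof -
  have "continuous_on {0..T} (\<lambda>t. l2_inner U (u t) (u t))"
    unfolding continuous_on_def
    by (intro ballI tendsto_l2_inner[OF u_L2 u_L2 _ _ ev_in u_lim u_lim]) (auto simp: u_L2)
  then show ?thesis unfolding l2_norm_def l2_inner_self[symmetric] by (intro continuous_intros)
qed

lemma cont_norm_G: "continuous_on {0..T} (\<lambda>t. l2_norm U (G t))"
proof -
  have "continuous_on {0..T} (\<lambda>t. l2_inner U (G t) (G t))"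
    unfolding continuous_on_def
    by (intro ballI tendsto_l2_inner[OF G_L2 G_L2 _ _ ev_in G_lim G_lim]) (auto simp: G_L2)
  then show ?thesis unfolding l2_norm_def l2_inner_self[symmetric] by (intro continuous_intros)
qed

lemma bounded_on_interval:
  assumes "continuous_on {0..T} (f :: real \<Rightarrow> real)" "\<And>t. f t \<ge> 0"
  shows "\<exists>B\<ge>0. \<forall>t\<in>{0..T}. f t \<le> B"
proof -
  have "compact (f ` {0..T})" by (rule compact_continuous_image[OF assms(1)]) simp
  then obtain B where "\<forall>y\<in>f ` {0..T}. \<bar>y\<bar> \<le> B" using compact_imp_bounded bounded_real by metis
  then have "\<forall>t\<in>{0..T}. f t \<le> \<bar>B\<bar>" by force
  then show ?thesis by (intro exI[of _ "\<bar>B\<bar>"]) auto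
qed

text \<open>Joint continuity of the Gram kernel of the gradients, on which the convergence of its
  double Riemann sums rests. Each projection is composed with the strong continuity of
  \<open>G\<close>.\<close>

lemma cont_GG: "continuous_on ({0..T} \<times> {0..T}) (\<lambda>p. l2_inner U (G (fst p)) (G (snd p)))"
  unfolding continuous_on_def
proof
  fix p :: "real \<times> real" assume p: "p \<in> {0..T} \<times> {0..T}"
  let ?F = "at p within ({0..T} \<times> {0..T})"
  have lim: "((\<lambda>q. l2_norm U (\<lambda>x. G (f q) x - G (f p) x)) \<longlongrightarrow> 0) ?F"
    if f: "(f \<longlongrightarrow> f p) ?F" "\<And>q. q \<in> {0..T} \<times> {0..T} \<Longrightarrow> f q \<in> {0..T}" for f :: "real \<times> real \<Rightarrow> real"
  proof -
    have "continuous (at (f p) within {0..T}) (\<lambda>s. l2_norm U (\<lambda>x. G s x - G (f p) x))"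
      using G_lim[OF f(2)[OF p]] unfolding continuous_within by (simp add: l2_norm_zero)
    then show ?thesis
      using f p continuous_within_tendsto_compose[of "f p" "{0..T}" "\<lambda>s. l2_norm U (\<lambda>x. G s x - G (f p) x)" f ?F]
      by (simp add: l2_norm_zero eventually_at_filter)
  qed
  have ev: "eventually (\<lambda>q. q \<in> {0..T} \<times> {0..T}) ?F" by (auto simp: eventually_at_filter)
  show "((\<lambda>q. l2_inner U (G (fst q)) (G (snd q))) \<longlongrightarrow> l2_inner U (G (fst p)) (G (snd p))) ?F"
  proof (rule tendsto_l2_inner[OF _ _ _ _ ev])
    show "((\<lambda>q. l2_norm U (\<lambda>x. G (fst q) x - G (fst p) x)) \<longlongrightarrow> 0) ?F"
      by (rule lim) (auto intro: tendsto_fst)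
    show "((\<lambda>q. l2_norm U (\<lambda>x. G (snd q) x - G (snd p) x)) \<longlongrightarrow> 0) ?F"
      by (rule lim) (auto intro: tendsto_snd)
  qed (use p in \<open>auto intro!: G_L2\<close>)
qed

lemma diff_quot_L2: "t \<in> {0..T} \<Longrightarrow> s \<in> {0..T} \<Longrightarrow> L2vec U (\<lambda>x. (u s x - u t x) / (s - t))"
  using L2vec_scaleR[OF L2vec_diff[OF u_L2 u_L2], of s t "1 / (s - t)"] by simp

lemma deriv_u:
  assumes "t \<in> {0..T}" "L2vec U \<psi>"
  shows "((\<lambda>t. l2_inner U (u t) \<psi>) has_real_derivative l2_inner U (U1 t) \<psi>) (at t within {0..T})"
proof -
  have "((\<lambda>s. l2_inner U (\<lambda>x. (u s x - u t x) / (s - t)) \<psi>) \<longlongrightarrow> l2_inner U (U1 t) \<psi>) (at t within {0..T})"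
    by (rule tendsto_l2_inner[OF diff_quot_L2[OF assms(1)] _ U1[OF assms(1)] _ ev_in diff_lim[OF assms(1)]])
      (use assms in \<open>auto simp: l2_norm_zero\<close>)
  moreover have "eventually (\<lambda>s. l2_inner U (\<lambda>x. (u s x - u t x) / (s - t)) \<psi> =
      (l2_inner U (u s) \<psi> - l2_inner U (u t) \<psi>) / (s - t)) (at t within {0..T})"
  proof (rule eventually_mono[OF ev_in])
    fix s assume s: "s \<in> {0..T}"
    show "l2_inner U (\<lambda>x. (u s x - u t x) / (s - t)) \<psi> = (l2_inner U (u s) \<psi> - l2_inner U (u t) \<psi>) / (s - t)"
      using l2_inner_scaleR_left[of U "1 / (s - t)" "\<lambda>x. u s x - u t x" \<psi>]
        l2_inner_diff_left[OF u_L2[OF s] u_L2[OF assms(1)] assms(2)] by simp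
  qed
  ultimately show ?thesis
    unfolding has_field_derivative_iff by (rule Lim_transform_eventually)
qed

text \<open>Factoring a difference of squares turns the quotient into the pairing of the difference
  quotient of \<open>u\<close> with u(s) + u(t), and the latter tends to 2 u(t) in L^2.\<close>

lemma deriv_norm_u:
  assumes t: "t \<in> {0..T}"
  shows "((\<lambda>t. L2vsq U (u t)) has_real_derivative 2 * l2_inner U (U1 t) (u t)) (at t within {0..T})"
proof -
  have add: "L2vec U (\<lambda>x. u s x + u t x)" if "s \<in> {0..T}" for s
    by (rule L2vec_add[OF u_L2[OF that] u_L2[OF t]])
  have two: "l2_inner U (U1 t) (\<lambda>x. u t x + u t x) = 2 * l2_inner U (U1 t) (u t)"
    using l2_inner_add_left[OF u_L2[OF t] u_L2[OF t] U1[OF t]] by (simp add: l2_inner_commute[of U "U1 t"])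
  have "((\<lambda>s. l2_inner U (\<lambda>x. (u s x - u t x) / (s - t)) (\<lambda>x. u s x + u t x)) \<longlongrightarrow> l2_inner U (U1 t) (\<lambda>x. u t x + u t x)) (at t within {0..T})"
    by (rule tendsto_l2_inner[OF diff_quot_L2[OF t] add U1[OF t] add[OF t] ev_in diff_lim[OF t]]) (use u_lim[OF t] in auto)
  then have "((\<lambda>s. l2_inner U (\<lambda>x. (u s x - u t x) / (s - t)) (\<lambda>x. u s x + u t x)) \<longlongrightarrow> 2 * l2_inner U (U1 t) (u t)) (at t within {0..T})"
    unfolding two .
  moreover have "eventually (\<lambda>s. l2_inner U (\<lambda>x. (u s x - u t x) / (s - t)) (\<lambda>x. u s x + u t x) =
      (L2vsq U (u s) - L2vsq U (u t)) / (s - t)) (at t within {0..T})"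
  proof (rule eventually_mono[OF ev_in])
    fix s assume s: "s \<in> {0..T}"
    have "l2_inner U (\<lambda>x. u s x - u t x) (\<lambda>x. u s x + u t x) = l2_inner U (u s) (\<lambda>x. u s x + u t x) - l2_inner U (u t) (\<lambda>x. u s x + u t x)"
      by (rule l2_inner_diff_left[OF u_L2[OF s] u_L2[OF t] add[OF s]])
    also have "\<dots> = L2vsq U (u s) - L2vsq U (u t)"
      using l2_inner_add_left[OF u_L2[OF s] u_L2[OF t] u_L2[OF s]] l2_inner_add_left[OF u_L2[OF s] u_L2[OF t] u_L2[OF t]]
      by (simp add: l2_inner_commute[of U "u s" "\<lambda>x. u s x + u t x"] l2_inner_commute[of U "u t" "\<lambda>x. u s x + u t x"]
          l2_inner_commute[of U "u t" "u s"] l2_inner_self)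
    finally show "l2_inner U (\<lambda>x. (u s x - u t x) / (s - t)) (\<lambda>x. u s x + u t x) = (L2vsq U (u s) - L2vsq U (u t)) / (s - t)"
      using l2_inner_scaleR_left[of U "1 / (s - t)" "\<lambda>x. u s x - u t x" "\<lambda>x. u s x + u t x"] by simp
  qed
  ultimately show ?thesis
    unfolding has_field_derivative_iff by (rule Lim_transform_eventually)
qed

lemma quintic_measurable:
  assumes \<psi>: "H01_pair U \<psi> \<gamma>"
  shows "(\<lambda>t. \<integral>x. u t x ^ 5 * \<psi> x \<partial>lebesgue_on U) \<in> borel_measurable (lebesgue_on {0..T})"
proof -
  \<comment> \<open>Truncating \<open>u\<close> makes the integral Lipschitz in the \<open>L\<^sup>2\<close> norm of \<open>u\<close>, hence continuous in time.\<close>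
  define clip :: "nat \<Rightarrow> real \<Rightarrow> real" where "clip n y = max (- real n) (min (real n) y)" for n y
  have clip_abs: "\<bar>clip n y\<bar> \<le> \<bar>y\<bar>" "\<bar>clip n y\<bar> \<le> real n" for n y by (auto simp: clip_def)
  have clip_lip: "\<bar>clip n y - clip n z\<bar> \<le> \<bar>y - z\<bar>" for n y z by (auto simp: clip_def max_def min_def)
  have clip_lim: "(\<lambda>n. clip n y) \<longlonglongrightarrow> y" for y
  proof -
    obtain N :: nat where N: "real N > \<bar>y\<bar>" using reals_Archimedean2 by blast
    have "eventually (\<lambda>n. y = clip n y) sequentially"
      by (rule eventually_sequentiallyI[of N]) (use N in \<open>auto simp: clip_def max_def min_def\<close>)
    then show ?thesis by (rule Lim_transform_eventually[OF tendsto_const])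
  qed
  have [measurable]: "clip n \<in> borel_measurable borel" for n unfolding clip_def by measurable
  have pm [measurable]: "\<psi> \<in> borel_measurable (lebesgue_on U)" and p2: "L2vec U \<psi>"
    using H01_pair_L2vec(1)[OF \<psi>] by (auto simp: L2vec_def)
  have um: "u t \<in> borel_measurable (lebesgue_on U)" if "t \<in> {0..T}" for t
    using u_L2[OF that] by (simp add: L2vec_def)
  define f where "f n t = (\<integral>x. clip n (u t x) ^ 5 * \<psi> x \<partial>lebesgue_on U)" for n t
  have lim: "(\<lambda>n. f n t) \<longlonglongrightarrow> (\<integral>x. u t x ^ 5 * \<psi> x \<partial>lebesgue_on U)" if t: "t \<in> {0..T}" for t
    unfolding f_def
  proof (rule integral_dominated_convergence[where w="\<lambda>x. \<bar>u t x ^ 5 * \<psi> x\<bar>"])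
    note [measurable] = um[OF t]
    show "(\<lambda>x. u t x ^ 5 * \<psi> x) \<in> borel_measurable (lebesgue_on U)" by measurable
    show "(\<lambda>x. clip n (u t x) ^ 5 * \<psi> x) \<in> borel_measurable (lebesgue_on U)" for n by measurable
    show "integrable (lebesgue_on U) (\<lambda>x. \<bar>u t x ^ 5 * \<psi> x\<bar>)"
      using quintic_integrable[OF Um pair[OF t] \<psi>] by auto
    show "AE x in lebesgue_on U. norm (clip n (u t x) ^ 5 * \<psi> x) \<le> \<bar>u t x ^ 5 * \<psi> x\<bar>" for n
      using clip_abs(1) by (auto intro!: AE_I2 mult_right_mono power_mono simp: abs_mult power_abs)
    show "AE x in lebesgue_on U. (\<lambda>n. clip n (u t x) ^ 5 * \<psi> x) \<longlonglongrightarrow> u t x ^ 5 * \<psi> x"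
      by (intro AE_I2 tendsto_intros clip_lim)
  qed
  have int: "integrable (lebesgue_on U) (\<lambda>x. clip n (u t x) ^ 5 * \<psi> x)" if t: "t \<in> {0..T}" for n t
  proof (rule Bochner_Integration.integrable_bound[OF quintic_integrable[OF Um pair[OF t] \<psi>]])
    note [measurable] = um[OF t]
    show "(\<lambda>x. clip n (u t x) ^ 5 * \<psi> x) \<in> borel_measurable (lebesgue_on U)" by measurable
    show "AE x in lebesgue_on U. norm (clip n (u t x) ^ 5 * \<psi> x) \<le> norm (u t x ^ 5 * \<psi> x)"
      using clip_abs(1) by (auto intro!: AE_I2 mult_right_mono power_mono simp: abs_mult power_abs)
  qed
  \<comment> \<open>The Lipschitz constant comes from 5 (n^4 + n^4). It grows with the truncation
    level, but the limit in \<open>n\<close> is taken pointwise in time, and that preserves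
    measurability.\<close>
  have bnd: "\<bar>f n s - f n t\<bar> \<le> 10 * real n ^ 4 * l2_norm U \<psi> * l2_norm U (\<lambda>x. u s x - u t x)"
    if s: "s \<in> {0..T}" and t: "t \<in> {0..T}" for n s t
  proof -
    note d = L2vec_diff[OF u_L2[OF s] u_L2[OF t]]
    have i: "integrable (lebesgue_on U) (\<lambda>x. 10 * real n ^ 4 * (norm (u s x - u t x) \<bullet> norm (\<psi> x)))"
      using L2vec_inner_integrable[OF L2vec_norm[OF d] L2vec_norm[OF p2]] by auto
    have pt: "\<bar>clip n a ^ 5 * p - clip n b ^ 5 * p\<bar> \<le> 10 * real n ^ 4 * (\<bar>a - b\<bar> * \<bar>p\<bar>)" for a b p
    proof -
      have c4: "clip n y ^ 4 \<le> real n ^ 4" for y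
        using power_mono[OF clip_abs(2)[of n y], of 4] by (simp add: power_even_abs)
      have "\<bar>clip n a ^ 5 - clip n b ^ 5\<bar> \<le> 5 * (clip n a ^ 4 + clip n b ^ 4) * \<bar>clip n a - clip n b\<bar>"
        by (rule quintic_diff_bound)
      also have "\<dots> \<le> 5 * (real n ^ 4 + real n ^ 4) * \<bar>a - b\<bar>"
        by (intro mult_mono add_mono c4 clip_lip) auto
      finally have "\<bar>clip n a ^ 5 - clip n b ^ 5\<bar> * \<bar>p\<bar> \<le> 10 * real n ^ 4 * \<bar>a - b\<bar> * \<bar>p\<bar>"
        by (intro mult_right_mono) auto
      then show ?thesis by (simp add: abs_mult left_diff_distrib[symmetric] mult.assoc)
    qed
    have "\<bar>f n s - f n t\<bar> = norm (\<integral>x. clip n (u s x) ^ 5 * \<psi> x - clip n (u t x) ^ 5 * \<psi> x \<partial>lebesgue_on U)"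
      using int[OF s, of n] int[OF t, of n] by (simp add: f_def)
    also have "\<dots> \<le> (\<integral>x. 10 * real n ^ 4 * (norm (u s x - u t x) \<bullet> norm (\<psi> x)) \<partial>lebesgue_on U)"
      by (rule Bochner_Integration.integral_norm_bound_integral)
        (use int[OF s, of n] int[OF t, of n] i pt in auto)
    also have "\<dots> = 10 * real n ^ 4 * l2_inner U (\<lambda>x. norm (u s x - u t x)) (\<lambda>x. norm (\<psi> x))"
      by (simp add: l2_inner_def)
    also have "\<dots> \<le> 10 * real n ^ 4 * (l2_norm U (\<lambda>x. norm (u s x - u t x)) * l2_norm U (\<lambda>x. norm (\<psi> x)))"
      using l2_Cauchy_Schwarz[OF L2vec_norm[OF d] L2vec_norm[OF p2]] by (intro mult_left_mono) auto
    finally show ?thesis unfolding l2_norm_norm by (simp add: mult_ac)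
  qed
  have cont: "continuous_on {0..T} (f n)" for n
    unfolding continuous_on_def
  proof
    fix t assume t: "t \<in> {0..T}"
    have "((\<lambda>s. 10 * real n ^ 4 * l2_norm U \<psi> * l2_norm U (\<lambda>x. u s x - u t x)) \<longlongrightarrow> 0) (at t within {0..T})"
      using tendsto_mult_right_zero[OF u_lim[OF t]] by blast
    then have "((\<lambda>s. f n s - f n t) \<longlongrightarrow> 0) (at t within {0..T})"
      by (rule Lim_null_comparison[rotated]) (rule eventually_mono[OF ev_in], use bnd t in auto)
    then show "(f n \<longlongrightarrow> f n t) (at t within {0..T})" by (simp add: Lim_null[symmetric])
  qed
  show ?thesis
  proof (rule borel_measurable_LIMSEQ_real)
    show "f n \<in> borel_measurable (lebesgue_on {0..T})" for n
      by (rule borel_measurable_integrable[OF continuous_integrable_interval[OF cont]])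
    show "(\<lambda>n. f n t) \<longlonglongrightarrow> (\<integral>x. u t x ^ 5 * \<psi> x \<partial>lebesgue_on U)" if "t \<in> space (lebesgue_on {0..T})" for t
      using lim that by simp
  qed
qed

lemma quintic_time_integrable:
  assumes \<psi>: "H01_pair U \<psi> \<gamma>" and L: "L4_L12 U T u"
  shows "integrable (lebesgue_on {0..T}) (\<lambda>t. \<integral>x. u t x ^ 5 * \<psi> x \<partial>lebesgue_on U)"
proof -
  obtain B where B: "B \<ge> 0" "\<And>t. t \<in> {0..T} \<Longrightarrow> l2_norm U (u t) \<le> B"
    using bounded_on_interval[OF cont_norm_u l2_norm_nonneg] by blast
  have gi: "integrable (lebesgue_on {0..T}) (\<lambda>t. L12_cube U (u t))"
    using L unfolding L4_L12_def L12_cube_def by blast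
  have ae: "AE t in lebesgue_on {0..T}. integrable (lebesgue_on U) (\<lambda>x. \<bar>u t x\<bar> powr 12)"
    using L unfolding L4_L12_def by (auto elim: AE_mp)
  have aeT: "AE t in lebesgue_on {0..T}. t \<in> {0..T}" by (rule AE_I2) simp
  show ?thesis
  proof (rule Bochner_Integration.integrable_bound)
    show "integrable (lebesgue_on {0..T}) (\<lambda>t. 20 * L12_cube U (u t) * B * l2_norm U \<gamma>)"
      using gi by auto
    show "(\<lambda>t. \<integral>x. u t x ^ 5 * \<psi> x \<partial>lebesgue_on U) \<in> borel_measurable (lebesgue_on {0..T})"
      by (rule quintic_measurable[OF \<psi>])
    show "AE t in lebesgue_on {0..T}. norm (\<integral>x. u t x ^ 5 * \<psi> x \<partial>lebesgue_on U) \<le> norm (20 * L12_cube U (u t) * B * l2_norm U \<gamma>)"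
      using ae aeT
    proof eventually_elim
      case (elim t)
      \<comment> \<open>The estimate for differences with zero as second function, whose L^12 term
        vanishes.\<close>
      have "\<bar>\<integral>x. (u t x ^ 5 - 0 ^ 5) * \<psi> x \<partial>lebesgue_on U\<bar>
         \<le> 20 * (L12_cube U (u t) + L12_cube U (\<lambda>x. 0)) * l2_norm U (\<lambda>x. u t x - 0) * l2_norm U \<gamma>"
        by (rule quintic_diff_integral_bound[OF Um \<psi> u_L2[OF elim(2)] L2vec_zero elim(1)]) simp
      then have "\<bar>\<integral>x. u t x ^ 5 * \<psi> x \<partial>lebesgue_on U\<bar> \<le> 20 * L12_cube U (u t) * l2_norm U (u t) * l2_norm U \<gamma>"
        by (simp add: L12_cube_def)
      also have "\<dots> \<le> 20 * L12_cube U (u t) * B * l2_norm U \<gamma>"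
        using B(2)[OF elim(2)] by (intro mult_right_mono mult_left_mono) (auto simp: l2_norm_nonneg L12_cube_def)
      finally show ?case by simp
    qed
  qed
qed

text \<open>Testing with \<psi>(x) \<theta>(t) yields the scalar hypothesis of
  \<open>integrated_weak_equation\<close>; the damping term, which carries the derivative of
  \<theta>, becomes \<open>D\<close>.\<close>

lemma integrated_equation:
  assumes am: "a \<in> borel_measurable (lebesgue_on U)" "AE x in lebesgue_on U. \<bar>a x\<bar> \<le> C"
    and L: "L4_L12 U T u" and \<psi>: "test_fun U \<psi>" and r: "r \<in> {0..T}"
    and weak: "\<And>\<phi>. test_fun (U \<times> {0<..<T}) \<phi> \<Longrightarrow>
         (\<integral>t. (\<integral>x. u t x * dt (dt \<phi>) (x, t) + G t x \<bullet> gradx \<phi> (x, t)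
                      - a x * (G t x \<bullet> gradx (dt \<phi>) (x, t)) + (u t x) ^ 5 * \<phi> (x, t)
                  \<partial>lebesgue_on U) \<partial>lebesgue_on {0..T}) = 0"
  shows "l2_inner U (U1 r) \<psi> + l2_inner U (G r) (\<lambda>x. a x *\<^sub>R cgrad \<psi> x)
     + integral {0..r} (\<lambda>t. l2_inner U (G t) (cgrad \<psi>) + (\<integral>x. u t x ^ 5 * \<psi> x \<partial>lebesgue_on U))
     = l2_inner U (U1 0) \<psi> + l2_inner U (G 0) (\<lambda>x. a x *\<^sub>R cgrad \<psi> x)"
proof (rule integrated_weak_equation[OF T deriv_u _ _ _ _ r])
  have p: "L2vec U \<psi>" and g: "L2vec U (cgrad \<psi>)" and pp: "H01_pair U \<psi> (cgrad \<psi>)"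
    using test_fun_L2vec[OF \<psi> Um] cgrad_L2vec[OF \<psi> Um] H01_pair_test_fun[OF \<psi> Um] by auto
  have ag: "L2vec U (\<lambda>x. a x *\<^sub>R cgrad \<psi> x)" by (rule L2vec_bounded_mult[OF g am])
  show "L2vec U \<psi>" by (rule p)
  show "continuous_on {0..T} (\<lambda>t. l2_inner U (U1 t) \<psi>)" by (rule cont_U1[OF p])
  show "continuous_on {0..T} (\<lambda>t. l2_inner U (G t) (\<lambda>x. a x *\<^sub>R cgrad \<psi> x))" by (rule cont_G[OF ag])
  show "integrable (lebesgue_on {0..T}) (\<lambda>t. l2_inner U (G t) (cgrad \<psi>) + (\<integral>x. u t x ^ 5 * \<psi> x \<partial>lebesgue_on U))"
    by (intro Bochner_Integration.integrable_add continuous_integrable_interval cont_G g quintic_time_integrable[OF pp L])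
  fix \<theta> :: "real \<Rightarrow> real" assume \<theta>: "test_fun {0<..<T} \<theta>"
  let ?\<phi> = "\<lambda>p::(real^3) \<times> real. \<psi> (fst p) * \<theta> (snd p)"
  let ?p = "dderiv [1] \<theta>"
  have s: "smooth \<theta>" "smooth ?p" "smooth \<psi>"
    using test_funD(1)[OF \<theta>] test_funD(1)[OF \<psi>] smooth_dderiv[of \<theta> 1] by auto
  have inner: "(\<integral>x. u t x * dt (dt ?\<phi>) (x, t) + G t x \<bullet> gradx ?\<phi> (x, t)
                      - a x * (G t x \<bullet> gradx (dt ?\<phi>) (x, t)) + (u t x) ^ 5 * ?\<phi> (x, t) \<partial>lebesgue_on U)
     = l2_inner U (u t) \<psi> * dderiv [1] ?p t
       + (l2_inner U (G t) (cgrad \<psi>) + (\<integral>x. u t x ^ 5 * \<psi> x \<partial>lebesgue_on U)) * \<theta> t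
       - l2_inner U (G t) (\<lambda>x. a x *\<^sub>R cgrad \<psi> x) * ?p t" if t: "t \<in> {0..T}" for t
  proof -
    have i: "integrable (lebesgue_on U) (\<lambda>x. u t x * \<psi> x)" "integrable (lebesgue_on U) (\<lambda>x. G t x \<bullet> cgrad \<psi> x)"
      "integrable (lebesgue_on U) (\<lambda>x. G t x \<bullet> (a x *\<^sub>R cgrad \<psi> x))" "integrable (lebesgue_on U) (\<lambda>x. u t x ^ 5 * \<psi> x)"
      using L2vec_inner_integrable[OF u_L2[OF t] p] L2vec_inner_integrable[OF G_L2[OF t] g]
        L2vec_inner_integrable[OF G_L2[OF t] ag] quintic_integrable[OF Um pair[OF t] pp] by simp_all
    have "(\<integral>x. u t x * dt (dt ?\<phi>) (x, t) + G t x \<bullet> gradx ?\<phi> (x, t)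
                      - a x * (G t x \<bullet> gradx (dt ?\<phi>) (x, t)) + (u t x) ^ 5 * ?\<phi> (x, t) \<partial>lebesgue_on U)
      = (\<integral>x. u t x * \<psi> x * dderiv [1] ?p t + (G t x \<bullet> cgrad \<psi> x) * \<theta> t
                      - (G t x \<bullet> (a x *\<^sub>R cgrad \<psi> x)) * ?p t + u t x ^ 5 * \<psi> x * \<theta> t \<partial>lebesgue_on U)"
      unfolding dt_tensor[OF s(1)] dt_tensor[OF s(2)] gradx_tensor[OF s(3)]
      by (rule Bochner_Integration.integral_cong) (auto simp: mult_ac)
    also have "\<dots> = (\<integral>x. u t x * \<psi> x \<partial>lebesgue_on U) * dderiv [1] ?p t + (\<integral>x. G t x \<bullet> cgrad \<psi> x \<partial>lebesgue_on U) * \<theta> t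
                      - (\<integral>x. G t x \<bullet> (a x *\<^sub>R cgrad \<psi> x) \<partial>lebesgue_on U) * ?p t + (\<integral>x. u t x ^ 5 * \<psi> x \<partial>lebesgue_on U) * \<theta> t"
      using i by (simp del: inner_scaleR_right)
    finally show ?thesis by (simp add: l2_inner_def algebra_simps)
  qed
  have "(\<integral>t. l2_inner U (u t) \<psi> * dderiv [1] ?p t
       + (l2_inner U (G t) (cgrad \<psi>) + (\<integral>x. u t x ^ 5 * \<psi> x \<partial>lebesgue_on U)) * \<theta> t
       - l2_inner U (G t) (\<lambda>x. a x *\<^sub>R cgrad \<psi> x) * ?p t \<partial>lebesgue_on {0..T}) =
    (\<integral>t. (\<integral>x. u t x * dt (dt ?\<phi>) (x, t) + G t x \<bullet> gradx ?\<phi> (x, t)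
                      - a x * (G t x \<bullet> gradx (dt ?\<phi>) (x, t)) + (u t x) ^ 5 * ?\<phi> (x, t)
                  \<partial>lebesgue_on U) \<partial>lebesgue_on {0..T})"
    by (rule Bochner_Integration.integral_cong) (use inner in auto)
  also have "\<dots> = 0" by (rule weak[OF test_fun_tensor[OF \<psi> \<theta>]])
  finally show "(\<integral>t. l2_inner U (u t) \<psi> * dderiv [1] ?p t
       + (l2_inner U (G t) (cgrad \<psi>) + (\<integral>x. u t x ^ 5 * \<psi> x \<partial>lebesgue_on U)) * \<theta> t
       - l2_inner U (G t) (\<lambda>x. a x *\<^sub>R cgrad \<psi> x) * ?p t \<partial>lebesgue_on {0..T}) = 0" .
qed

end

section \<open>Riemann sums, Fubini on a triangle, and a Gronwall argument\<close>

text \<open>Left end points, by induction on the number of cells. The error is expressed by an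
  oscillation bound and not as a limit, so that it can be applied to both variables of a kernel on
  the same mesh.\<close>

lemma riemann_sum_error:
  fixes h :: "real \<Rightarrow> real"
  assumes c: "continuous_on {0..\<sigma>} h" and \<sigma>: "\<sigma> \<ge> 0" and n: "n > 0" and e: "e \<ge> 0"
    and osc: "\<And>s t. s \<in> {0..\<sigma>} \<Longrightarrow> t \<in> {0..\<sigma>} \<Longrightarrow> \<bar>s - t\<bar> \<le> \<sigma> / real n \<Longrightarrow> \<bar>h s - h t\<bar> \<le> e"
  shows "\<bar>integral {0..\<sigma>} h - \<sigma> / real n * (\<Sum>i<n. h (real i * (\<sigma> / real n)))\<bar> \<le> e * \<sigma>"
proof -
  define \<delta> where "\<delta> = \<sigma> / real n"
  have \<delta>: "\<delta> \<ge> 0" "real n * \<delta> = \<sigma>" using \<sigma> n by (auto simp: \<delta>_def)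
  have "\<bar>integral {0..real m * \<delta>} h - \<delta> * (\<Sum>i<m. h (real i * \<delta>))\<bar> \<le> e * (real m * \<delta>)" if "m \<le> n" for m
    using that
  proof (induction m)
    case 0
    then show ?case by simp
  next
    case (Suc m)
    have le: "real (Suc m) * \<delta> \<le> \<sigma>" using Suc.prems \<delta> by (metis mult_right_mono of_nat_le_iff)
    have m0: "0 \<le> real m * \<delta>" "real m * \<delta> \<le> real (Suc m) * \<delta>" using \<delta> by (auto intro: mult_right_mono)
    have sub: "{real m * \<delta>..real (Suc m) * \<delta>} \<subseteq> {0..\<sigma>}" using m0 le by auto
    have int: "h integrable_on {0..real (Suc m) * \<delta>}"
      by (rule integrable_continuous_real[OF continuous_on_subset[OF c]]) (use le in auto)
    have intm: "h integrable_on {real m * \<delta>..real (Suc m) * \<delta>}"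
      by (rule integrable_continuous_real[OF continuous_on_subset[OF c sub]])
    have comb: "integral {0..real (Suc m) * \<delta>} h = integral {0..real m * \<delta>} h + integral {real m * \<delta>..real (Suc m) * \<delta>} h"
      using Henstock_Kurzweil_Integration.integral_combine[OF m0 int] by simp
    have len: "real (Suc m) * \<delta> - real m * \<delta> = \<delta>" by (simp add: algebra_simps)
    have *: "norm (integral {real m * \<delta>..real (Suc m) * \<delta>} (\<lambda>t. h t - h (real m * \<delta>)))
       \<le> integral {real m * \<delta>..real (Suc m) * \<delta>} (\<lambda>t. e)"
    proof (rule Henstock_Kurzweil_Integration.integral_norm_bound_integral)
      fix t assume t: "t \<in> {real m * \<delta>..real (Suc m) * \<delta>}"
      have "t \<in> {0..\<sigma>}" "real m * \<delta> \<in> {0..\<sigma>}" using t sub m0 le by auto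
      moreover have "\<bar>t - real m * \<delta>\<bar> \<le> \<sigma> / real n" using t len unfolding \<delta>_def[symmetric] by auto
      ultimately show "norm (h t - h (real m * \<delta>)) \<le> e" using osc by simp
    qed (use intm in \<open>auto intro: integrable_diff\<close>)
    have "\<bar>integral {real m * \<delta>..real (Suc m) * \<delta>} h - \<delta> * h (real m * \<delta>)\<bar> \<le> e * \<delta>"
    proof -
      have "integral {real m * \<delta>..real (Suc m) * \<delta>} (\<lambda>t. h t - h (real m * \<delta>)) =
          integral {real m * \<delta>..real (Suc m) * \<delta>} h - \<delta> * h (real m * \<delta>)"
        using integral_diff[OF intm integrable_const_ivl[of "h (real m * \<delta>)"]] m0 len by simp
      moreover have "integral {real m * \<delta>..real (Suc m) * \<delta>} (\<lambda>t. e) = e * \<delta>"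
        using m0 len by (simp add: mult.commute)
      ultimately show ?thesis using * by (simp only: real_norm_def)
    qed
    then have "\<bar>integral {0..real (Suc m) * \<delta>} h - \<delta> * (\<Sum>i<Suc m. h (real i * \<delta>))\<bar> \<le> e * (real m * \<delta>) + e * \<delta>"
      using Suc unfolding comb sum.lessThan_Suc distrib_left by linarith
    then show ?case by (simp add: algebra_simps)
  qed
  from this[of n] show ?thesis by (simp add: \<delta>(2) \<delta>_def[symmetric])
qed

lemma mesh_eventually_less:
  assumes "d > 0" shows "eventually (\<lambda>n. \<sigma> / real (Suc n) < d) sequentially"
proof -
  have "(\<lambda>n. \<sigma> / real (Suc n)) \<longlonglongrightarrow> 0" using LIMSEQ_Suc[OF lim_const_over_n[of \<sigma>]] .
  then show ?thesis using assms by (simp add: order_tendstoD)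
qed

lemma riemann_sum_limit:
  fixes h :: "real \<Rightarrow> real"
  assumes c: "continuous_on {0..\<sigma>} h" and \<sigma>: "\<sigma> \<ge> 0"
  shows "(\<lambda>n. \<sigma> / real (Suc n) * (\<Sum>i<Suc n. h (real i * (\<sigma> / real (Suc n))))) \<longlonglongrightarrow> integral {0..\<sigma>} h"
proof (rule tendstoI)
  fix e :: real assume e: "e > 0"
  \<comment> \<open>The + 1 keeps the denominator positive when \<sigma> = 0.\<close>
  define e' where "e' = e / (\<sigma> + 1) / 2"
  have e': "e' > 0" "e' * \<sigma> < e"
    using e \<sigma> by (auto simp: e'_def field_simps intro: add_strict_increasing2)
  have "uniformly_continuous_on {0..\<sigma>} h" by (rule compact_uniformly_continuous[OF c]) simp
  then obtain d where d: "d > 0" "\<And>s t. s \<in> {0..\<sigma>} \<Longrightarrow> t \<in> {0..\<sigma>} \<Longrightarrow> dist s t < d \<Longrightarrow> dist (h s) (h t) < e'"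
    using e'(1) unfolding uniformly_continuous_on_def by metis
  show "eventually (\<lambda>n. dist (\<sigma> / real (Suc n) * (\<Sum>i<Suc n. h (real i * (\<sigma> / real (Suc n))))) (integral {0..\<sigma>} h) < e) sequentially"
    using mesh_eventually_less[OF d(1), of \<sigma>]
  proof (rule eventually_mono)
    fix n assume n: "\<sigma> / real (Suc n) < d"
    have "\<bar>integral {0..\<sigma>} h - \<sigma> / real (Suc n) * (\<Sum>i<Suc n. h (real i * (\<sigma> / real (Suc n))))\<bar> \<le> e' * \<sigma>"
    proof (rule riemann_sum_error[OF c \<sigma>])
      fix s t assume "s \<in> {0..\<sigma>}" "t \<in> {0..\<sigma>}" "\<bar>s - t\<bar> \<le> \<sigma> / real (Suc n)"
      then have "dist (h s) (h t) < e'" using n by (intro d(2)) (auto simp: dist_real_def)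
      then show "\<bar>h s - h t\<bar> \<le> e'" by (simp add: dist_real_def)
    qed (use e' in auto)
    then show "dist (\<sigma> / real (Suc n) * (\<Sum>i<Suc n. h (real i * (\<sigma> / real (Suc n))))) (integral {0..\<sigma>} h) < e"
      using e'(2) unfolding dist_real_def by linarith
  qed
qed

text \<open>Such double sums are the squared norms of Riemann sums of the gradient. The error bound
  is used for the inner integral as a function of the outer variable and then on each row; each use
  contributes e' \<sigma>^2, which dictates the choice of e'.\<close>

lemma riemann_sum_limit_2d:
  fixes k :: "real \<times> real \<Rightarrow> real"
  assumes c: "continuous_on ({0..\<sigma>} \<times> {0..\<sigma>}) k" and \<sigma>: "\<sigma> \<ge> 0"
  shows "(\<lambda>n. (\<sigma> / real (Suc n))\<^sup>2 * (\<Sum>i<Suc n. \<Sum>j<Suc n. k (real i * (\<sigma> / real (Suc n)), real j * (\<sigma> / real (Suc n)))))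
    \<longlonglongrightarrow> integral {0..\<sigma>} (\<lambda>t. integral {0..\<sigma>} (\<lambda>s. k (t, s)))"
proof (rule tendstoI)
  fix e :: real assume e: "e > 0"
  define e' where "e' = e / 4 / (\<sigma>\<^sup>2 + 1)"
  have e'p: "e' > 0" unfolding e'_def using e by (intro divide_pos_pos) (auto simp: add_nonneg_pos)
  have "x / D * D = x" if "D \<noteq> 0" for x D :: real using that by simp
  moreover have "\<sigma>\<^sup>2 + 1 \<noteq> 0" using zero_le_power2[of \<sigma>] by linarith
  ultimately have "e' * (\<sigma>\<^sup>2 + 1) = e / 4" unfolding e'_def by blast
  moreover have "e' * (\<sigma>\<^sup>2 + 1) = e' * \<sigma> * \<sigma> + e'" by (simp add: distrib_left power2_eq_square)
  ultimately have e'e: "e' * \<sigma> * \<sigma> + e' * \<sigma> * \<sigma> < e" using e e'p by linarith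
  have "uniformly_continuous_on ({0..\<sigma>} \<times> {0..\<sigma>}) k" by (rule compact_uniformly_continuous[OF c]) (simp add: compact_Times)
  then obtain d where d: "d > 0" "\<And>p q. p \<in> {0..\<sigma>} \<times> {0..\<sigma>} \<Longrightarrow> q \<in> {0..\<sigma>} \<times> {0..\<sigma>} \<Longrightarrow> dist p q < d \<Longrightarrow> dist (k p) (k q) < e'"
    using e'p unfolding uniformly_continuous_on_def by metis
  define K where "K t = integral {0..\<sigma>} (\<lambda>s. k (t, s))" for t
  have ck: "continuous_on {0..\<sigma>} (\<lambda>s. k (t, s))" if "t \<in> {0..\<sigma>}" for t
    by (rule continuous_on_compose2[OF c]) (use that in \<open>auto intro!: continuous_intros\<close>)
  have oscK: "\<bar>K t - K t'\<bar> \<le> e' * \<sigma>" if t: "t \<in> {0..\<sigma>}" "t' \<in> {0..\<sigma>}" "\<bar>t - t'\<bar> < d" for t t'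
  proof -
    have i: "(\<lambda>s. k (t, s)) integrable_on {0..\<sigma>}" "(\<lambda>s. k (t', s)) integrable_on {0..\<sigma>}"
      by (auto intro!: integrable_continuous_real ck t)
    have "norm (integral {0..\<sigma>} (\<lambda>s. k (t, s) - k (t', s))) \<le> integral {0..\<sigma>} (\<lambda>s. e')"
    proof (rule Henstock_Kurzweil_Integration.integral_norm_bound_integral)
      fix s assume "s \<in> {0..\<sigma>}"
      then have "dist (k (t, s)) (k (t', s)) < e'"
        using t by (intro d(2)) (auto simp: dist_prod_def dist_real_def)
      then show "norm (k (t, s) - k (t', s)) \<le> e'" by (simp add: dist_real_def)
    qed (use i in \<open>auto intro: integrable_diff\<close>)
    then show ?thesis using i \<sigma> by (simp add: K_def integral_diff mult.commute)
  qed
  have cK: "continuous_on {0..\<sigma>} K"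
  proof -
    have "continuous_on {0..\<sigma>} (\<lambda>t. integral (cbox 0 \<sigma>) (\<lambda>s. k (t, s)))"
      by (rule integral_continuous_on_param) (use c in \<open>auto simp: case_prod_unfold\<close>)
    then show ?thesis by (simp add: K_def[abs_def])
  qed
  show "eventually (\<lambda>n. dist ((\<sigma> / real (Suc n))\<^sup>2 * (\<Sum>i<Suc n. \<Sum>j<Suc n. k (real i * (\<sigma> / real (Suc n)), real j * (\<sigma> / real (Suc n)))))
      (integral {0..\<sigma>} (\<lambda>t. integral {0..\<sigma>} (\<lambda>s. k (t, s)))) < e) sequentially"
    using mesh_eventually_less[OF d(1), of \<sigma>]
  proof (rule eventually_mono)
    fix n assume n: "\<sigma> / real (Suc n) < d"
    let ?\<delta> = "\<sigma> / real (Suc n)"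
    have d0: "0 \<le> ?\<delta>" using \<sigma> by simp
    have pt: "real i * ?\<delta> \<in> {0..\<sigma>}" if "i < Suc n" for i
    proof -
      have "real i * ?\<delta> \<le> real (Suc n) * ?\<delta>" using that \<sigma> by (intro mult_right_mono) auto
      then show ?thesis using \<sigma> by simp
    qed
    have 1: "\<bar>integral {0..\<sigma>} K - ?\<delta> * (\<Sum>i<Suc n. K (real i * ?\<delta>))\<bar> \<le> e' * \<sigma> * \<sigma>"
      by (rule riemann_sum_error[OF cK \<sigma>]) (use oscK n e'p \<sigma> in auto)
    have 2: "\<bar>K (real i * ?\<delta>) - ?\<delta> * (\<Sum>j<Suc n. k (real i * ?\<delta>, real j * ?\<delta>))\<bar> \<le> e' * \<sigma>" if i: "i < Suc n" for i
      unfolding K_def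
    proof (rule riemann_sum_error[OF ck[OF pt[OF i]] \<sigma>])
      fix s t assume "s \<in> {0..\<sigma>}" "t \<in> {0..\<sigma>}" "\<bar>s - t\<bar> \<le> \<sigma> / real (Suc n)"
      then have "dist (k (real i * ?\<delta>, s)) (k (real i * ?\<delta>, t)) < e'"
        using n pt[OF i] by (intro d(2)) (auto simp: dist_prod_def dist_real_def)
      then show "\<bar>k (real i * ?\<delta>, s) - k (real i * ?\<delta>, t)\<bar> \<le> e'" by (simp add: dist_real_def)
    qed (use e'p in auto)
    have "\<bar>?\<delta> * (\<Sum>i<Suc n. K (real i * ?\<delta>)) - ?\<delta> * (\<Sum>i<Suc n. ?\<delta> * (\<Sum>j<Suc n. k (real i * ?\<delta>, real j * ?\<delta>)))\<bar>
        = ?\<delta> * \<bar>\<Sum>i<Suc n. K (real i * ?\<delta>) - ?\<delta> * (\<Sum>j<Suc n. k (real i * ?\<delta>, real j * ?\<delta>))\<bar>"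
      unfolding sum_subtractf by (simp only: right_diff_distrib[symmetric] abs_mult abs_of_nonneg[OF d0])
    also have "\<dots> \<le> ?\<delta> * (\<Sum>i<Suc n. e' * \<sigma>)"
      by (intro mult_left_mono order_trans[OF sum_abs] sum_mono 2) (use \<sigma> in auto)
    also have "\<dots> = e' * \<sigma> * \<sigma>" by (simp del: sum.lessThan_Suc add: field_simps)
    finally have 3: "\<bar>?\<delta> * (\<Sum>i<Suc n. K (real i * ?\<delta>)) - ?\<delta> * (\<Sum>i<Suc n. ?\<delta> * (\<Sum>j<Suc n. k (real i * ?\<delta>, real j * ?\<delta>)))\<bar> \<le> e' * \<sigma> * \<sigma>" .
    have 4: "?\<delta> * (\<Sum>i<Suc n. ?\<delta> * (\<Sum>j<Suc n. k (real i * ?\<delta>, real j * ?\<delta>))) =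
       ?\<delta>\<^sup>2 * (\<Sum>i<Suc n. \<Sum>j<Suc n. k (real i * ?\<delta>, real j * ?\<delta>))"
      by (simp only: sum_distrib_left[symmetric] power2_eq_square mult.assoc)
    show "dist (?\<delta>\<^sup>2 * (\<Sum>i<Suc n. \<Sum>j<Suc n. k (real i * ?\<delta>, real j * ?\<delta>))) (integral {0..\<sigma>} (\<lambda>t. integral {0..\<sigma>} (\<lambda>s. k (t, s)))) < e"
      using 1 3 e'e unfolding 4 dist_real_def K_def[symmetric] by linarith
  qed
qed

text \<open>Measurable in one variable and continuous in the other: the function is a limit of
  functions constant in \<open>t\<close> on cells of length 1/(n+1), and each of these is glued from
  countably many measurable pieces.\<close>

lemma caratheodory_measurable:
  fixes f :: "real \<Rightarrow> real \<Rightarrow> real"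
  assumes meas: "\<And>t. t \<in> {0..s} \<Longrightarrow> (\<lambda>\<tau>. f \<tau> t) \<in> borel_measurable (lebesgue_on {0..s})"
    and cont: "\<And>\<tau>. \<tau> \<in> {0..s} \<Longrightarrow> continuous_on {0..s} (f \<tau>)"
  shows "(\<lambda>(\<tau>, t). f \<tau> t) \<in> borel_measurable (lebesgue_on {0..s} \<Otimes>\<^sub>M lebesgue_on {0..s})"
proof -
  let ?M = "lebesgue_on {0..s}"
  \<comment> \<open>Rounding down keeps the grid point in [0, t], so the approximation stays in the
    interval; the value 0 in \<open>g\<close> covers grid points outside, which are never
    selected.\<close>
  define c where "c n t = real_of_int \<lfloor>real (Suc n) * t\<rfloor> / real (Suc n)" for n t
  have c: "0 \<le> c n t" "c n t \<le> t" "t - 1 / real (Suc n) \<le> c n t" if "t \<ge> 0" for n t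
  proof -
    show "0 \<le> c n t" using that by (auto simp: c_def intro!: divide_nonneg_pos)
    have "real_of_int \<lfloor>real (Suc n) * t\<rfloor> \<le> real (Suc n) * t" by (rule of_int_floor_le)
    then show "c n t \<le> t" by (simp add: c_def field_simps del: of_nat_Suc)
    have "real (Suc n) * t - 1 \<le> real_of_int \<lfloor>real (Suc n) * t\<rfloor>" by linarith
    then have "(real (Suc n) * t - 1) / real (Suc n) \<le> c n t" unfolding c_def by (rule divide_right_mono) simp
    then show "t - 1 / real (Suc n) \<le> c n t" by (simp add: diff_divide_distrib del: of_nat_Suc)
  qed
  have clim: "(\<lambda>n. c n t) \<longlonglongrightarrow> t" if "t \<ge> 0" for t
  proof (rule tendsto_sandwich)
    show "\<forall>\<^sub>F n in sequentially. t - 1 / real (Suc n) \<le> c n t" "\<forall>\<^sub>F n in sequentially. c n t \<le> t"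
      using c[OF that] by auto
    show "(\<lambda>n. t - 1 / real (Suc n)) \<longlonglongrightarrow> t"
      using tendsto_diff[OF tendsto_const LIMSEQ_Suc[OF lim_const_over_n[of 1]]] by simp
  qed simp
  define g where "g n i = (\<lambda>p::real \<times> real. if real_of_int i / real (Suc n) \<in> {0..s} then f (fst p) (real_of_int i / real (Suc n)) else 0)" for n i
  have id: "(\<lambda>t. t) \<in> borel_measurable ?M"
    by (rule borel_measurable_integrable[OF continuous_integrable_interval]) (auto intro: continuous_intros)
  have gm: "g n i \<in> borel_measurable (?M \<Otimes>\<^sub>M ?M)" for n i
  proof (cases "real_of_int i / real (Suc n) \<in> {0..s}")
    case True
    from measurable_compose[OF measurable_fst meas[OF True]] show ?thesis
      unfolding g_def using True by simp
  next
    case False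
    then show ?thesis unfolding g_def by (simp only: if_False) simp
  qed
  have Gm: "(\<lambda>p. g n \<lfloor>real (Suc n) * snd p\<rfloor> p) \<in> borel_measurable (?M \<Otimes>\<^sub>M ?M)" for n
  proof (rule measurable_compose_countable[of g for g, OF gm])
    have [measurable]: "(\<lambda>p::real \<times> real. snd p) \<in> borel_measurable (?M \<Otimes>\<^sub>M ?M)"
      by (rule measurable_compose[OF measurable_snd id])
    show "(\<lambda>p. \<lfloor>real (Suc n) * snd p\<rfloor>) \<in> measurable (?M \<Otimes>\<^sub>M ?M) (count_space UNIV)"
      by measurable
  qed
  show ?thesis
  proof (rule borel_measurable_LIMSEQ_real[OF _ Gm])
    fix p assume "p \<in> space (?M \<Otimes>\<^sub>M ?M)"
    then have p: "fst p \<in> {0..s}" "snd p \<in> {0..s}" by (auto simp: space_pair_measure)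
    have eq: "g n \<lfloor>real (Suc n) * snd p\<rfloor> p = f (fst p) (c n (snd p))" for n
      using c[of "snd p" n] p unfolding g_def c_def[symmetric] by auto
    have cs: "c n (snd p) \<in> {0..s}" for n using c(1,2)[of "snd p" n] p by auto
    have "(\<lambda>n. f (fst p) (c n (snd p))) \<longlonglongrightarrow> f (fst p) (snd p)"
      by (rule continuous_on_tendsto_compose[OF cont[OF p(1)] clim]) (use p cs in \<open>auto intro: always_eventually\<close>)
    then show "(\<lambda>n. g n \<lfloor>real (Suc n) * snd p\<rfloor> p) \<longlonglongrightarrow> (case p of (\<tau>, t) \<Rightarrow> f \<tau> t)"
      unfolding eq by (simp add: case_prod_unfold)
  qed
qed

text \<open>After the exchange the inner integral runs over the argument of \<open>w\<close> and
  becomes a difference of values of a primitive. In the first argument only measurability and a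
  bound are available, hence the Caratheodory form of the hypotheses.\<close>

lemma triangle_Fubini:
  fixes f :: "real \<Rightarrow> real \<Rightarrow> real"
  assumes meas: "\<And>t. t \<in> {0..s} \<Longrightarrow> (\<lambda>\<tau>. f \<tau> t) \<in> borel_measurable (lebesgue_on {0..s})"
    and cont: "\<And>\<tau>. \<tau> \<in> {0..s} \<Longrightarrow> continuous_on {0..s} (f \<tau>)"
    and bnd: "\<And>\<tau> t. \<tau> \<in> {0..s} \<Longrightarrow> t \<in> {0..s} \<Longrightarrow> \<bar>f \<tau> t\<bar> \<le> B"
  shows "integrable (lebesgue_on {0..s}) (\<lambda>t. integral {0..t} (\<lambda>\<tau>. f \<tau> t))"
    and "integrable (lebesgue_on {0..s}) (\<lambda>\<tau>. integral {\<tau>..s} (f \<tau>))"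
    and "integral {0..s} (\<lambda>t. integral {0..t} (\<lambda>\<tau>. f \<tau> t)) = integral {0..s} (\<lambda>\<tau>. integral {\<tau>..s} (f \<tau>))"
proof -
  let ?M = "lebesgue_on {0..s}"
  interpret M: finite_measure ?M by (rule finite_measure_lebesgue_on) (rule lmeasurable_interval)
  interpret P: pair_sigma_finite ?M ?M ..
  interpret PF: finite_measure "?M \<Otimes>\<^sub>M ?M" by (rule finite_measure_pair_measure) unfold_locales
  have id: "(\<lambda>t. t) \<in> borel_measurable ?M"
    by (rule borel_measurable_integrable[OF continuous_integrable_interval]) (auto intro: continuous_intros)
  have [measurable]: "(\<lambda>p::real \<times> real. fst p) \<in> borel_measurable (?M \<Otimes>\<^sub>M ?M)"
      "(\<lambda>p::real \<times> real. snd p) \<in> borel_measurable (?M \<Otimes>\<^sub>M ?M)"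
    by (rule measurable_compose[OF measurable_fst id], rule measurable_compose[OF measurable_snd id])
  have [measurable]: "(\<lambda>p. f (fst p) (snd p)) \<in> borel_measurable (?M \<Otimes>\<^sub>M ?M)"
    using caratheodory_measurable[OF meas cont] by (simp add: case_prod_unfold)
  let ?F = "\<lambda>p. if fst p \<le> snd p then f (fst p) (snd p) else 0"
  have F: "integrable (?M \<Otimes>\<^sub>M ?M) ?F"
  proof (rule PF.integrable_const_bound[of _ "\<bar>B\<bar>"])
    show "AE p in ?M \<Otimes>\<^sub>M ?M. norm (?F p) \<le> \<bar>B\<bar>"
    proof (rule AE_I2)
      fix p assume "p \<in> space (?M \<Otimes>\<^sub>M ?M)"
      then have "fst p \<in> {0..s}" "snd p \<in> {0..s}" by (auto simp: space_pair_measure)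
      from bnd[OF this] show "norm (?F p) \<le> \<bar>B\<bar>" by auto
    qed
  qed measurable
  then have F': "integrable (?M \<Otimes>\<^sub>M ?M) (\<lambda>(\<tau>, t). if \<tau> \<le> t then f \<tau> t else 0)"
    by (simp add: case_prod_unfold)
  have col: "(\<integral>\<tau>. (if \<tau> \<le> t then f \<tau> t else 0) \<partial>?M) = integral {0..t} (\<lambda>\<tau>. f \<tau> t)" if t: "t \<in> {0..s}" for t
  proof -
    have sub: "{0..t} \<subseteq> {0..s}" using t by auto
    have "integrable ?M (\<lambda>\<tau>. f \<tau> t)"
      by (rule M.integrable_const_bound[of _ B]) (use meas[OF t] bnd t in \<open>auto intro!: AE_I2\<close>)
    then have i: "integrable (lebesgue_on {0..t}) (\<lambda>\<tau>. f \<tau> t)"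
      by (rule lebesgue_on_subset_integrable[OF _ sub]) auto
    have "(\<integral>\<tau>. (if \<tau> \<le> t then f \<tau> t else 0) \<partial>?M) = (\<integral>\<tau>. (if \<tau> \<in> {0..t} then f \<tau> t else 0) \<partial>?M)"
      by (rule Bochner_Integration.integral_cong) auto
    also have "\<dots> = (\<integral>\<tau>. f \<tau> t \<partial>lebesgue_on {0..t})"
      by (rule Lebesgue_Measure.integral_restrict[OF sub]) auto
    also have "\<dots> = integral {0..t} (\<lambda>\<tau>. f \<tau> t)" by (rule LINT_interval_eq_integral[OF i])
    finally show ?thesis .
  qed
  have row: "(\<integral>t. (if \<tau> \<le> t then f \<tau> t else 0) \<partial>?M) = integral {\<tau>..s} (f \<tau>)" if \<tau>: "\<tau> \<in> {0..s}" for \<tau>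
  proof -
    have sub: "{\<tau>..s} \<subseteq> {0..s}" using \<tau> by auto
    have i: "integrable (lebesgue_on {\<tau>..s}) (f \<tau>)"
      by (rule continuous_integrable_interval[OF continuous_on_subset[OF cont[OF \<tau>] sub]])
    have "(\<integral>t. (if \<tau> \<le> t then f \<tau> t else 0) \<partial>?M) = (\<integral>t. (if t \<in> {\<tau>..s} then f \<tau> t else 0) \<partial>?M)"
      by (rule Bochner_Integration.integral_cong) auto
    also have "\<dots> = (\<integral>t. f \<tau> t \<partial>lebesgue_on {\<tau>..s})"
      by (rule Lebesgue_Measure.integral_restrict[OF sub]) auto
    also have "\<dots> = integral {\<tau>..s} (f \<tau>)" by (rule LINT_interval_eq_integral[OF i])
    finally show ?thesis .
  qed
  have "integrable ?M (\<lambda>t. \<integral>\<tau>. (if \<tau> \<le> t then f \<tau> t else 0) \<partial>?M)"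
    using P.integrable_snd[OF F'] .
  then show 1: "integrable ?M (\<lambda>t. integral {0..t} (\<lambda>\<tau>. f \<tau> t))"
    by (rule Bochner_Integration.integrable_cong[THEN iffD1, rotated -1]) (auto simp: col)
  have "integrable ?M (\<lambda>\<tau>. \<integral>t. (if \<tau> \<le> t then f \<tau> t else 0) \<partial>?M)"
    using P.integrable_fst[OF F'] .
  then show 2: "integrable ?M (\<lambda>\<tau>. integral {\<tau>..s} (f \<tau>))"
    by (rule Bochner_Integration.integrable_cong[THEN iffD1, rotated -1]) (auto simp: row)
  have "integral {0..s} (\<lambda>t. integral {0..t} (\<lambda>\<tau>. f \<tau> t)) = (\<integral>t. integral {0..t} (\<lambda>\<tau>. f \<tau> t) \<partial>?M)"
    by (rule LINT_interval_eq_integral[OF 1, symmetric])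
  also have "\<dots> = (\<integral>t. \<integral>\<tau>. (if \<tau> \<le> t then f \<tau> t else 0) \<partial>?M \<partial>?M)"
    by (rule Bochner_Integration.integral_cong) (auto simp: col)
  also have "\<dots> = (\<integral>\<tau>. \<integral>t. (if \<tau> \<le> t then f \<tau> t else 0) \<partial>?M \<partial>?M)"
    by (rule P.Fubini_integral[OF F'])
  also have "\<dots> = (\<integral>\<tau>. integral {\<tau>..s} (f \<tau>) \<partial>?M)"
    by (rule Bochner_Integration.integral_cong) (auto simp: row)
  also have "\<dots> = integral {0..s} (\<lambda>\<tau>. integral {\<tau>..s} (f \<tau>))"
    by (rule LINT_interval_eq_integral[OF 2])
  finally show "integral {0..s} (\<lambda>t. integral {0..t} (\<lambda>\<tau>. f \<tau> t)) = integral {0..s} (\<lambda>\<tau>. integral {\<tau>..s} (f \<tau>))" .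
qed

text \<open>The energy estimate bounds E(s) by values at \<open>s\<close> and at earlier times, so
  the inequality is demanded only where \<open>E\<close> is largest since \<open>m\<close>. Beyond
  the last time \<open>m\<close> up to which \<open>E\<close> vanishes, take a short interval on
  which the integral of \<open>g\<close> stays below 1/2 and a maximum point \<open>s\<close> in it:
  then E(s) \<le> E(s)/2.\<close>

lemma gronwall_zero:
  fixes E g :: "real \<Rightarrow> real"
  assumes T: "T > 0" and c: "continuous_on {0..T} E" and nn: "\<And>t. t \<in> {0..T} \<Longrightarrow> E t \<ge> 0"
    and g: "integrable (lebesgue_on {0..T}) g" "\<And>t. g t \<ge> 0"
    and E0: "E 0 = 0"
    and ineq: "\<And>s m. s \<in> {0..T} \<Longrightarrow> m \<in> {0..s} \<Longrightarrow> (\<And>t. t \<in> {0..m} \<Longrightarrow> E t = 0) \<Longrightarrow>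
       (\<And>t. t \<in> {m..s} \<Longrightarrow> E t \<le> E s) \<Longrightarrow> E s \<le> E s * integral {m..s} g"
    and t: "t \<in> {0..T}"
  shows "E t = 0"
proof -
  have gi: "g integrable_on {0..T}" using g(1) integrable_on_lebesgue_on by fastforce
  define S where "S = {s \<in> {0..T}. \<forall>t\<in>{0..s}. E t = 0}"
  have S0: "0 \<in> S" using T E0 by (auto simp: S_def)
  have bdd: "bdd_above S" by (auto simp: S_def intro: bdd_aboveI[of _ T])
  define m where "m = Sup S"
  have m0: "0 \<le> m" unfolding m_def by (rule cSup_upper[OF S0 bdd])
  have mT: "m \<le> T" unfolding m_def by (rule cSup_least) (use S0 in \<open>auto simp: S_def\<close>)
  have below: "E t = 0" if tm: "0 \<le> t" "t < m" for t
  proof -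
    obtain s where "s \<in> S" "t < s" using less_cSup_iff[OF _ bdd, of t] S0 tm unfolding m_def by blast
    then show ?thesis using tm by (auto simp: S_def)
  qed
  have Em: "E m = 0"
  proof (cases "m = 0")
    case False
    have "closure {0..<m} = {0..m}" using False m0 by simp
    then show ?thesis
      using continuous_constant_on_closure[of "{0..<m}" E 0 m] continuous_on_subset[OF c, of "{0..m}"] below m0 mT by auto
  qed (simp add: E0)
  have upto: "E t = 0" if "t \<in> {0..m}" for t using below[of t] Em that by (cases "t = m") auto
  have "m = T"
  proof (rule ccontr)
    assume "m \<noteq> T"
    then have mlt: "m < T" using mT by simp
    \<comment> \<open>Continuity of the primitive makes the integral of \<open>g\<close> small on
      short intervals after \<open>m\<close>, although \<open>g\<close> itself may be
      unbounded.\<close>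
    have cI: "continuous_on {0..T} (\<lambda>x. integral {0..x} g)" by (rule indefinite_integral_continuous_1[OF gi])
    obtain d where d: "d > 0" "\<And>x. x \<in> {0..T} \<Longrightarrow> dist x m < d \<Longrightarrow> dist (integral {0..x} g) (integral {0..m} g) < 1 / 2"
      using cI m0 mT unfolding continuous_on_iff by (metis atLeastAtMost_iff half_gt_zero zero_less_one)
    define b where "b = min (m + d / 2) T"
    have b: "m < b" "b \<le> T" "b < m + d" using d mlt by (auto simp: b_def)
    have "\<exists>s\<in>{m..b}. \<forall>t\<in>{m..b}. E t \<le> E s"
      by (rule continuous_attains_sup) (use b m0 continuous_on_subset[OF c] in auto)
    then obtain s where s: "s \<in> {m..b}" "\<And>t. t \<in> {m..b} \<Longrightarrow> E t \<le> E s" by blast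
    have sT: "s \<in> {0..T}" using s b m0 by auto
    have "E s \<le> E s * integral {m..s} g"
      by (rule ineq) (use s sT m0 upto in auto)
    moreover have "integral {m..s} g < 1 / 2"
    proof -
      have "g integrable_on {0..s}" by (rule integrable_subinterval_real[OF gi]) (use sT in auto)
      then have "integral {0..m} g + integral {m..s} g = integral {0..s} g"
        by (intro Henstock_Kurzweil_Integration.integral_combine) (use s m0 in auto)
      moreover have "dist (integral {0..s} g) (integral {0..m} g) < 1 / 2"
        by (rule d(2)[OF sT]) (use s b in \<open>auto simp: dist_real_def\<close>)
      ultimately show ?thesis unfolding dist_real_def by linarith
    qed
    then have "E s * integral {m..s} g \<le> E s * (1 / 2)" by (intro mult_left_mono) (use nn[OF sT] in auto)
    ultimately have "E s \<le> 0" by simp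
    then have "E t = 0" if "t \<in> {0..b}" for t
      using upto[of t] s(2)[of t] nn[of t] that b m0 by (cases "t \<le> m") auto
    then have "b \<in> S" using b m0 by (auto simp: S_def)
    then have "b \<le> m" unfolding m_def by (rule cSup_upper[OF _ bdd])
    then show False using b by simp
  qed
  then show ?thesis using upto t by simp
qed

text \<open>In the application, \<open>e\<close> is the squared \<open>L\<^sup>2\<close> norm of \<open>w\<close>, \<open>k\<close> the Gram kernel of the gradients
  of \<open>w\<close>, so that \<open>N \<sigma>\<close> is the squared norm of the gradient of \<open>\<integral>\<^sub>0\<^sup>\<sigma> w\<close>, and
  \<open>f \<tau> t = \<langle>(u\<^sup>5 - v\<^sup>5)(\<tau>), w(t)\<rangle>\<close>.\<close>

lemma scalar_energy_uniqueness:
  fixes e c g :: "real \<Rightarrow> real" and k :: "real \<times> real \<Rightarrow> real" and f :: "real \<Rightarrow> real \<Rightarrow> real"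
  defines "N \<equiv> \<lambda>\<sigma>. integral {0..\<sigma>} (\<lambda>t. integral {0..\<sigma>} (\<lambda>s. k (t, s)))"
  assumes T: "T > 0"
    and der: "\<And>t. t \<in> {0..T} \<Longrightarrow> (e has_real_derivative 2 * c t) (at t within {0..T})"
    and cc: "continuous_on {0..T} c" and e0: "e 0 = 0" and enn: "\<And>t. t \<in> {0..T} \<Longrightarrow> e t \<ge> 0"
    and ck: "continuous_on ({0..T} \<times> {0..T}) k" and ksym: "\<And>s t. k (s, t) = k (t, s)"
    and fm: "\<And>t. t \<in> {0..T} \<Longrightarrow> (\<lambda>\<tau>. f \<tau> t) \<in> borel_measurable (lebesgue_on {0..T})"
    and fc: "\<And>\<tau>. \<tau> \<in> {0..T} \<Longrightarrow> continuous_on {0..T} (f \<tau>)"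
    and fb: "\<And>\<tau> t. \<tau> \<in> {0..T} \<Longrightarrow> t \<in> {0..T} \<Longrightarrow> \<bar>f \<tau> t\<bar> \<le> B"
    and ineq: "\<And>t. t \<in> {0..T} \<Longrightarrow> c t + integral {0..t} (\<lambda>\<tau>. k (\<tau>, t)) + integral {0..t} (\<lambda>\<tau>. f \<tau> t) \<le> 0"
    and Nnn: "\<And>\<sigma>. \<sigma> \<in> {0..T} \<Longrightarrow> N \<sigma> \<ge> 0"
    and g: "integrable (lebesgue_on {0..T}) g" "\<And>t. g t \<ge> 0"
    and fN: "AE \<tau> in lebesgue_on {0..T}. \<forall>\<sigma>\<in>{0..T}. \<bar>integral {0..\<sigma>} (f \<tau>)\<bar> \<le> g \<tau> * sqrt (e \<tau>) * sqrt (N \<sigma>)"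
    and t: "t \<in> {0..T}"
  shows "e t = 0"
proof -
  define I where "I t = integral {0..t} (\<lambda>\<tau>. k (\<tau>, t))" for t
  define J where "J t = integral {0..t} (\<lambda>\<tau>. f \<tau> t)" for t
  have "compact (k ` ({0..T} \<times> {0..T}))" by (rule compact_continuous_image[OF ck]) (simp add: compact_Times)
  then obtain Bk where Bk: "\<And>p. p \<in> {0..T} \<times> {0..T} \<Longrightarrow> \<bar>k p\<bar> \<le> Bk"
    using compact_imp_bounded bounded_real by (metis image_eqI)
  have ck1: "continuous_on {0..T} (\<lambda>s. k (\<tau>, s))" if "\<tau> \<in> {0..T}" for \<tau>
    by (rule continuous_on_compose2[OF ck]) (use that in \<open>auto intro!: continuous_intros\<close>)
  have km: "(\<lambda>\<tau>. k (\<tau>, t)) \<in> borel_measurable (lebesgue_on {0..s})" if "t \<in> {0..s}" "s \<in> {0..T}" for s t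
  proof -
    have "continuous_on {0..s} (\<lambda>\<tau>. k (t, \<tau>))"
      by (rule continuous_on_subset[OF ck1]) (use that in auto)
    then show ?thesis
      unfolding ksym[of _ t] by (rule borel_measurable_integrable[OF continuous_integrable_interval])
  qed
  have trik: "integrable (lebesgue_on {0..s}) I" "integrable (lebesgue_on {0..s}) (\<lambda>\<tau>. integral {\<tau>..s} (\<lambda>t. k (\<tau>, t)))"
     "integral {0..s} I = integral {0..s} (\<lambda>\<tau>. integral {\<tau>..s} (\<lambda>t. k (\<tau>, t)))" if s: "s \<in> {0..T}" for s
  proof -
    have a: "continuous_on {0..s} (\<lambda>t. k (\<tau>, t))" if "\<tau> \<in> {0..s}" for \<tau>
      by (rule continuous_on_subset[OF ck1]) (use that s in auto)
    have b: "\<bar>k (\<tau>, t)\<bar> \<le> Bk" if "\<tau> \<in> {0..s}" "t \<in> {0..s}" for \<tau> t using Bk that s by auto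
    note triangle_Fubini[of s "\<lambda>\<tau> t. k (\<tau>, t)", OF km[OF _ s] a b]
    then show "integrable (lebesgue_on {0..s}) I" "integrable (lebesgue_on {0..s}) (\<lambda>\<tau>. integral {\<tau>..s} (\<lambda>t. k (\<tau>, t)))"
      "integral {0..s} I = integral {0..s} (\<lambda>\<tau>. integral {\<tau>..s} (\<lambda>t. k (\<tau>, t)))"
      unfolding I_def by blast+
  qed
  have trif: "integrable (lebesgue_on {0..s}) J" "integrable (lebesgue_on {0..s}) (\<lambda>\<tau>. integral {\<tau>..s} (f \<tau>))"
     "integral {0..s} J = integral {0..s} (\<lambda>\<tau>. integral {\<tau>..s} (f \<tau>))" if s: "s \<in> {0..T}" for s
  proof -
    have sub: "{0..s} \<subseteq> {0..T}" using s by auto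
    have m: "(\<lambda>\<tau>. f \<tau> t) \<in> borel_measurable (lebesgue_on {0..s})" if "t \<in> {0..s}" for t
      by (rule measurable_restrict_mono[OF fm sub]) (use that s in auto)
    have a: "continuous_on {0..s} (f \<tau>)" if "\<tau> \<in> {0..s}" for \<tau>
      by (rule continuous_on_subset[OF fc sub]) (use that s in auto)
    have b: "\<bar>f \<tau> t\<bar> \<le> B" if "\<tau> \<in> {0..s}" "t \<in> {0..s}" for \<tau> t using fb that s by auto
    note triangle_Fubini[of s f, OF m a b]
    then show "integrable (lebesgue_on {0..s}) J" "integrable (lebesgue_on {0..s}) (\<lambda>\<tau>. integral {\<tau>..s} (f \<tau>))"
      "integral {0..s} J = integral {0..s} (\<lambda>\<tau>. integral {\<tau>..s} (f \<tau>))"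
      unfolding J_def by blast+
  qed
  have HK: "h integrable_on {0..s}" if "integrable (lebesgue_on {0..s}) h" for h :: "real \<Rightarrow> real" and s
    using that integrable_on_lebesgue_on by fastforce
  \<comment> \<open>The square consists of two triangles, which the symmetry of \<open>k\<close>
    interchanges.\<close>
  have N2: "N s = 2 * integral {0..s} I" if s: "s \<in> {0..T}" for s
  proof -
    have "N s = integral {0..s} (\<lambda>t. I t + integral {t..s} (\<lambda>\<tau>. k (t, \<tau>)))"
      unfolding N_def
    proof (rule Henstock_Kurzweil_Integration.integral_cong)
      fix t assume t: "t \<in> {0..s}"
      have "(\<lambda>\<tau>. k (t, \<tau>)) integrable_on {0..s}"
        by (rule integrable_continuous_real[OF continuous_on_subset[OF ck1]]) (use t s in auto)
      then have "integral {0..s} (\<lambda>\<tau>. k (t, \<tau>)) = integral {0..t} (\<lambda>\<tau>. k (t, \<tau>)) + integral {t..s} (\<lambda>\<tau>. k (t, \<tau>))"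
        using Henstock_Kurzweil_Integration.integral_combine[of 0 t s "\<lambda>\<tau>. k (t, \<tau>)"] t by simp
      then show "integral {0..s} (\<lambda>\<tau>. k (t, \<tau>)) = I t + integral {t..s} (\<lambda>\<tau>. k (t, \<tau>))"
        unfolding I_def ksym[of _ t] .
    qed
    also have "\<dots> = integral {0..s} I + integral {0..s} (\<lambda>t. integral {t..s} (\<lambda>\<tau>. k (t, \<tau>)))"
      by (rule integral_add[OF HK[OF trik(1)[OF s]] HK[OF trik(2)[OF s]]])
    finally show ?thesis using trik(3)[OF s] by simp
  qed
  \<comment> \<open>Twice \<open>ineq\<close>, integrated over [0, s]: the first term is the
    derivative of \<open>e\<close>, the second gives \<open>N\<close> by \<open>N2\<close>, and the
    order of integration is exchanged in the third.\<close>
  have main: "e s + N s \<le> - 2 * integral {0..s} (\<lambda>\<tau>. integral {\<tau>..s} (f \<tau>))" if s: "s \<in> {0..T}" for s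
  proof -
    have "((\<lambda>t. 2 * c t) has_integral (e s - e 0)) {0..s}"
    proof (rule fundamental_theorem_of_calculus)
      fix t assume "t \<in> {0..s}"
      then have "(e has_real_derivative 2 * c t) (at t within {0..s})"
        by (intro DERIV_subset[OF der]) (use s in auto)
      then show "(e has_vector_derivative 2 * c t) (at t within {0..s})"
        by (simp add: has_real_derivative_iff_has_vector_derivative)
    qed (use s in auto)
    from integral_unique[OF this] have "e s = integral {0..s} (\<lambda>t. 2 * c t)" using e0 by linarith
    also have "\<dots> \<le> integral {0..s} (\<lambda>t. - 2 * I t - 2 * J t)"
    proof (rule integral_le)
      show "(\<lambda>t. 2 * c t) integrable_on {0..s}"
        by (intro integrable_continuous_real continuous_intros continuous_on_subset[OF cc]) (use s in auto)
      show "(\<lambda>t. - 2 * I t - 2 * J t) integrable_on {0..s}"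
        by (rule HK) (use trik(1)[OF s] trif(1)[OF s] in auto)
      fix t assume "t \<in> {0..s}"
      then have "c t + I t + J t \<le> 0" using ineq[of t] s unfolding I_def J_def by auto
      then show "2 * c t \<le> - 2 * I t - 2 * J t" by simp
    qed
    also have "\<dots> = - 2 * integral {0..s} I - 2 * integral {0..s} J"
      by (rule integral_unique[OF has_integral_diff[OF
            has_integral_mult_right[OF integrable_integral[OF HK[OF trik(1)[OF s]]]]
            has_integral_mult_right[OF integrable_integral[OF HK[OF trif(1)[OF s]]]]]])
    finally show ?thesis using N2[OF s] trif(3)[OF s] by simp
  qed
  define E where "E t = e t + N t" for t
  have En: "0 \<le> e t" "0 \<le> N t" "e t \<le> E t" "N t \<le> E t" "0 \<le> E t" if "t \<in> {0..T}" for t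
    using enn[OF that] Nnn[OF that] by (auto simp: E_def)
  have "E t = 0"
  \<comment> \<open>One factor 2 comes from \<open>main\<close>, the other from the two primitives
    whose difference is the integral over [\<tau>, s].\<close>
  proof (rule gronwall_zero[OF T, of E "\<lambda>t. 4 * g t"])
    have "continuous_on {0..T} e" by (auto simp: continuous_on_eq_continuous_within intro!: DERIV_continuous der)
    moreover have "continuous_on {0..T} N"
    proof -
      have "T \<in> {0..T}" using T by simp
      then have "continuous_on {0..T} (\<lambda>s. 2 * integral {0..s} I)"
        by (intro continuous_on_mult continuous_on_const indefinite_integral_continuous_1 HK trik(1))
      then show ?thesis by (rule continuous_on_eq) (rule N2[symmetric])
    qed
    ultimately show "continuous_on {0..T} E" unfolding E_def by (intro continuous_on_add)
    show "E 0 = 0" by (simp add: E_def e0 N_def)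
    show "integrable (lebesgue_on {0..T}) (\<lambda>t. 4 * g t)" using g by auto
    fix s m assume s: "s \<in> {0..T}" and m: "m \<in> {0..s}" and z: "\<And>t. t \<in> {0..m} \<Longrightarrow> E t = 0"
      and mx: "\<And>t. t \<in> {m..s} \<Longrightarrow> E t \<le> E s"
    let ?M = "lebesgue_on {0..s}"
    let ?R = "\<lambda>\<tau>. integral {\<tau>..s} (f \<tau>)"
    have sub: "{0..s} \<subseteq> {0..T}" "{m..s} \<subseteq> {0..s}" using s m by auto
    have gs: "integrable ?M g" by (rule lebesgue_on_subset_integrable[OF g(1) sub(1)]) auto
    have gms: "integrable (lebesgue_on {m..s}) g" by (rule lebesgue_on_subset_integrable[OF gs sub(2)]) auto
    have "AE \<tau> in lebesgue. \<tau> \<in> {0..T} \<longrightarrow> (\<forall>\<sigma>\<in>{0..T}. \<bar>integral {0..\<sigma>} (f \<tau>)\<bar> \<le> g \<tau> * sqrt (e \<tau>) * sqrt (N \<sigma>))"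
      using fN by (simp add: AE_restrict_space_iff)
    then have "AE \<tau> in lebesgue. \<tau> \<in> {0..s} \<longrightarrow> \<bar>?R \<tau>\<bar> \<le> 2 * E s * (if \<tau> \<in> {m..s} then g \<tau> else 0)"
    proof eventually_elim
      case (elim \<tau>)
      show ?case
      proof
        assume \<tau>: "\<tau> \<in> {0..s}"
        then have \<tau>T: "\<tau> \<in> {0..T}" using sub by auto
        have "f \<tau> integrable_on {0..s}"
          by (rule integrable_continuous_real[OF continuous_on_subset[OF fc[OF \<tau>T] sub(1)]])
        then have "?R \<tau> = integral {0..s} (f \<tau>) - integral {0..\<tau>} (f \<tau>)"
          using Henstock_Kurzweil_Integration.integral_combine[of 0 \<tau> s "f \<tau>"] \<tau> by simp
        then have "\<bar>?R \<tau>\<bar> \<le> \<bar>integral {0..s} (f \<tau>)\<bar> + \<bar>integral {0..\<tau>} (f \<tau>)\<bar>" by simp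
        also have "\<dots> \<le> g \<tau> * sqrt (e \<tau>) * sqrt (N s) + g \<tau> * sqrt (e \<tau>) * sqrt (N \<tau>)"
          using elim s \<tau>T by (intro add_mono) auto
        finally have R: "\<bar>?R \<tau>\<bar> \<le> g \<tau> * sqrt (e \<tau>) * sqrt (N s) + g \<tau> * sqrt (e \<tau>) * sqrt (N \<tau>)" .
        \<comment> \<open>After \<open>m\<close> the maximality of \<open>E\<close> at
          \<open>s\<close> bounds both products of roots by E(s); before \<open>m\<close> the factor
          \<open>e \<tau>\<close> vanishes.\<close>
        show "\<bar>?R \<tau>\<bar> \<le> 2 * E s * (if \<tau> \<in> {m..s} then g \<tau> else 0)"
        proof (cases "\<tau> \<in> {m..s}")
          case True
          have le: "e \<tau> \<le> E s" "N s \<le> E s" "N \<tau> \<le> E s"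
            using mx[OF True] En(3,4)[OF \<tau>T] En(4)[OF s] by linarith+
          have q: "g \<tau> * sqrt (e \<tau>) * sqrt y \<le> g \<tau> * E s" if "y \<le> E s" "0 \<le> y" for y
          proof -
            have "sqrt (e \<tau>) * sqrt y \<le> sqrt (E s) * sqrt (E s)"
              using le(1) that En(1)[OF \<tau>T] En(5)[OF s] by (intro mult_mono real_sqrt_le_mono) auto
            also have "\<dots> = E s" using En(5)[OF s] by simp
            finally show ?thesis using g(2)[of \<tau>] by (simp add: mult.assoc mult_left_mono)
          qed
          have "\<bar>?R \<tau>\<bar> \<le> 2 * (g \<tau> * E s)"
            using R q[OF le(2) En(2)[OF s]] q[OF le(3) En(2)[OF \<tau>T]] by linarith
          then show ?thesis using True by (simp add: mult_ac)
        next
          case False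
          then have "\<tau> \<in> {0..m}" using \<tau> by auto
          then have "e \<tau> = 0" using z En[OF \<tau>T] by fastforce
          then show ?thesis using R False by auto
        qed
      qed
    qed
    then have ae: "AE \<tau> in ?M. \<bar>?R \<tau>\<bar> \<le> 2 * E s * (if \<tau> \<in> {m..s} then g \<tau> else 0)"
      by (simp add: AE_restrict_space_iff)
    have gi: "integrable ?M (\<lambda>\<tau>. if \<tau> \<in> {m..s} then g \<tau> else 0)"
    proof -
      have "integrable ?M (\<lambda>\<tau>. indicator {m..s} \<tau> *\<^sub>R g \<tau>)"
        by (rule integrable_mult_indicator[OF _ gs]) (use sub in \<open>auto simp: sets_restrict_space_iff\<close>)
      then show ?thesis
        by (rule Bochner_Integration.integrable_cong[THEN iffD1, rotated -1]) (auto simp: indicator_def)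
    qed
    have "- integral {0..s} ?R = - (\<integral>\<tau>. ?R \<tau> \<partial>?M)"
      using LINT_interval_eq_integral[OF trif(2)[OF s]] by simp
    also have "\<dots> \<le> \<bar>\<integral>\<tau>. ?R \<tau> \<partial>?M\<bar>" by simp
    also have "\<dots> \<le> (\<integral>\<tau>. \<bar>?R \<tau>\<bar> \<partial>?M)" by (rule integral_abs_bound)
    also have "\<dots> \<le> (\<integral>\<tau>. 2 * E s * (if \<tau> \<in> {m..s} then g \<tau> else 0) \<partial>?M)"
      by (rule integral_mono_AE) (use trif(2)[OF s] gi ae in auto)
    also have "\<dots> = 2 * E s * (\<integral>\<tau>. (if \<tau> \<in> {m..s} then g \<tau> else 0) \<partial>?M)"
      by (rule Bochner_Integration.integral_mult_right[OF gi])
    also have "(\<integral>\<tau>. (if \<tau> \<in> {m..s} then g \<tau> else 0) \<partial>?M) = (\<integral>\<tau>. g \<tau> \<partial>lebesgue_on {m..s})"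
      by (rule Lebesgue_Measure.integral_restrict[OF sub(2)]) auto
    also have "\<dots> = integral {m..s} g" by (rule LINT_interval_eq_integral[OF gms])
    finally have "- integral {0..s} ?R \<le> 2 * E s * integral {m..s} g" .
    moreover have "E s \<le> - 2 * integral {0..s} ?R" using main[OF s] by (simp add: E_def)
    ultimately have "E s \<le> 2 * (2 * E s * integral {m..s} g)" by linarith
    then have "E s \<le> E s * (4 * integral {m..s} g)" by (simp add: mult_ac)
    then show "E s \<le> E s * integral {m..s} (\<lambda>t. 4 * g t)" by simp
  qed (use g En t in auto)
  then show ?thesis using En[OF t] by linarith
qed

text \<open>Writing u^5 \<psi> as u^3 times u^2 \<psi> puts both factors into L^2 by the Sobolev
  inequality alone, each with constant 64, the root of 4096. The bound depends on gradient norms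
  only and hence holds uniformly in time along an energy path.\<close>

lemma quintic_pair_bound:
  fixes U :: "(real^3) set"
  assumes U: "U \<in> lmeasurable" and u: "H01_pair U u g" and \<psi>: "H01_pair U \<psi> \<gamma>"
  shows "\<bar>\<integral>x. u x ^ 5 * \<psi> x \<partial>lebesgue_on U\<bar> \<le> 4096 * l2_norm U g ^ 5 * l2_norm U \<gamma>"
proof -
  have [measurable]: "u \<in> borel_measurable (lebesgue_on U)" "\<psi> \<in> borel_measurable (lebesgue_on U)"
    using H01_pair_L2vec(1)[OF u] H01_pair_L2vec(1)[OF \<psi>] by (auto simp: L2vec_def)
  have i: "integrable (lebesgue_on U) (\<lambda>x. ((u x)\<^sup>2) ^ 3)" "integrable (lebesgue_on U) (\<lambda>x. ((\<psi> x)\<^sup>2) ^ 3)"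
    using sobolev(1)[OF u U] sobolev(1)[OF \<psi> U] by (simp_all flip: power_mult)
  have le: "(\<integral>x. ((u x)\<^sup>2) ^ 3 \<partial>lebesgue_on U) \<le> (16 * L2vsq U g) ^ 3"
      "(\<integral>x. ((\<psi> x)\<^sup>2) ^ 3 \<partial>lebesgue_on U) \<le> (16 * L2vsq U \<gamma>) ^ 3"
    using sobolev(2)[OF u U] sobolev(2)[OF \<psi> U] by (simp_all add: power_mult_distrib flip: power_mult)
  have nn: "0 \<le> 16 * L2vsq U g" "0 \<le> 16 * L2vsq U \<gamma>" by (simp_all add: L2vsq_nonneg)
  have m: "(\<lambda>x. (u x)\<^sup>2) \<in> borel_measurable (lebesgue_on U)" "(\<lambda>x. (\<psi> x)\<^sup>2) \<in> borel_measurable (lebesgue_on U)"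
    by measurable
  note h = Holder_cubes[OF m zero_le_power2 zero_le_power2 i le nn]
  have a: "L2vec U (\<lambda>x. u x ^ 3)" using i(1) by (simp add: L2vec_def flip: power_mult)
  have b: "L2vec U (\<lambda>x. (u x)\<^sup>2 * \<psi> x)" using h(1) by (simp add: L2vec_def power_mult_distrib flip: power_mult)
  have na: "l2_norm U (\<lambda>x. u x ^ 3) \<le> 64 * l2_norm U g ^ 3"
  proof (rule power2_le_imp_le)
    have "(l2_norm U (\<lambda>x. u x ^ 3))\<^sup>2 = (\<integral>x. ((u x)\<^sup>2) ^ 3 \<partial>lebesgue_on U)"
      by (simp add: l2_norm_square L2vsq_def flip: power_mult)
    also have "\<dots> \<le> (16 * (l2_norm U g)\<^sup>2) ^ 3" using le(1) by (simp add: l2_norm_square)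
    also have "\<dots> = (64 * l2_norm U g ^ 3)\<^sup>2" by (simp add: power_mult_distrib flip: power_mult)
    finally show "(l2_norm U (\<lambda>x. u x ^ 3))\<^sup>2 \<le> (64 * l2_norm U g ^ 3)\<^sup>2" .
  qed (simp add: l2_norm_nonneg)
  have nb: "l2_norm U (\<lambda>x. (u x)\<^sup>2 * \<psi> x) \<le> 64 * (l2_norm U g)\<^sup>2 * l2_norm U \<gamma>"
  proof (rule power2_le_imp_le)
    have "(l2_norm U (\<lambda>x. (u x)\<^sup>2 * \<psi> x))\<^sup>2 = (\<integral>x. ((u x)\<^sup>2)\<^sup>2 * (\<psi> x)\<^sup>2 \<partial>lebesgue_on U)"
      by (simp add: l2_norm_square L2vsq_def power_mult_distrib)
    also have "\<dots> \<le> (16 * (l2_norm U g)\<^sup>2)\<^sup>2 * (16 * (l2_norm U \<gamma>)\<^sup>2)" using h(2) by (simp add: l2_norm_square)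
    also have "\<dots> = (64 * (l2_norm U g)\<^sup>2 * l2_norm U \<gamma>)\<^sup>2" by (simp add: power_mult_distrib flip: power_mult)
    finally show "(l2_norm U (\<lambda>x. (u x)\<^sup>2 * \<psi> x))\<^sup>2 \<le> (64 * (l2_norm U g)\<^sup>2 * l2_norm U \<gamma>)\<^sup>2" .
  qed (simp add: l2_norm_nonneg)
  have "(\<integral>x. u x ^ 5 * \<psi> x \<partial>lebesgue_on U) = l2_inner U (\<lambda>x. u x ^ 3) (\<lambda>x. (u x)\<^sup>2 * \<psi> x)"
    by (simp add: l2_inner_def mult.assoc[symmetric] flip: power_add)
  also have "\<bar>\<dots>\<bar> \<le> l2_norm U (\<lambda>x. u x ^ 3) * l2_norm U (\<lambda>x. (u x)\<^sup>2 * \<psi> x)"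
    by (rule l2_Cauchy_Schwarz[OF a b])
  also have "\<dots> \<le> (64 * l2_norm U g ^ 3) * (64 * (l2_norm U g)\<^sup>2 * l2_norm U \<gamma>)"
    by (intro mult_mono na nb) (auto simp: l2_norm_nonneg)
  also have "\<dots> = 4096 * l2_norm U g ^ 5 * l2_norm U \<gamma>"
    by (simp add: mult_ac flip: power_add)
  finally show ?thesis .
qed

section \<open>Uniqueness\<close>

lemma tendsto_l2_norm_diff:
  assumes f: "\<And>s. s \<in> S \<Longrightarrow> L2vec U (f s)" and g: "\<And>s. s \<in> S \<Longrightarrow> L2vec U (g s)"
    and f0: "L2vec U f0" and g0: "L2vec U g0" and S: "eventually (\<lambda>s. s \<in> S) F"
    and lf: "((\<lambda>s. l2_norm U (\<lambda>x. f s x - f0 x)) \<longlongrightarrow> 0) F"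
    and lg: "((\<lambda>s. l2_norm U (\<lambda>x. g s x - g0 x)) \<longlongrightarrow> 0) F"
  shows "((\<lambda>s. l2_norm U (\<lambda>x. (f s x - g s x) - (f0 x - g0 x))) \<longlongrightarrow> 0) F"
proof (rule Lim_null_comparison)
  show "((\<lambda>s. l2_norm U (\<lambda>x. f s x - f0 x) + l2_norm U (\<lambda>x. g0 x - g s x)) \<longlongrightarrow> 0) F"
    using tendsto_add[OF lf lg] by (simp add: l2_norm_diff_commute[of U g0])
  show "eventually (\<lambda>s. norm (l2_norm U (\<lambda>x. (f s x - g s x) - (f0 x - g0 x)))
      \<le> l2_norm U (\<lambda>x. f s x - f0 x) + l2_norm U (\<lambda>x. g0 x - g s x)) F"
  proof (rule eventually_mono[OF S])
    fix s assume s: "s \<in> S"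
    have "(\<lambda>x. (f s x - g s x) - (f0 x - g0 x)) = (\<lambda>x. (f s x - f0 x) + (g0 x - g s x))"
      by (auto simp: algebra_simps)
    then show "norm (l2_norm U (\<lambda>x. (f s x - g s x) - (f0 x - g0 x)))
      \<le> l2_norm U (\<lambda>x. f s x - f0 x) + l2_norm U (\<lambda>x. g0 x - g s x)"
      using l2_norm_triangle[OF L2vec_diff[OF f[OF s] f0] L2vec_diff[OF g0 g[OF s]]]
      by (simp add: l2_norm_nonneg)
  qed
qed

text \<open>All conditions on an energy path are linear, so the continuity and differentiability
  results of the locale become available for the difference of two solutions.\<close>

lemma energy_path_diff:
  assumes "energy_path U T u G U1" "energy_path U T v K V1"
  shows "energy_path U T (\<lambda>t x. u t x - v t x) (\<lambda>t x. G t x - K t x) (\<lambda>t x. U1 t x - V1 t x)"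
proof -
  interpret P: energy_path U T u G U1 by fact
  interpret Q: energy_path U T v K V1 by fact
  show ?thesis
  proof
    fix t assume t: "t \<in> {0..T}"
    show "H01_pair U (\<lambda>x. u t x - v t x) (\<lambda>x. G t x - K t x)"
      by (rule H01_pair_diff[OF P.Um P.pair[OF t] Q.pair[OF t]])
    show "L2vec U (\<lambda>x. U1 t x - V1 t x)" by (rule L2vec_diff[OF P.U1[OF t] Q.U1[OF t]])
    show "((\<lambda>s. l2_norm U (\<lambda>x. u s x - v s x - (u t x - v t x))) \<longlongrightarrow> 0) (at t within {0..T})"
      by (rule tendsto_l2_norm_diff[OF P.u_L2 Q.u_L2 P.u_L2[OF t] Q.u_L2[OF t] P.ev_in P.u_lim[OF t] Q.u_lim[OF t]])
    show "((\<lambda>s. l2_norm U (\<lambda>x. G s x - K s x - (G t x - K t x))) \<longlongrightarrow> 0) (at t within {0..T})"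
      by (rule tendsto_l2_norm_diff[OF P.G_L2 Q.G_L2 P.G_L2[OF t] Q.G_L2[OF t] P.ev_in P.G_lim[OF t] Q.G_lim[OF t]])
    show "((\<lambda>s. l2_norm U (\<lambda>x. U1 s x - V1 s x - (U1 t x - V1 t x))) \<longlongrightarrow> 0) (at t within {0..T})"
      by (rule tendsto_l2_norm_diff[OF P.U1 Q.U1 P.U1[OF t] Q.U1[OF t] P.ev_in P.U1_lim[OF t] Q.U1_lim[OF t]])
    have "(u s x - v s x - (u t x - v t x)) / (s - t) - (U1 t x - V1 t x) =
       ((u s x - u t x) / (s - t) - (v s x - v t x) / (s - t)) - (U1 t x - V1 t x)" for s x
      by (simp add: diff_divide_distrib)
    then show "((\<lambda>s. l2_norm U (\<lambda>x. (u s x - v s x - (u t x - v t x)) / (s - t) - (U1 t x - V1 t x))) \<longlongrightarrow> 0) (at t within {0..T})"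
      using tendsto_l2_norm_diff[OF P.diff_quot_L2[OF t] Q.diff_quot_L2[OF t] P.U1[OF t] Q.U1[OF t] P.ev_in P.diff_lim[OF t] Q.diff_lim[OF t]]
      by simp
  qed (use P.Um P.T in auto)
qed

text \<open>The hypothesis \<open>eq\<close> is the difference of the two integrated equations, with
  the terms at time 0 already cancelled.\<close>

lemma energy_path_uniqueness:
  assumes P: "energy_path U T u G U1" and Q: "energy_path U T v K V1"
    and am: "a \<in> borel_measurable (lebesgue_on U)" "AE x in lebesgue_on U. \<bar>a x\<bar> \<le> C" "AE x in lebesgue_on U. a x \<ge> 0"
    and Lu: "L4_L12 U T u" and Lv: "L4_L12 U T v"
    and init: "AE x in lebesgue_on U. u 0 x = v 0 x"
    and eq: "\<And>\<psi> r. test_fun U \<psi> \<Longrightarrow> r \<in> {0..T} \<Longrightarrow>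
        l2_inner U (\<lambda>x. U1 r x - V1 r x) \<psi> + l2_inner U (\<lambda>x. G r x - K r x) (\<lambda>x. a x *\<^sub>R cgrad \<psi> x)
        + integral {0..r} (\<lambda>\<tau>. l2_inner U (\<lambda>x. G \<tau> x - K \<tau> x) (cgrad \<psi>)
            + ((\<integral>x. u \<tau> x ^ 5 * \<psi> x \<partial>lebesgue_on U) - (\<integral>x. v \<tau> x ^ 5 * \<psi> x \<partial>lebesgue_on U))) = 0"
    and t: "t \<in> {0..T}"
  shows "AE x in lebesgue_on U. u t x = v t x"
proof -
  interpret P: energy_path U T u G U1 by fact
  interpret Q: energy_path U T v K V1 by fact
  define w where "w = (\<lambda>t x. u t x - v t x)"
  define H where "H = (\<lambda>t x. G t x - K t x)"
  define W where "W = (\<lambda>t x. U1 t x - V1 t x)"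
  interpret W: energy_path U T w H W
    unfolding w_def H_def W_def by (rule energy_path_diff[OF P Q])
  note Um = P.Um and T = P.T
  define Fi where "Fi \<tau> \<zeta> = (\<integral>x. u \<tau> x ^ 5 * \<zeta> x \<partial>lebesgue_on U) - (\<integral>x. v \<tau> x ^ 5 * \<zeta> x \<partial>lebesgue_on U)" for \<tau> \<zeta>
  obtain B1 where B1: "\<And>t. t \<in> {0..T} \<Longrightarrow> l2_norm U (G t) \<le> B1"
    using P.bounded_on_interval[OF P.cont_norm_G l2_norm_nonneg] by blast
  obtain B2 where B2: "\<And>t. t \<in> {0..T} \<Longrightarrow> l2_norm U (K t) \<le> B2"
    using P.bounded_on_interval[OF Q.cont_norm_G l2_norm_nonneg] by blast
  obtain BH where BH: "BH \<ge> 0" "\<And>t. t \<in> {0..T} \<Longrightarrow> l2_norm U (H t) \<le> BH"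
    using P.bounded_on_interval[OF W.cont_norm_G l2_norm_nonneg] by blast
  define B where "B = 4096 * (\<bar>B1\<bar> ^ 5 + \<bar>B2\<bar> ^ 5)"
  have B0: "B \<ge> 0" by (simp add: B_def)
  \<comment> \<open>Uniform in \<tau> and in terms of the gradient alone: the nonlinear term is a
    bounded functional on H01, as the density argument and Fubini require.\<close>
  have Fi_bnd: "\<bar>Fi \<tau> \<zeta>\<bar> \<le> B * l2_norm U \<xi>" if \<tau>: "\<tau> \<in> {0..T}" and \<zeta>: "H01_pair U \<zeta> \<xi>" for \<tau> \<zeta> \<xi>
  proof -
    have p: "l2_norm U (G \<tau>) ^ 5 \<le> \<bar>B1\<bar> ^ 5" "l2_norm U (K \<tau>) ^ 5 \<le> \<bar>B2\<bar> ^ 5"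
      using B1[OF \<tau>] B2[OF \<tau>] by (auto intro!: power_mono simp: l2_norm_nonneg)
    have "\<bar>Fi \<tau> \<zeta>\<bar> \<le> 4096 * l2_norm U (G \<tau>) ^ 5 * l2_norm U \<xi> + 4096 * l2_norm U (K \<tau>) ^ 5 * l2_norm U \<xi>"
      using quintic_pair_bound[OF Um P.pair[OF \<tau>] \<zeta>] quintic_pair_bound[OF Um Q.pair[OF \<tau>] \<zeta>]
      unfolding Fi_def by linarith
    also have "\<dots> \<le> 4096 * \<bar>B1\<bar> ^ 5 * l2_norm U \<xi> + 4096 * \<bar>B2\<bar> ^ 5 * l2_norm U \<xi>"
      using p by (intro add_mono mult_right_mono mult_left_mono) (auto simp: l2_norm_nonneg)
    also have "\<dots> = B * l2_norm U \<xi>" by (simp add: B_def algebra_simps)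
    finally show ?thesis .
  qed
  have Fi_m: "(\<lambda>\<tau>. Fi \<tau> \<zeta>) \<in> borel_measurable (lebesgue_on {0..T})" if "H01_pair U \<zeta> \<xi>" for \<zeta> \<xi>
    unfolding Fi_def by (intro borel_measurable_diff P.quintic_measurable[OF that] Q.quintic_measurable[OF that])
  have Fi_int: "(\<lambda>\<tau>. Fi \<tau> \<zeta>) integrable_on {0..r}" if \<zeta>: "H01_pair U \<zeta> \<xi>" and r: "r \<in> {0..T}" for \<zeta> \<xi> r
  proof -
    interpret finite_measure "lebesgue_on {0..T}" by (rule finite_measure_lebesgue_on) (rule lmeasurable_interval)
    have "integrable (lebesgue_on {0..T}) (\<lambda>\<tau>. Fi \<tau> \<zeta>)"
      by (rule integrable_const_bound[of _ "B * l2_norm U \<xi>"]) (use Fi_m[OF \<zeta>] Fi_bnd[OF _ \<zeta>] in \<open>auto intro!: AE_I2\<close>)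
    then have "(\<lambda>\<tau>. Fi \<tau> \<zeta>) integrable_on {0..T}" using integrable_on_lebesgue_on by fastforce
    then show ?thesis by (rule integrable_subinterval_real) (use r in auto)
  qed
  have Fi_diff: "Fi \<tau> (\<lambda>x. \<zeta> x - \<zeta>' x) = Fi \<tau> \<zeta> - Fi \<tau> \<zeta>'"
    if "\<tau> \<in> {0..T}" "H01_pair U \<zeta> \<xi>" "H01_pair U \<zeta>' \<xi>'" for \<tau> \<zeta> \<xi> \<zeta>' \<xi>'
    unfolding Fi_def right_diff_distrib
    using quintic_integrable[OF Um P.pair[OF that(1)] that(2)] quintic_integrable[OF Um P.pair[OF that(1)] that(3)]
      quintic_integrable[OF Um Q.pair[OF that(1)] that(2)] quintic_integrable[OF Um Q.pair[OF that(1)] that(3)]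
    by simp
  have Fi_sum: "Fi \<tau> (\<lambda>x. \<Sum>i<n. d * \<zeta> i x) = d * (\<Sum>i<n. Fi \<tau> (\<zeta> i))"
    if \<tau>: "\<tau> \<in> {0..T}" and \<zeta>: "\<And>i. i < n \<Longrightarrow> H01_pair U (\<zeta> i) (\<xi> i)" for \<tau> d and n :: nat and \<zeta> \<xi>
  proof -
    have gen: "(\<integral>x. y x ^ 5 * (\<Sum>i<n. d * \<zeta> i x) \<partial>lebesgue_on U) = d * (\<Sum>i<n. \<integral>x. y x ^ 5 * \<zeta> i x \<partial>lebesgue_on U)"
      if y: "H01_pair U y \<gamma>" for y \<gamma>
    proof -
      have "(\<integral>x. y x ^ 5 * (\<Sum>i<n. d * \<zeta> i x) \<partial>lebesgue_on U) = (\<integral>x. (\<Sum>i<n. d * (y x ^ 5 * \<zeta> i x)) \<partial>lebesgue_on U)"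
        by (simp add: sum_distrib_left mult_ac)
      also have "\<dots> = (\<Sum>i<n. \<integral>x. d * (y x ^ 5 * \<zeta> i x) \<partial>lebesgue_on U)"
        by (rule Bochner_Integration.integral_sum) (use quintic_integrable[OF Um y \<zeta>] in auto)
      also have "\<dots> = d * (\<Sum>i<n. \<integral>x. y x ^ 5 * \<zeta> i x \<partial>lebesgue_on U)"
        by (simp add: sum_distrib_left)
      finally show ?thesis .
    qed
    show ?thesis
      unfolding Fi_def gen[OF P.pair[OF \<tau>]] gen[OF Q.pair[OF \<tau>]]
      by (simp add: sum_subtractf right_diff_distrib)
  qed
  have aL: "L2vec U (\<lambda>x. a x *\<^sub>R g x)" if "L2vec U g" for g :: "real^3 \<Rightarrow> real^3"
    by (rule L2vec_bounded_mult[OF that am(1,2)])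
  have a_sw: "l2_inner U f (\<lambda>x. a x *\<^sub>R g x) = l2_inner U (\<lambda>x. a x *\<^sub>R f x) g" for f g :: "real^3 \<Rightarrow> real^3"
    by (simp add: l2_inner_def)
  \<comment> \<open>Function and gradient are separate arguments, which makes \<open>L r\<close>
    linear and continuous on pairs; \<open>a\<close> is moved to the side of \<open>H r\<close> for
    this purpose.\<close>
  define L where "L r \<zeta> \<xi> = l2_inner U (W r) \<zeta> + l2_inner U (\<lambda>x. a x *\<^sub>R H r x) \<xi>
     + integral {0..r} (\<lambda>\<tau>. l2_inner U (H \<tau>) \<xi> + Fi \<tau> \<zeta>)" for r \<zeta> \<xi>
  have HI: "(\<lambda>\<tau>. l2_inner U (H \<tau>) \<xi>) integrable_on {0..r}" if "L2vec U \<xi>" "r \<in> {0..T}" for \<xi> r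
    by (rule integrable_continuous_real[OF continuous_on_subset[OF W.cont_G[OF that(1)]]]) (use that in auto)
  have L0: "L r \<phi> (cgrad \<phi>) = 0" if "test_fun U \<phi>" "r \<in> {0..T}" for r \<phi>
    using eq[OF that] unfolding L_def W_def H_def Fi_def a_sw .
  have L_diff: "L r (\<lambda>x. \<zeta> x - \<zeta>' x) (\<lambda>x. \<xi> x - \<xi>' x) = L r \<zeta> \<xi> - L r \<zeta>' \<xi>'"
    if r: "r \<in> {0..T}" and p: "H01_pair U \<zeta> \<xi>" and p': "H01_pair U \<zeta>' \<xi>'" for r \<zeta> \<xi> \<zeta>' \<xi>'
  proof -
    note l = H01_pair_L2vec[OF p] H01_pair_L2vec[OF p']
    have "integral {0..r} (\<lambda>\<tau>. l2_inner U (H \<tau>) (\<lambda>x. \<xi> x - \<xi>' x) + Fi \<tau> (\<lambda>x. \<zeta> x - \<zeta>' x)) =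
      integral {0..r} (\<lambda>\<tau>. (l2_inner U (H \<tau>) \<xi> + Fi \<tau> \<zeta>) - (l2_inner U (H \<tau>) \<xi>' + Fi \<tau> \<zeta>'))"
    proof (rule Henstock_Kurzweil_Integration.integral_cong)
      fix \<tau> assume "\<tau> \<in> {0..r}"
      then have \<tau>: "\<tau> \<in> {0..T}" using r by auto
      show "l2_inner U (H \<tau>) (\<lambda>x. \<xi> x - \<xi>' x) + Fi \<tau> (\<lambda>x. \<zeta> x - \<zeta>' x) =
        (l2_inner U (H \<tau>) \<xi> + Fi \<tau> \<zeta>) - (l2_inner U (H \<tau>) \<xi>' + Fi \<tau> \<zeta>')"
        using Fi_diff[OF \<tau> p p'] l2_inner_diff_right[OF l(2) l(4) W.G_L2[OF \<tau>]] by simp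
    qed
    also have "\<dots> = integral {0..r} (\<lambda>\<tau>. l2_inner U (H \<tau>) \<xi> + Fi \<tau> \<zeta>) - integral {0..r} (\<lambda>\<tau>. l2_inner U (H \<tau>) \<xi>' + Fi \<tau> \<zeta>')"
      by (intro integral_diff integrable_add HI Fi_int[OF p] Fi_int[OF p'] l r)
    finally show ?thesis
      unfolding L_def
      using l2_inner_diff_right[OF l(1) l(3) W.U1[OF r]] l2_inner_diff_right[OF l(2) l(4) aL[OF W.G_L2[OF r]]] by simp
  qed
  have L_bnd: "\<bar>L r \<zeta> \<xi>\<bar> \<le> l2_norm U (W r) * l2_norm U \<zeta> + (l2_norm U (\<lambda>x. a x *\<^sub>R H r x) + T * (BH + B)) * l2_norm U \<xi>"
    if r: "r \<in> {0..T}" and p: "H01_pair U \<zeta> \<xi>" for r \<zeta> \<xi>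
  proof -
    note l = H01_pair_L2vec[OF p]
    have "norm (integral {0..r} (\<lambda>\<tau>. l2_inner U (H \<tau>) \<xi> + Fi \<tau> \<zeta>)) \<le> integral {0..r} (\<lambda>\<tau>. (BH + B) * l2_norm U \<xi>)"
    proof (rule Henstock_Kurzweil_Integration.integral_norm_bound_integral)
      show "(\<lambda>\<tau>. l2_inner U (H \<tau>) \<xi> + Fi \<tau> \<zeta>) integrable_on {0..r}"
        by (intro integrable_add HI Fi_int[OF p] l r)
      fix \<tau> assume "\<tau> \<in> {0..r}"
      then have \<tau>: "\<tau> \<in> {0..T}" using r by auto
      have "\<bar>l2_inner U (H \<tau>) \<xi>\<bar> \<le> BH * l2_norm U \<xi>"
        using l2_Cauchy_Schwarz[OF W.G_L2[OF \<tau>] l(2)] mult_right_mono[OF BH(2)[OF \<tau>] l2_norm_nonneg[of U \<xi>]] by linarith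
      then show "norm (l2_inner U (H \<tau>) \<xi> + Fi \<tau> \<zeta>) \<le> (BH + B) * l2_norm U \<xi>"
        using Fi_bnd[OF \<tau> p] unfolding distrib_right real_norm_def by linarith
    qed (rule integrable_const_ivl)
    also have "\<dots> = r * ((BH + B) * l2_norm U \<xi>)" using r by simp
    also have "\<dots> \<le> T * ((BH + B) * l2_norm U \<xi>)"
      using r BH(1) B0 by (intro mult_right_mono) (auto simp: l2_norm_nonneg)
    finally have "\<bar>integral {0..r} (\<lambda>\<tau>. l2_inner U (H \<tau>) \<xi> + Fi \<tau> \<zeta>)\<bar> \<le> T * (BH + B) * l2_norm U \<xi>"
      by (simp only: real_norm_def mult.assoc)
    then show ?thesis
      using l2_Cauchy_Schwarz[OF W.U1[OF r] l(1)] l2_Cauchy_Schwarz[OF aL[OF W.G_L2[OF r]] l(2)]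
      unfolding L_def distrib_right by linarith
  qed
  \<comment> \<open>The equation extends from test functions to \<open>H01\<close> by density and continuity of \<open>L\<close>.\<close>
  have L_zero: "L r \<zeta> \<xi> = 0" if r: "r \<in> {0..T}" and p: "H01_pair U \<zeta> \<xi>" for r \<zeta> \<xi>
  proof -
    obtain \<phi> where \<phi>: "\<And>n. test_fun U (\<phi> n)" "(\<lambda>n. l2_norm U (\<lambda>x. \<phi> n x - \<zeta> x)) \<longlonglongrightarrow> 0"
       "(\<lambda>n. l2_norm U (\<lambda>x. cgrad (\<phi> n) x - \<xi> x)) \<longlonglongrightarrow> 0"
      using p unfolding H01_pair_def by blast
    have "\<bar>L r \<zeta> \<xi>\<bar> \<le> l2_norm U (W r) * l2_norm U (\<lambda>x. \<phi> n x - \<zeta> x)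
        + (l2_norm U (\<lambda>x. a x *\<^sub>R H r x) + T * (BH + B)) * l2_norm U (\<lambda>x. cgrad (\<phi> n) x - \<xi> x)" for n
    proof -
      note q = H01_pair_test_fun[OF \<phi>(1) Um, of n]
      show ?thesis
        using L_bnd[OF r H01_pair_diff[OF Um q p]] L_diff[OF r q p] L0[OF \<phi>(1) r] by simp
    qed
    moreover have "(\<lambda>n. l2_norm U (W r) * l2_norm U (\<lambda>x. \<phi> n x - \<zeta> x)
        + (l2_norm U (\<lambda>x. a x *\<^sub>R H r x) + T * (BH + B)) * l2_norm U (\<lambda>x. cgrad (\<phi> n) x - \<xi> x)) \<longlonglongrightarrow>
        l2_norm U (W r) * 0 + (l2_norm U (\<lambda>x. a x *\<^sub>R H r x) + T * (BH + B)) * 0"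
      by (intro tendsto_intros \<phi>)
    ultimately have "\<bar>L r \<zeta> \<xi>\<bar> \<le> l2_norm U (W r) * 0 + (l2_norm U (\<lambda>x. a x *\<^sub>R H r x) + T * (BH + B)) * 0"
      by (intro LIMSEQ_le_const) auto
    then show ?thesis by simp
  qed
  let ?k = "\<lambda>p. l2_inner U (H (fst p)) (H (snd p))"
  let ?N = "\<lambda>\<sigma>. integral {0..\<sigma>} (\<lambda>t. integral {0..\<sigma>} (\<lambda>s. ?k (t, s)))"
  have fcont: "continuous_on {0..T} (\<lambda>t. Fi \<tau> (w t))" if \<tau>: "\<tau> \<in> {0..T}" for \<tau>
    unfolding continuous_on_def
  proof
    fix t assume t: "t \<in> {0..T}"
    have "((\<lambda>s. B * l2_norm U (\<lambda>x. H s x - H t x)) \<longlongrightarrow> 0) (at t within {0..T})"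
      using tendsto_mult_right_zero[OF W.G_lim[OF t]] by blast
    then have "((\<lambda>s. Fi \<tau> (w s) - Fi \<tau> (w t)) \<longlongrightarrow> 0) (at t within {0..T})"
    proof (rule Lim_null_comparison[rotated], intro eventually_mono[OF W.ev_in])
      fix s assume s: "s \<in> {0..T}"
      show "norm (Fi \<tau> (w s) - Fi \<tau> (w t)) \<le> B * l2_norm U (\<lambda>x. H s x - H t x)"
        using Fi_bnd[OF \<tau> H01_pair_diff[OF Um W.pair[OF s] W.pair[OF t]]] Fi_diff[OF \<tau> W.pair[OF s] W.pair[OF t]] by simp
    qed
    then show "((\<lambda>t. Fi \<tau> (w t)) \<longlongrightarrow> Fi \<tau> (w t)) (at t within {0..T})" by (simp add: Lim_null[symmetric])
  qed
  \<comment> \<open>Riemann sums \<open>S\<close> of \<open>w\<close>, with gradients \<open>\<Gamma>\<close>, replace the primitive of \<open>w\<close> on \<open>[0,\<sigma>]\<close>.\<close>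
  have sums: "\<exists>S \<Gamma>. (\<forall>n. H01_pair U (S n) (\<Gamma> n)) \<and> (\<lambda>n. L2vsq U (\<Gamma> n)) \<longlonglongrightarrow> ?N \<sigma>
      \<and> (\<forall>\<tau>\<in>{0..T}. (\<lambda>n. Fi \<tau> (S n)) \<longlonglongrightarrow> integral {0..\<sigma>} (\<lambda>t. Fi \<tau> (w t)))" if \<sigma>: "\<sigma> \<in> {0..T}" for \<sigma>
  proof -
    define \<delta> where "\<delta> n = \<sigma> / real (Suc n)" for n
    define S where "S n = (\<lambda>x. \<Sum>i<Suc n. \<delta> n * w (real i * \<delta> n) x)" for n
    define \<Gamma> where "\<Gamma> n = (\<lambda>x. \<Sum>i<Suc n. \<delta> n *\<^sub>R H (real i * \<delta> n) x)" for n
    have pt: "real i * \<delta> n \<in> {0..T}" if "i < Suc n" for i n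
    proof -
      have "real i * \<delta> n \<le> real (Suc n) * \<delta> n" using that \<sigma> by (intro mult_right_mono) (auto simp: \<delta>_def)
      also have "\<dots> = \<sigma>" by (simp add: \<delta>_def)
      finally show ?thesis using \<sigma> by (simp add: \<delta>_def)
    qed
    have pair: "H01_pair U (S n) (\<Gamma> n)" for n
      unfolding S_def \<Gamma>_def by (rule H01_pair_sum[OF Um]) (use pt W.pair in auto)
    \<comment> \<open>Expanding the squared norm of the Riemann sum of gradients gives the double
      sum of the Gram kernel.\<close>
    have k1: "L2vsq U (\<Gamma> n) = (\<delta> n)\<^sup>2 * (\<Sum>i<Suc n. \<Sum>j<Suc n. ?k (real i * \<delta> n, real j * \<delta> n))" for n
    proof -
      let ?h = "\<lambda>i. H (real i * \<delta> n)"
      have h: "L2vec U (?h i)" if "i < Suc n" for i by (rule W.G_L2[OF pt[OF that]])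
      have dh: "L2vec U (\<lambda>x. \<delta> n *\<^sub>R ?h i x)" if "i < Suc n" for i by (rule L2vec_scaleR[OF h[OF that]])
      have G2: "L2vec U (\<Gamma> n)" by (rule H01_pair_L2vec(2)[OF pair])
      have inner: "l2_inner U (?h i) (\<Gamma> n) = (\<Sum>j<Suc n. \<delta> n * ?k (real i * \<delta> n, real j * \<delta> n))" if i: "i < Suc n" for i
      proof -
        have "l2_inner U (\<Gamma> n) (?h i) = (\<Sum>j<Suc n. l2_inner U (\<lambda>x. \<delta> n *\<^sub>R ?h j x) (?h i))"
          unfolding \<Gamma>_def by (rule l2_inner_sum_left) (use dh h i in auto)
        then show ?thesis
          unfolding l2_inner_commute[of U "?h i" "\<Gamma> n"] l2_inner_scaleR_left
          by (simp only: fst_conv snd_conv l2_inner_commute[of U _ "?h i"])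
      qed
      have "L2vsq U (\<Gamma> n) = l2_inner U (\<lambda>x. \<Sum>i<Suc n. \<delta> n *\<^sub>R ?h i x) (\<Gamma> n)"
        unfolding l2_inner_self[symmetric] by (simp only: \<Gamma>_def)
      also have "\<dots> = (\<Sum>i<Suc n. l2_inner U (\<lambda>x. \<delta> n *\<^sub>R ?h i x) (\<Gamma> n))"
        by (rule l2_inner_sum_left) (use dh G2 in auto)
      also have "\<dots> = (\<Sum>i<Suc n. \<delta> n * (\<Sum>j<Suc n. \<delta> n * ?k (real i * \<delta> n, real j * \<delta> n)))"
        unfolding l2_inner_scaleR_left by (rule sum.cong[OF refl]) (use inner in auto)
      also have "\<dots> = (\<delta> n)\<^sup>2 * (\<Sum>i<Suc n. \<Sum>j<Suc n. ?k (real i * \<delta> n, real j * \<delta> n))"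
        by (simp only: sum_distrib_left[symmetric] power2_eq_square mult.assoc)
      finally show ?thesis .
    qed
    have ckk: "continuous_on ({0..\<sigma>} \<times> {0..\<sigma>}) ?k"
      by (rule continuous_on_subset[OF W.cont_GG]) (use \<sigma> in auto)
    have "(\<lambda>n. L2vsq U (\<Gamma> n)) \<longlonglongrightarrow> ?N \<sigma>"
      unfolding k1 \<delta>_def by (rule riemann_sum_limit_2d[OF ckk]) (use \<sigma> in auto)
    moreover have "(\<lambda>n. Fi \<tau> (S n)) \<longlonglongrightarrow> integral {0..\<sigma>} (\<lambda>t. Fi \<tau> (w t))" if \<tau>: "\<tau> \<in> {0..T}" for \<tau>
    proof -
      have "Fi \<tau> (S n) = \<delta> n * (\<Sum>i<Suc n. Fi \<tau> (w (real i * \<delta> n)))" for n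
        unfolding S_def by (rule Fi_sum[OF \<tau> W.pair[OF pt]])
      moreover have "continuous_on {0..\<sigma>} (\<lambda>t. Fi \<tau> (w t))"
        by (rule continuous_on_subset[OF fcont[OF \<tau>]]) (use \<sigma> in auto)
      ultimately show ?thesis
        using riemann_sum_limit[of \<sigma> "\<lambda>t. Fi \<tau> (w t)"] \<sigma> by (simp only: \<delta>_def atLeastAtMost_iff)
    qed
    ultimately show ?thesis using pair by blast
  qed
  define g where "g \<tau> = 20 * (L12_cube U (u \<tau>) + L12_cube U (v \<tau>))" for \<tau>
  have "L2vsq U (w t) = 0"
  proof (rule scalar_energy_uniqueness[OF T, of "\<lambda>t. L2vsq U (w t)" "\<lambda>t. l2_inner U (W t) (w t)" ?k "\<lambda>\<tau> t. Fi \<tau> (w t)" "B * BH" g])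
    show "((\<lambda>t. L2vsq U (w t)) has_real_derivative 2 * l2_inner U (W t) (w t)) (at t within {0..T})" if "t \<in> {0..T}" for t
      by (rule W.deriv_norm_u[OF that])
    show "continuous_on {0..T} (\<lambda>t. l2_inner U (W t) (w t))" by (rule W.cont_U1_u)
    have T0: "0 \<in> {0..T}" using T by simp
    have "L2vsq U (w 0) = L2vsq U (\<lambda>x. 0::real)"
      by (rule L2vsq_cong_AE) (use W.u_L2[OF T0] init in \<open>auto simp: L2vec_def w_def elim!: eventually_mono\<close>)
    then show "L2vsq U (w 0) = 0" by (simp add: L2vsq_def)
    show "continuous_on ({0..T} \<times> {0..T}) ?k" by (rule W.cont_GG)
    show "?k (s, t) = ?k (t, s)" for s t by (simp add: l2_inner_commute)
    show "(\<lambda>\<tau>. Fi \<tau> (w t)) \<in> borel_measurable (lebesgue_on {0..T})" if "t \<in> {0..T}" for t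
      by (rule Fi_m[OF W.pair[OF that]])
    show "continuous_on {0..T} (\<lambda>t. Fi \<tau> (w t))" if "\<tau> \<in> {0..T}" for \<tau> by (rule fcont[OF that])
    show "\<bar>Fi \<tau> (w t)\<bar> \<le> B * BH" if "\<tau> \<in> {0..T}" "t \<in> {0..T}" for \<tau> t
      using Fi_bnd[OF that(1) W.pair[OF that(2)]] mult_left_mono[OF BH(2)[OF that(2)] B0] by linarith
    show "l2_inner U (W t) (w t) + integral {0..t} (\<lambda>\<tau>. ?k (\<tau>, t)) + integral {0..t} (\<lambda>\<tau>. Fi \<tau> (w t)) \<le> 0" if t: "t \<in> {0..T}" for t
    proof -
      have "integral {0..t} (\<lambda>\<tau>. l2_inner U (H \<tau>) (H t) + Fi \<tau> (w t)) = integral {0..t} (\<lambda>\<tau>. l2_inner U (H \<tau>) (H t)) + integral {0..t} (\<lambda>\<tau>. Fi \<tau> (w t))"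
        by (rule integral_add[OF HI[OF W.G_L2[OF t] t] Fi_int[OF W.pair[OF t] t]])
      moreover have "0 \<le> l2_inner U (\<lambda>x. a x *\<^sub>R H t x) (H t)"
        unfolding l2_inner_def by (rule integral_nonneg_AE) (use am(3) in \<open>auto elim!: eventually_mono\<close>)
      ultimately show ?thesis using L_zero[OF t W.pair[OF t]] unfolding L_def by simp
    qed
    \<comment> \<open>\<open>?N\<close> is a double integral of a kernel without a sign; it is
      nonnegative as a limit of squared norms.\<close>
    show "0 \<le> ?N \<sigma>" if "\<sigma> \<in> {0..T}" for \<sigma>
      using sums[OF that] L2vsq_nonneg by (metis (no_types, lifting) LIMSEQ_le_const)
    show "integrable (lebesgue_on {0..T}) g"
      using Lu Lv unfolding g_def L4_L12_def L12_cube_def by auto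
    show "0 \<le> g t" for t by (simp add: g_def L12_cube_def)
    have ae: "AE \<tau> in lebesgue_on {0..T}. integrable (lebesgue_on U) (\<lambda>x. \<bar>u \<tau> x\<bar> powr 12)"
      "AE \<tau> in lebesgue_on {0..T}. integrable (lebesgue_on U) (\<lambda>x. \<bar>v \<tau> x\<bar> powr 12)"
      using Lu Lv unfolding L4_L12_def by (auto elim: AE_mp)
    have aeT: "AE \<tau> in lebesgue_on {0..T}. \<tau> \<in> {0..T}" by (rule AE_I2) simp
    show "AE \<tau> in lebesgue_on {0..T}. \<forall>\<sigma>\<in>{0..T}. \<bar>integral {0..\<sigma>} (\<lambda>t. Fi \<tau> (w t))\<bar> \<le> g \<tau> * sqrt (L2vsq U (w \<tau>)) * sqrt (?N \<sigma>)"
      using ae(1) ae(2) aeT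
    proof eventually_elim
      case (elim \<tau>)
      note \<tau> = elim(3)
      show ?case
      proof
        \<comment> \<open>The exceptional set of \<tau> is fixed before \<sigma> is chosen, so all
          \<sigma> are treated at once and no uncountable union of null sets arises.\<close>
        fix \<sigma> assume \<sigma>: "\<sigma> \<in> {0..T}"
        obtain S \<Gamma> where S: "\<And>n. H01_pair U (S n) (\<Gamma> n)" "(\<lambda>n. L2vsq U (\<Gamma> n)) \<longlonglongrightarrow> ?N \<sigma>"
          "(\<lambda>n. Fi \<tau> (S n)) \<longlonglongrightarrow> integral {0..\<sigma>} (\<lambda>t. Fi \<tau> (w t))"
          using sums[OF \<sigma>] \<tau> by blast
        have "\<bar>Fi \<tau> (S n)\<bar> \<le> g \<tau> * sqrt (L2vsq U (w \<tau>)) * sqrt (L2vsq U (\<Gamma> n))" for n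
        proof -
          have "Fi \<tau> (S n) = (\<integral>x. (u \<tau> x ^ 5 - v \<tau> x ^ 5) * S n x \<partial>lebesgue_on U)"
            unfolding Fi_def left_diff_distrib
            using quintic_integrable[OF Um P.pair[OF \<tau>] S(1)] quintic_integrable[OF Um Q.pair[OF \<tau>] S(1)] by simp
          then show ?thesis
            using quintic_diff_integral_bound[OF Um S(1) P.u_L2[OF \<tau>] Q.u_L2[OF \<tau>] elim(1,2)]
            unfolding g_def w_def l2_norm_def by simp
        qed
        moreover have "(\<lambda>n. \<bar>Fi \<tau> (S n)\<bar>) \<longlonglongrightarrow> \<bar>integral {0..\<sigma>} (\<lambda>t. Fi \<tau> (w t))\<bar>"
          by (rule tendsto_rabs[OF S(3)])
        moreover have "(\<lambda>n. g \<tau> * sqrt (L2vsq U (w \<tau>)) * sqrt (L2vsq U (\<Gamma> n))) \<longlonglongrightarrow> g \<tau> * sqrt (L2vsq U (w \<tau>)) * sqrt (?N \<sigma>)"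
          by (intro tendsto_intros S(2))
        ultimately show "\<bar>integral {0..\<sigma>} (\<lambda>t. Fi \<tau> (w t))\<bar> \<le> g \<tau> * sqrt (L2vsq U (w \<tau>)) * sqrt (?N \<sigma>)"
          by (intro LIMSEQ_le) auto
      qed
    qed
  qed (use t L2vsq_nonneg in auto)
  from L2vsq_eq_0_AE[OF W.u_L2[OF t] this] show ?thesis
    unfolding w_def by (auto elim!: eventually_mono)
qed

text \<open>The locale \<open>energy_path\<close> forgets that \<open>G\<close> is a weak gradient.
  This information is kept at time 0, where the gradients of two solutions have to be
  compared.\<close>

lemma energy_solution_path:
  assumes "energy_solution \<Omega> a T u0 u1 u" "open \<Omega>" "\<Omega> \<in> lmeasurable" "T > 0"
  shows "\<exists>G U1. energy_path \<Omega> T u G U1 \<and> weak_grad \<Omega> (u 0) (G 0) \<and>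
    (AE x in lebesgue_on \<Omega>. u 0 x = u0 x) \<and> (AE x in lebesgue_on \<Omega>. U1 0 x = u1 x) \<and>
    (\<forall>\<phi>. test_fun (\<Omega> \<times> {0<..<T}) \<phi> \<longrightarrow>
         (\<integral>t. (\<integral>x. u t x * dt (dt \<phi>) (x, t) + G t x \<bullet> gradx \<phi> (x, t)
                      - a x * (G t x \<bullet> gradx (dt \<phi>) (x, t)) + (u t x) ^ 5 * \<phi> (x, t)
                  \<partial>lebesgue_on \<Omega>) \<partial>lebesgue_on {0..T}) = 0)"
proof -
  obtain G U1 where
    1: "\<forall>t\<in>{0..T}. H01 \<Omega> (u t) \<and> weak_grad \<Omega> (u t) (G t) \<and> L2vec \<Omega> (G t) \<and> L2 \<Omega> (U1 t)"
    and 2: "\<forall>t\<in>{0..T}. ((\<lambda>s. L2sq \<Omega> (\<lambda>x. u s x - u t x) + L2vsq \<Omega> (\<lambda>x. G s x - G t x)) \<longlongrightarrow> 0) (at t within {0..T})"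
    and 3: "\<forall>t\<in>{0..T}. ((\<lambda>s. L2sq \<Omega> (\<lambda>x. U1 s x - U1 t x)) \<longlongrightarrow> 0) (at t within {0..T})"
    and 4: "\<forall>t\<in>{0..T}. ((\<lambda>s. L2sq \<Omega> (\<lambda>x. (u s x - u t x) / (s - t) - U1 t x)) \<longlongrightarrow> 0) (at t within {0..T})"
    and 5: "AE x in lebesgue_on \<Omega>. u 0 x = u0 x" "AE x in lebesgue_on \<Omega>. U1 0 x = u1 x"
    and 6: "\<forall>\<phi>. test_fun (\<Omega> \<times> {0<..<T}) \<phi> \<longrightarrow>
         (\<integral>t. (\<integral>x. u t x * dt (dt \<phi>) (x, t) + G t x \<bullet> gradx \<phi> (x, t)
                      - a x * (G t x \<bullet> gradx (dt \<phi>) (x, t)) + (u t x) ^ 5 * \<phi> (x, t)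
                  \<partial>lebesgue_on \<Omega>) \<partial>lebesgue_on {0..T}) = 0"
    using assms(1) unfolding energy_solution_def by (elim exE conjE) (rule that, assumption+)
  have "energy_path \<Omega> T u G U1"
  proof
    fix t assume t: "t \<in> {0..T}"
    show "H01_pair \<Omega> (u t) (G t)" using 1 t by (intro H01_pairI assms) auto
    show "L2vec \<Omega> (U1 t)" using 1 t by (simp add: L2_eq_L2vec)
    note lim = bspec[OF 2 t, unfolded L2sq_eq_L2vsq]
    show "((\<lambda>s. l2_norm \<Omega> (\<lambda>x. u s x - u t x)) \<longlongrightarrow> 0) (at t within {0..T})"
      unfolding tendsto_l2_norm_iff[symmetric]
      by (rule Lim_null_comparison[OF _ lim]) (auto simp: L2vsq_nonneg)
    show "((\<lambda>s. l2_norm \<Omega> (\<lambda>x. G s x - G t x)) \<longlongrightarrow> 0) (at t within {0..T})"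
      unfolding tendsto_l2_norm_iff[symmetric]
      by (rule Lim_null_comparison[OF _ lim]) (auto simp: L2vsq_nonneg)
    show "((\<lambda>s. l2_norm \<Omega> (\<lambda>x. U1 s x - U1 t x)) \<longlongrightarrow> 0) (at t within {0..T})"
      unfolding tendsto_l2_norm_iff[symmetric] using 3 t by (simp add: L2sq_eq_L2vsq)
    show "((\<lambda>s. l2_norm \<Omega> (\<lambda>x. (u s x - u t x) / (s - t) - U1 t x)) \<longlongrightarrow> 0) (at t within {0..T})"
      unfolding tendsto_l2_norm_iff[symmetric] using 4 t by (simp add: L2sq_eq_L2vsq)
  qed (use assms in auto)
  moreover have "weak_grad \<Omega> (u 0) (G 0)" using 1 assms(4) by simp
  ultimately show ?thesis using 5 6 by blast
qed

theorem theorem4p2: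
  fixes \<Omega> :: "(real^3) set" and a u0 u1 :: "real^3 \<Rightarrow> real" and T :: real
    and u v :: "real \<Rightarrow> real^3 \<Rightarrow> real"
  assumes "smooth_domain \<Omega>"
    and "W1inf \<Omega> a" and "AE x in lebesgue_on \<Omega>. a x \<ge> 0"
    and "T > 0"
    and "H01 \<Omega> u0" and "L2 \<Omega> u1"
    and "energy_solution \<Omega> a T u0 u1 u" and "energy_solution \<Omega> a T u0 u1 v"
    and "L4_L12 \<Omega> T u" and "L4_L12 \<Omega> T v"
  shows "\<forall>t\<in>{0..T}. AE x in lebesgue_on \<Omega>. u t x = v t x"
proof
  fix t assume t: "t \<in> {0..T}"
  have op: "open \<Omega>" and bd: "bounded \<Omega>" using assms(1) unfolding smooth_domain_def by blast+
  have Om: "\<Omega> \<in> lmeasurable" by (rule lmeasurable_open[OF bd op])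
  have T0: "0 \<in> {0..T}" using assms(4) by simp
  obtain C where am: "a \<in> borel_measurable (lebesgue_on \<Omega>)" "AE x in lebesgue_on \<Omega>. \<bar>a x\<bar> \<le> C"
    using assms(2) unfolding W1inf_def by blast
  obtain G U1 where u: "energy_path \<Omega> T u G U1" "weak_grad \<Omega> (u 0) (G 0)"
    "AE x in lebesgue_on \<Omega>. u 0 x = u0 x" "AE x in lebesgue_on \<Omega>. U1 0 x = u1 x"
    and wu: "\<forall>\<phi>. test_fun (\<Omega> \<times> {0<..<T}) \<phi> \<longrightarrow>
         (\<integral>t. (\<integral>x. u t x * dt (dt \<phi>) (x, t) + G t x \<bullet> gradx \<phi> (x, t)
                      - a x * (G t x \<bullet> gradx (dt \<phi>) (x, t)) + (u t x) ^ 5 * \<phi> (x, t)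
                  \<partial>lebesgue_on \<Omega>) \<partial>lebesgue_on {0..T}) = 0"
    using energy_solution_path[OF assms(7) op Om assms(4)] by (elim exE conjE)
  obtain K V1 where v: "energy_path \<Omega> T v K V1" "weak_grad \<Omega> (v 0) (K 0)"
    "AE x in lebesgue_on \<Omega>. v 0 x = u0 x" "AE x in lebesgue_on \<Omega>. V1 0 x = u1 x"
    and wv: "\<forall>\<phi>. test_fun (\<Omega> \<times> {0<..<T}) \<phi> \<longrightarrow>
         (\<integral>t. (\<integral>x. v t x * dt (dt \<phi>) (x, t) + K t x \<bullet> gradx \<phi> (x, t)
                      - a x * (K t x \<bullet> gradx (dt \<phi>) (x, t)) + (v t x) ^ 5 * \<phi> (x, t)
                  \<partial>lebesgue_on \<Omega>) \<partial>lebesgue_on {0..T}) = 0"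
    using energy_solution_path[OF assms(8) op Om assms(4)] by (elim exE conjE)
  interpret P: energy_path \<Omega> T u G U1 by (rule u(1))
  interpret Q: energy_path \<Omega> T v K V1 by (rule v(1))
  have init: "AE x in lebesgue_on \<Omega>. u 0 x = v 0 x"
    using u(3) v(3) by eventually_elim simp
  \<comment> \<open>The initial gradients are determined by the common initial value, so the terms
    with \<open>a\<close> at time 0 cancel when the two integrated equations are subtracted.\<close>
  have G0: "AE x in lebesgue_on \<Omega>. G 0 x = K 0 x"
    by (rule weak_grad_unique[OF op Om u(2) v(2) P.G_L2[OF T0] Q.G_L2[OF T0] init])
  have V0: "AE x in lebesgue_on \<Omega>. U1 0 x = V1 0 x"
    using u(4) v(4) by eventually_elim simp
  have cong: "l2_inner \<Omega> f h = l2_inner \<Omega> g h"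
    if "L2vec \<Omega> f" "L2vec \<Omega> g" "L2vec \<Omega> h" "AE x in lebesgue_on \<Omega>. f x = g x"
    for f g h :: "real^3 \<Rightarrow> 'b::euclidean_space"
    unfolding l2_inner_def
    by (rule integral_cong_AE) (use that in \<open>auto simp: L2vec_def elim!: eventually_mono\<close>)
  show "AE x in lebesgue_on \<Omega>. u t x = v t x"
  proof (rule energy_path_uniqueness[OF u(1) v(1) am assms(3,9,10) init _ t])
    fix \<psi> r assume \<psi>: "test_fun \<Omega> \<psi>" and r: "r \<in> {0..T}"
    have p: "L2vec \<Omega> \<psi>" and g: "L2vec \<Omega> (cgrad \<psi>)" and pp: "H01_pair \<Omega> \<psi> (cgrad \<psi>)"
      using test_fun_L2vec[OF \<psi> Om] cgrad_L2vec[OF \<psi> Om] H01_pair_test_fun[OF \<psi> Om] by auto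
    have ag: "L2vec \<Omega> (\<lambda>x. a x *\<^sub>R cgrad \<psi> x)" by (rule L2vec_bounded_mult[OF g am])
    have sub: "{0..r} \<subseteq> {0..T}" using r by auto
    let ?fu = "\<lambda>\<tau>. l2_inner \<Omega> (G \<tau>) (cgrad \<psi>) + (\<integral>x. u \<tau> x ^ 5 * \<psi> x \<partial>lebesgue_on \<Omega>)"
    let ?fv = "\<lambda>\<tau>. l2_inner \<Omega> (K \<tau>) (cgrad \<psi>) + (\<integral>x. v \<tau> x ^ 5 * \<psi> x \<partial>lebesgue_on \<Omega>)"
    have "integrable (lebesgue_on {0..T}) ?fu" "integrable (lebesgue_on {0..T}) ?fv"
      by (intro Bochner_Integration.integrable_add continuous_integrable_interval P.cont_G Q.cont_G g
          P.quintic_time_integrable[OF pp assms(9)] Q.quintic_time_integrable[OF pp assms(10)])+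
    then have "?fu integrable_on {0..T}" "?fv integrable_on {0..T}"
      using integrable_on_lebesgue_on by fastforce+
    then have iuv: "?fu integrable_on {0..r}" "?fv integrable_on {0..r}"
      using integrable_subinterval_real[OF _ sub] by blast+
    have "integral {0..r} (\<lambda>\<tau>. l2_inner \<Omega> (\<lambda>x. G \<tau> x - K \<tau> x) (cgrad \<psi>)
            + ((\<integral>x. u \<tau> x ^ 5 * \<psi> x \<partial>lebesgue_on \<Omega>) - (\<integral>x. v \<tau> x ^ 5 * \<psi> x \<partial>lebesgue_on \<Omega>)))
        = integral {0..r} (\<lambda>\<tau>. ?fu \<tau> - ?fv \<tau>)"
    proof (rule Henstock_Kurzweil_Integration.integral_cong)
      fix \<tau> assume "\<tau> \<in> {0..r}"
      then have \<tau>: "\<tau> \<in> {0..T}" using sub by auto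
      show "l2_inner \<Omega> (\<lambda>x. G \<tau> x - K \<tau> x) (cgrad \<psi>)
            + ((\<integral>x. u \<tau> x ^ 5 * \<psi> x \<partial>lebesgue_on \<Omega>) - (\<integral>x. v \<tau> x ^ 5 * \<psi> x \<partial>lebesgue_on \<Omega>)) = ?fu \<tau> - ?fv \<tau>"
        using l2_inner_diff_left[OF P.G_L2[OF \<tau>] Q.G_L2[OF \<tau>] g] by simp
    qed
    also have "\<dots> = integral {0..r} ?fu - integral {0..r} ?fv" by (rule integral_diff[OF iuv])
    finally show "l2_inner \<Omega> (\<lambda>x. U1 r x - V1 r x) \<psi> + l2_inner \<Omega> (\<lambda>x. G r x - K r x) (\<lambda>x. a x *\<^sub>R cgrad \<psi> x)
        + integral {0..r} (\<lambda>\<tau>. l2_inner \<Omega> (\<lambda>x. G \<tau> x - K \<tau> x) (cgrad \<psi>)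
            + ((\<integral>x. u \<tau> x ^ 5 * \<psi> x \<partial>lebesgue_on \<Omega>) - (\<integral>x. v \<tau> x ^ 5 * \<psi> x \<partial>lebesgue_on \<Omega>))) = 0"
      using P.integrated_equation[OF am assms(9) \<psi> r wu[rule_format]] Q.integrated_equation[OF am assms(10) \<psi> r wv[rule_format]]
        cong[OF P.U1[OF T0] Q.U1[OF T0] p V0] cong[OF P.G_L2[OF T0] Q.G_L2[OF T0] ag G0]
        l2_inner_diff_left[OF P.U1[OF r] Q.U1[OF r] p] l2_inner_diff_left[OF P.G_L2[OF r] Q.G_L2[OF r] ag]
      by linarith
  qed
qed

end
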